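(* Let $(X,\mu)$ be a $\sigma$-finite measure space with $\mu(X)=b\in(0,\infty]$, and put $I_b:=(0,b)$. Fix $p$ with $1<p<\infty$, let $p'=\frac{p}{p-1}$, and suppose $\phi$ is a non-trivial weight function on $I_b$. Define $$\psi(t):=\frac{t^{p+p'-1}\int_0^t\phi(s)\,ds\,\int_t^b\phi(s)s^{-p}\,ds}{\left[\int_0^t\phi(s)\,ds+t^p\int_t^b\phi(s)s^{-p}\,ds\right]^{p'+1}},\qquad t\in I_b .$$ Then $$\rho_{p,\phi}'(g)\approx\rho_{p',\psi}(g)+\frac{\int_X|g|\,d\mu}{\left[\int_{I_b}\phi(t)\,dt\right]^{1/p}},\qquad g\in\mathfrak M(X),$$ that is, there is a constant $C\ge1$, independent of $g$, such that each side is at most $C$ times the other for every $g\in\mathfrak M(X)$.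
   Context: $\mathfrak M(X)$ is the set of $\mu$-measurable real-valued functions on $X$. For $f\in\mathfrak M(X)$ let $\mu_f(\lambda):=\mu(\{x\in X:|f(x)|>\lambda\})$, $f^*(t):=\inf\{\lambda>0:\mu_f(\lambda)\le t\}$ and $f^{**}(t):=t^{-1}\int_0^tf^*(s)\,ds$ for $t\in I_b=(0,b)$. A weight on $I_b$ is a positive locally integrable function; it is integrable on $(0,t)$ for every finite $t\le b$. For an index $1<r<\infty$ and a weight $w$ on $I_b$, $\rho_{r,w}(f):=\left[\int_0^bf^{**}(t)^rw(t)\,dt\right]^{1/r}$, $f\in\mathfrak M(X)$ (possibly $+\infty$); the same formula defines $\rho_{p',\psi}$ for the function $\psi$ in the statement. The weight $\phi$ is called non-trivial (with respect to $p$) if $\int_1^\infty\phi(t)t^{-p}\,dt<\infty$ in case $b=\infty$, and $\int_0^c\phi(t)t^{-p}\,dt=\infty$ for all finite $c$ with $0<c\le b$. The associate (Köthe dual) norm is $\rho_{p,\phi}'(g):=\sup\{\int_X|fg|\,d\mu: f\in\mathfrak M(X),\ \rho_{p,\phi}(f)\le1\}$. If $\int_{I_b}\phi=\infty$, the last term on the right-hand side of the equivalence is read as $0$. *)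

theory Defs
  imports "HOL-Analysis.Analysis"
begin

text \<open>The library has no power function on the extended nonnegative reals; the exponents \<open>r\<close>
  used below are all positive.\<close>

definition ennpowr :: "ennreal \<Rightarrow> real \<Rightarrow> ennreal" where
  "ennpowr x r = (if x = \<infinity> then \<infinity> else ennreal (enn2real x powr r))"

definition distr_fun :: "'a measure \<Rightarrow> ('a \<Rightarrow> real) \<Rightarrow> real \<Rightarrow> ennreal" where
  "distr_fun M f l = emeasure M {x \<in> space M. \<bar>f x\<bar> > l}"

text \<open>The infimum of the empty set is \<open>\<infinity>\<close>.\<close>

definition rearr :: "'a measure \<Rightarrow> ('a \<Rightarrow> real) \<Rightarrow> real \<Rightarrow> ennreal" where
  "rearr M f t = (INF l\<in>{l. 0 < l \<and> distr_fun M f l \<le> ennreal t}. ennreal l)"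

definition max_rearr :: "'a measure \<Rightarrow> ('a \<Rightarrow> real) \<Rightarrow> real \<Rightarrow> ennreal" where
  "max_rearr M f t = (\<integral>\<^sup>+ s\<in>{0<..<t}. rearr M f s \<partial>lebesgue) / ennreal t"

definition Ib :: "ennreal \<Rightarrow> real set" where
  "Ib b = {t. 0 < t \<and> ennreal t < b}"

text \<open>Local integrability on \<open>Ib b\<close> is implied by integrability on the intervals \<open>(0,t)\<close>.\<close>

definition weight_on :: "ennreal \<Rightarrow> (real \<Rightarrow> real) \<Rightarrow> bool" where
  "weight_on b w \<longleftrightarrow>
     (\<forall>t\<in>Ib b. 0 < w t) \<and>
     (\<forall>t. 0 < t \<and> ennreal t \<le> b \<longrightarrow> set_integrable lebesgue {0<..<t} w)"

definition nontrivial_weight :: "ennreal \<Rightarrow> real \<Rightarrow> (real \<Rightarrow> real) \<Rightarrow> bool" where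
  "nontrivial_weight b p \<phi> \<longleftrightarrow>
     (b = \<infinity> \<longrightarrow> (\<integral>\<^sup>+ t\<in>{1<..}. ennreal (\<phi> t * t powr (- p)) \<partial>lebesgue) < \<infinity>) \<and>
     (\<forall>c. 0 < c \<and> ennreal c \<le> b \<longrightarrow>
        (\<integral>\<^sup>+ t\<in>{0<..<c}. ennreal (\<phi> t * t powr (- p)) \<partial>lebesgue) = \<infinity>)"

definition rho :: "'a measure \<Rightarrow> real \<Rightarrow> (real \<Rightarrow> real) \<Rightarrow> ('a \<Rightarrow> real) \<Rightarrow> ennreal" where
  "rho M r w f =
     ennpowr (\<integral>\<^sup>+ t\<in>Ib (emeasure M (space M)). ennpowr (max_rearr M f t) r * ennreal (w t) \<partial>lebesgue)
       (1 / r)"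

definition rho_assoc :: "'a measure \<Rightarrow> real \<Rightarrow> (real \<Rightarrow> real) \<Rightarrow> ('a \<Rightarrow> real) \<Rightarrow> ennreal" where
  "rho_assoc M r w g =
     (SUP f\<in>{f \<in> borel_measurable M. rho M r w f \<le> 1}. \<integral>\<^sup>+ x. ennreal \<bar>f x * g x\<bar> \<partial>M)"

text \<open>Both real-valued integrals below converge for every \<open>t\<close> in \<open>Ib b\<close> when \<open>\<phi>\<close> is a
  non-trivial weight.\<close>

definition dual_weight :: "ennreal \<Rightarrow> real \<Rightarrow> (real \<Rightarrow> real) \<Rightarrow> real \<Rightarrow> real" where
  "dual_weight b p \<phi> t =
     (let p' = p / (p - 1);
          V = (LINT s:{0<..<t}|lebesgue. \<phi> s);
          W = (LINT s:{s. t < s \<and> ennreal s < b}|lebesgue. \<phi> s * s powr (- p))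
      in t powr (p + p' - 1) * V * W / (V + t powr p * W) powr (p' + 1))"

end

theory Submission
  imports Defs "HOL-Probability.Distribution_Functions"
begin

text \<open>
  Write \<open>K(f,t) = t f**(t)\<close>, the integral of \<open>min t (\<mu>\<^sub>f l)\<close> over \<open>l > 0\<close>, \<open>V(t)\<close> for the integral of
  \<open>\<phi>\<close> over \<open>(0,t)\<close>, \<open>W(t)\<close> for that of \<open>\<phi>(s) s\<^sup>-\<^sup>p\<close> over \<open>(t,b)\<close>, and \<open>\<omega> = V + t\<^sup>p W\<close>, the
  \<open>p\<close>-th power of the fundamental function of \<open>\<rho>\<close>. The function \<open>\<omega>\<close> is continuously differentiable with
  \<open>\<omega>' = p t\<^sup>p\<^sup>-\<^sup>1 W\<close>, and \<open>y = t\<^sup>-\<^sup>p \<omega>\<close> has \<open>y' = -p t\<^sup>-\<^sup>p\<^sup>-\<^sup>1 V\<close>. With the density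
  \<open>\<phi>' = V W t\<^sup>p\<^sup>-\<^sup>1 / \<omega>\<close> (not a derivative) the dual norm becomes the norm of \<open>K(g,t) / \<omega>\<close> in \<open>L\<^sup>p'(\<phi>' dt)\<close>, and everything
  rests on a Schur test, with powers of \<open>\<omega>\<close> as test functions, for the kernel \<open>min 1 (t/s)\<^sup>c / \<omega>(t)\<close> between
  \<open>\<phi> ds\<close> and \<open>\<phi>' dt\<close>.

  For the upper bound, Hardy--Littlewood gives \<open>\<integral>|f g| \<le> \<integral> K(f, \<mu>\<^sub>g l) dl\<close>, and \<open>K(f,s)\<close> is dominated by an
  average of the smoothing of \<open>f**\<close> by that kernel; the boundary term at \<open>b\<close> of this estimate is the source
  of the \<open>L\<^sup>1\<close> term. For the lower bound, \<open>f\<close> is taken to be an average over \<open>t\<close> of near-extremal functions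
  for \<open>K(g,t)\<close>, weighted by \<open>(K(g,t) / \<omega>)\<^sup>p\<^sup>'\<^sup>-\<^sup>1 \<phi>' / \<omega>\<close>. This works on every \<open>\<sigma>\<close>-finite space, atoms
  included, because only \<open>f**\<close>, never \<open>f*\<close>, has to be controlled.
\<close>

subsection \<open>The weight and its fundamental function\<close>

text \<open>The weight is only measurable, so \<open>V\<close> and \<open>W\<close> need not be
  differentiable everywhere; but \<open>\<phi> ds = -s^p dW\<close> makes the bad terms of
  \<open>d(V + s^p W)\<close> cancel, which is why integrals are computed through
  \<open>\<omega>\<close> and \<open>y\<close>. The density \<open>\<phi>'\<close> is
  \<open>1/t\<close> times the product of \<open>V\<close> and \<open>t^p W\<close> divided by their
  sum, hence at most both \<open>\<omega>' / p\<close> and \<open>- t^p y' / p\<close>: it can be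
  integrated against powers of \<open>\<omega>\<close> towards infinity and against powers of
  \<open>y\<close> towards 0. The two ends differ. Non-triviality forces \<open>W\<close>, hence
  \<open>y\<close>, to infinity at 0, so no boundary term arises there; \<open>\<omega>\<close>
  stays bounded at infinity when \<open>\<phi>\<close> is integrable, and a term remains. The kernel
  is used with \<open>c = p - 1\<close> in the upper and with \<open>c = 1\<close> in the lower
  estimate. The lower estimate absorbs a multiple of an integral into that integral itself, so its
  finiteness must be known beforehand: hence the truncated \<open>g\<close> and the restriction of
  \<open>t\<close> to a bounded interval away from 0.\<close>

lemma nn_integral_UN_incseq_le:
  assumes [measurable]: "f \<in> borel_measurable M" "\<And>n. A n \<in> sets M"
    and inc: "incseq A" and le: "\<And>n. (\<integral>\<^sup>+x\<in>(A n). f x \<partial>M) \<le> c"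
  shows "(\<integral>\<^sup>+x. f x * indicator (\<Union>n. A n) x \<partial>M) \<le> c"
proof -
  have "(\<integral>\<^sup>+x. f x * indicator (\<Union>n. A n) x \<partial>M) = (\<integral>\<^sup>+x. (SUP n. f x * indicator (A n) x) \<partial>M)"
  proof (rule nn_integral_cong)
    fix x
    have "indicator (\<Union>n. A n) x = (SUP n. indicator (A n) x :: ennreal)"
      by (rule LIMSEQ_unique[OF LIMSEQ_indicator_incseq[OF inc] LIMSEQ_SUP])
        (use inc in \<open>auto simp: incseq_def split: split_indicator\<close>)
    then show "f x * indicator (\<Union>n. A n) x = (SUP n. f x * indicator (A n) x)"
      by (simp add: SUP_mult_left_ennreal)
  qed
  also have "\<dots> = (SUP n. (\<integral>\<^sup>+x\<in>(A n). f x \<partial>M))"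
    using inc by (intro nn_integral_monotone_convergence_SUP)
      (auto simp: incseq_def le_fun_def split: split_indicator)
  also have "\<dots> \<le> c" by (intro SUP_least le)
  finally show ?thesis .
qed

section \<open>Integrating a nonnegative derivative up to 0 or to infinity\<close>

context
  fixes G g :: "real \<Rightarrow> real" and t c :: real
  assumes g[measurable]: "g \<in> borel_measurable borel"
    and der: "\<And>x. 0 < x \<Longrightarrow> (G has_real_derivative g x) (at x)" and nn: "\<And>x. 0 < x \<Longrightarrow> 0 \<le> g x"
    and t: "0 < t"
begin

lemma nn_integral_deriv_le:
  assumes "incseq (\<lambda>n. {a n..b n})" and "\<And>n. 0 < a n" "\<And>n. a n < b n" "\<And>n. G (b n) - G (a n) \<le> c"
  shows "(\<integral>\<^sup>+x. ennreal (g x) * indicator (\<Union>n::nat. {a n..b n}) x \<partial>lborel) \<le> ennreal c"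
proof (rule nn_integral_UN_incseq_le)
  fix n
  have "(\<integral>\<^sup>+x\<in>{a n..b n}. ennreal (g x) \<partial>lborel) = ennreal (G (b n) - G (a n))"
    using assms(2,3)[of n] by (intro nn_integral_FTC_Icc der nn) auto
  then show "(\<integral>\<^sup>+x\<in>{a n..b n}. ennreal (g x) \<partial>lborel) \<le> ennreal c"
    using assms(4) by (simp add: ennreal_leI)
qed (use assms in auto)

text \<open>A bound on the increments of \<open>G\<close> replaces its limit at the open end. In the
  applications \<open>G\<close> has constant sign, and the bound results from dropping the value at
  that end.\<close>

lemma nn_integral_deriv_left_le:
  assumes "\<And>a. 0 < a \<Longrightarrow> a < t \<Longrightarrow> G t - G a \<le> c"
  shows "(\<integral>\<^sup>+x\<in>{0<..t}. ennreal (g x) \<partial>lborel) \<le> ennreal c"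
proof -
  define a where "a n = t / real (n+2)" for n
  have a: "0 < a n" "a n < t" for n using t by (auto simp: a_def divide_simps)
  have "{0<..t} = (\<Union>n. {a n..t})"
  proof (intro equalityI subsetI)
    fix x assume x: "x \<in> {0<..t}"
    obtain n where "t / x < real n" using reals_Archimedean2 by blast
    then have "a n \<le> x" using x by (auto simp: a_def field_simps)
    then show "x \<in> (\<Union>n. {a n..t})" using x by auto
  qed (use a in \<open>auto intro: less_le_trans\<close>)
  moreover have "incseq (\<lambda>n. {a n..t})" using t by (auto simp: incseq_def a_def divide_simps)
  ultimately show ?thesis using nn_integral_deriv_le[of a "\<lambda>_. t"] a assms by simp
qed

lemma nn_integral_deriv_right_le:
  assumes "\<And>b. t < b \<Longrightarrow> G b - G t \<le> c"
  shows "(\<integral>\<^sup>+x\<in>{t..}. ennreal (g x) \<partial>lborel) \<le> ennreal c"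
proof -
  have "{t..} = (\<Union>n. {t..t+1+real n})"
  proof (intro equalityI subsetI)
    fix x assume x: "x \<in> {t..}"
    obtain n where "x - t - 1 < real n" using reals_Archimedean2 by blast
    then have "x \<in> {t..t+1+real n}" using x by auto
    then show "x \<in> (\<Union>n. {t..t+1+real n})" by blast
  qed auto
  then show ?thesis using nn_integral_deriv_le[of "\<lambda>_. t" "\<lambda>n. t+1+real n"] t assms by (simp add: incseq_def)
qed

end

text \<open>The hypothesis says that \<open>G\<close> behaves like the Stieltjes integral of a
  decreasing \<open>w\<close> with respect to \<open>P\<close>. The difference quotient of
  \<open>G\<close> then differs from that of \<open>P\<close> times \<open>w x\<close> by at most
  the latter quotient times the oscillation of \<open>w\<close>.\<close>

lemma has_real_derivative_between_Stieltjes: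
  fixes G P w :: "real \<Rightarrow> real"
  assumes bd: "\<And>t t'. 0 < t \<Longrightarrow> t \<le> t' \<Longrightarrow> (P t' - P t) * w t' \<le> G t' - G t \<and> G t' - G t \<le> (P t' - P t) * w t"
    and "0 < x" and cont: "isCont w x" and P: "(P has_real_derivative d) (at x)"
  shows "(G has_real_derivative d * w x) (at x)"
proof -
  define q where "q = (\<lambda>y. (P y - P x) / (y - x))"
  have q: "(q \<longlongrightarrow> d) (at x)"
    using P by (simp add: has_field_derivative_iff q_def)
  have w: "(w \<longlongrightarrow> w x) (at x)" using cont by (simp add: isCont_def)
  have "((\<lambda>y. (G y - G x) / (y - x) - q y * w x) \<longlongrightarrow> 0) (at x)"
  proof (rule Lim_null_comparison)
    show "((\<lambda>y. \<bar>q y\<bar> * \<bar>w y - w x\<bar>) \<longlongrightarrow> 0) (at x)"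
      using tendsto_mult[OF tendsto_rabs[OF q] tendsto_rabs[OF LIM_zero[OF w]]] by simp
    have "\<forall>\<^sub>F y in at x. y > 0 \<and> y \<noteq> x"
      using \<open>0 < x\<close> eventually_neq_at_within[of x x UNIV]
      by (intro eventually_conj order_tendstoD(1)[OF tendsto_ident_at]) auto
    then show "\<forall>\<^sub>F y in at x. norm ((G y - G x) / (y - x) - q y * w x) \<le> \<bar>q y\<bar> * \<bar>w y - w x\<bar>"
    proof (eventually_elim)
      case (elim y)
      let ?D = "G y - G x - (P y - P x) * w x"
      \<comment> \<open>On either side of \<open>x\<close> the sandwich puts \<open>?D\<close>
        between \<open>(P y - P x) * (w y - w x)\<close> and 0.\<close>
      have "\<bar>?D\<bar> \<le> \<bar>(P y - P x) * (w y - w x)\<bar>"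
      proof (cases "x < y")
        case True
        with bd[of x y] \<open>0 < x\<close> show ?thesis by (simp add: algebra_simps)
      next
        case False
        with bd[of y x] elim show ?thesis by (simp add: algebra_simps)
      qed
      then have "\<bar>?D\<bar> / \<bar>y - x\<bar> \<le> \<bar>(P y - P x) * (w y - w x)\<bar> / \<bar>y - x\<bar>"
        by (rule divide_right_mono) simp
      moreover have "\<bar>?D\<bar> / \<bar>y - x\<bar> = \<bar>(G y - G x) / (y - x) - q y * w x\<bar>"
        unfolding q_def abs_divide[symmetric] by (rule arg_cong[where f=abs]) (simp add: diff_divide_distrib left_diff_distrib)
      moreover have "\<bar>(P y - P x) * (w y - w x)\<bar> / \<bar>y - x\<bar> = \<bar>q y\<bar> * \<bar>w y - w x\<bar>"
        unfolding q_def by (simp add: abs_mult)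
      ultimately show ?case by simp
    qed
  qed
  then have "((\<lambda>y. ((G y - G x) / (y - x) - q y * w x) + q y * w x) \<longlongrightarrow> 0 + d * w x) (at x)"
    by (intro tendsto_add tendsto_mult q tendsto_const)
  then show ?thesis by (simp add: has_field_derivative_iff)
qed

text \<open>The weight is extended by 0 to the whole line, so that \<open>b\<close> disappears and
  all integrals run over fixed half-lines. Positivity is weakened to nonnegativity; what is needed
  of it returns through the divergence \<open>inf_left\<close>.\<close>

locale rearr_weight =
  fixes \<phi> :: "real \<Rightarrow> real" and p :: real
  assumes phi_meas[measurable]: "\<phi> \<in> borel_measurable borel"
    and phi_nonneg: "0 \<le> \<phi> t"
    and phi_zero: "t \<le> 0 \<Longrightarrow> \<phi> t = 0"
    and p_gt: "1 < p"
    and fin_left: "(\<integral>\<^sup>+s\<in>{..t}. ennreal (\<phi> s) \<partial>lborel) < \<infinity>"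
    and fin_right: "0 < t \<Longrightarrow> (\<integral>\<^sup>+s\<in>{t<..}. ennreal (\<phi> s * s powr (-p)) \<partial>lborel) < \<infinity>"
    and inf_left: "0 < t \<Longrightarrow> (\<integral>\<^sup>+s\<in>{..t}. ennreal (\<phi> s * s powr (-p)) \<partial>lborel) = \<infinity>"
begin

definition "N = density lborel (\<lambda>s. ennreal (\<phi> s))"
definition "N' = density lborel (\<lambda>s. ennreal (\<phi> s * s powr (-p)))"
definition "V t = measure N {..t}"
definition "W t = measure N' {t<..}"
definition "\<omega> t = V t + t powr p * W t"
text \<open>\<open>y\<close> is to \<open>N'\<close> and \<open>(t, \<infinity>)\<close> what
  \<open>\<omega>\<close> is to \<open>N\<close> and \<open>(0, t]\<close>: it equals
  \<open>V t * t powr (-p) + W t\<close> for \<open>t > 0\<close>, decreases, and dominates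
  \<open>W\<close> as \<open>\<omega>\<close> dominates \<open>V\<close>.\<close>

definition "y t = \<omega> t * t powr (-p)"
definition "\<phi>' t = V t * W t * t powr (p-1) / \<omega> t"

lemma sets_N[simp, measurable_cong]: "sets N = sets borel" by (simp add: N_def)
lemma sets_N'[simp, measurable_cong]: "sets N' = sets borel" by (simp add: N'_def)
lemma space_N[simp]: "space N = UNIV" by (simp add: N_def)
lemma space_N'[simp]: "space N' = UNIV" by (simp add: N'_def)

lemma nn_integral_N: "f \<in> borel_measurable borel \<Longrightarrow> (\<integral>\<^sup>+s. f s \<partial>N) = (\<integral>\<^sup>+s. ennreal (\<phi> s) * f s \<partial>lborel)"
  unfolding N_def by (subst nn_integral_density) auto

lemma nn_integral_N': "f \<in> borel_measurable borel \<Longrightarrow> (\<integral>\<^sup>+s. f s \<partial>N') = (\<integral>\<^sup>+s. ennreal (\<phi> s * s powr (-p)) * f s \<partial>lborel)"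
  unfolding N'_def by (subst nn_integral_density) auto

lemma emeasure_N: "A \<in> sets borel \<Longrightarrow> emeasure N A = (\<integral>\<^sup>+s\<in>A. ennreal (\<phi> s) \<partial>lborel)"
  unfolding N_def by (subst emeasure_density) auto

lemma emeasure_N': "A \<in> sets borel \<Longrightarrow> emeasure N' A = (\<integral>\<^sup>+s\<in>A. ennreal (\<phi> s * s powr (-p)) \<partial>lborel)"
  unfolding N'_def by (subst emeasure_density) auto

lemma sigma_finite_N: "sigma_finite_measure N"
  unfolding N_def by (subst sigma_finite_measure.sigma_finite_iff_density_finite[OF lborel.sigma_finite_measure_axioms]) auto

lemma sigma_finite_N': "sigma_finite_measure N'"
  unfolding N'_def by (subst sigma_finite_measure.sigma_finite_iff_density_finite[OF lborel.sigma_finite_measure_axioms]) auto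

lemma emeasure_N_atMost: "emeasure N {..t} = ennreal (V t)"
  unfolding V_def using fin_left[of t] by (intro emeasure_eq_ennreal_measure) (auto simp: emeasure_N)

lemma emeasure_N'_greater: "0 < t \<Longrightarrow> emeasure N' {t<..} = ennreal (W t)"
  unfolding W_def using fin_right[of t] by (intro emeasure_eq_ennreal_measure) (auto simp: emeasure_N')

lemma AE_N_pos: "AE s in N. 0 < s"
  unfolding N_def by (subst AE_density) (auto simp: phi_zero not_le[symmetric] intro!: AE_I2)

lemma nn_integral_N_mono: "(\<And>s. 0 < s \<Longrightarrow> f s \<le> g s) \<Longrightarrow> (\<integral>\<^sup>+s. f s \<partial>N) \<le> (\<integral>\<^sup>+s. g s \<partial>N)"
  by (rule nn_integral_mono_AE) (use AE_N_pos in \<open>auto elim: eventually_mono\<close>)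

lemma nn_integral_N_cong: "(\<And>s. 0 < s \<Longrightarrow> f s = g s) \<Longrightarrow> (\<integral>\<^sup>+s. f s \<partial>N) = (\<integral>\<^sup>+s. g s \<partial>N)"
  by (intro antisym nn_integral_N_mono) auto

lemma emeasure_N'_single: "emeasure N' {t} = 0"
proof -
  have "AE s in lborel. s \<noteq> t" by (rule AE_lborel_singleton)
  then show ?thesis by (subst emeasure_N') (auto simp: nn_integral_0_iff_AE elim!: eventually_mono split: split_indicator)
qed

lemma V_nonneg: "0 \<le> V t" and W_nonneg: "0 \<le> W t" by (auto simp: V_def W_def)

lemma V_mono: "s \<le> t \<Longrightarrow> V s \<le> V t"
  using emeasure_mono[of "{..s}" "{..t}" N] by (auto simp: emeasure_N_atMost V_nonneg)

lemma W_antimono: "0 < s \<Longrightarrow> s \<le> t \<Longrightarrow> W t \<le> W s"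
  using emeasure_mono[of "{t<..}" "{s<..}" N'] by (auto simp: emeasure_N'_greater W_nonneg)

lemma V_nonpos: "t \<le> 0 \<Longrightarrow> V t = 0"
proof -
  assume "t \<le> 0"
  then have "emeasure N {..t} = 0"
    by (subst emeasure_N) (auto simp: phi_zero nn_integral_0_iff_AE intro!: AE_I2 split: split_indicator)
  then show ?thesis by (simp add: V_def measure_def)
qed

lemma emeasure_N'_atLeast: assumes "0 < t" shows "emeasure N' {t..} = ennreal (W t)"
proof -
  have "emeasure N' {t..} = emeasure N' ({t} \<union> {t<..})" by (intro arg_cong[where f="emeasure N'"]) auto
  also have "\<dots> = emeasure N' {t} + emeasure N' {t<..}" by (subst plus_emeasure) auto
  finally show ?thesis using assms by (simp add: emeasure_N'_single emeasure_N'_greater)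
qed

text \<open>If \<open>W\<close> were bounded near 0, exhausting \<open>(0, \<infinity>)\<close> by
  the half-lines \<open>{t0/(n+2)<..}\<close> would make the integral in \<open>inf_left\<close>
  finite. This removes the boundary term at 0 in \<open>nn_integral_y_lower\<close>.\<close>

lemma W_unbounded: "\<exists>s. 0 < s \<and> s < t0 \<and> c \<le> W s" if "0 < t0"
proof (rule ccontr)
  assume *: "\<not> ?thesis"
  have bd: "W s \<le> max c 0" if "0 < s" "s < t0" for s using * that by force
  have "(\<integral>\<^sup>+s. ennreal (\<phi> s * s powr (-p)) * indicator (\<Union>n. {t0/real (n+2)<..}) s \<partial>lborel) \<le> ennreal (max c 0)"
  proof (rule nn_integral_UN_incseq_le)
    show "incseq (\<lambda>n. {t0/real (n+2)<..})" using that unfolding incseq_def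
      by (auto simp: divide_simps)
    fix n
    show "(\<integral>\<^sup>+s. ennreal (\<phi> s * s powr (-p)) * indicator ({t0/real (n+2)<..}) s \<partial>lborel) \<le> ennreal (max c 0)"
    proof -
      have "0 < t0/real (n+2)" "t0/real (n+2) < t0" using that by (auto simp: divide_simps)
      then show ?thesis using emeasure_N'_greater[of "t0/real (n+2)"] bd[of "t0/real (n+2)"]
        by (simp add: emeasure_N' ennreal_leI del: of_nat_add)
    qed
  qed auto
  moreover have "(\<integral>\<^sup>+s\<in>{..t0}. ennreal (\<phi> s * s powr (-p)) \<partial>lborel)
      \<le> (\<integral>\<^sup>+s. ennreal (\<phi> s * s powr (-p)) * indicator (\<Union>n. {t0/real (n+2)<..}) s \<partial>lborel)"
  proof (rule nn_integral_mono)
    fix x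
    show "ennreal (\<phi> x * x powr (-p)) * indicator {..t0} x \<le> ennreal (\<phi> x * x powr (-p)) * indicator (\<Union>n. {t0/real (n+2)<..}) x"
    proof (cases "0 < x")
      case True
      obtain n where "t0 / x < real n" using reals_Archimedean2 by blast
      then have "t0 / real (n+2) < x" using True by (auto simp: field_simps)
      then have "x \<in> (\<Union>n. {t0/real (n+2)<..})" by blast
      then show ?thesis by (simp split: split_indicator)
    qed (simp add: phi_zero)
  qed
  ultimately show False using inf_left[OF that] by (simp add: top_unique)
qed

text \<open>If \<open>V t\<close> were 0, the weight would vanish almost everywhere up to
  \<open>t\<close>, against the divergence at 0.\<close>

lemma V_pos: assumes "0 < t" shows "0 < V t"
proof (rule ccontr)
  assume "\<not> ?thesis"
  then have "V t = 0" using V_nonneg[of t] by simp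
  then have "(\<integral>\<^sup>+s\<in>{..t}. ennreal (\<phi> s) \<partial>lborel) = 0"
    using emeasure_N_atMost[of t] by (simp add: emeasure_N)
  then have "AE s in lborel. ennreal (\<phi> s) * indicator {..t} s = 0"
    by (subst (asm) nn_integral_0_iff_AE) auto
  then have "(\<integral>\<^sup>+s\<in>{..t}. ennreal (\<phi> s * s powr (-p)) \<partial>lborel) = 0"
    by (subst nn_integral_0_iff_AE)
      (auto elim!: eventually_mono simp: phi_nonneg ennreal_eq_0_iff indicator_def mult_nonpos_nonneg split: if_splits)
  then show False using inf_left[OF assms] by simp
qed

lemma emeasure_N_Ioc: assumes "s \<le> t" shows "emeasure N {s<..t} = ennreal (V t - V s)"
proof -
  have "{s<..t} = {..t} - {..s}" by auto
  then have "emeasure N {s<..t} = emeasure N {..t} - emeasure N {..s}"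
    using assms by (simp add: emeasure_Diff emeasure_N_atMost)
  then show ?thesis by (simp add: emeasure_N_atMost ennreal_minus V_nonneg)
qed

lemma emeasure_N'_Ioc: assumes "0 < s" "s \<le> t" shows "emeasure N' {s<..t} = ennreal (W s - W t)"
proof -
  have "{s<..t} = {s<..} - {t<..}" by auto
  then have "emeasure N' {s<..t} = emeasure N' {s<..} - emeasure N' {t<..}"
    using assms by (simp add: emeasure_Diff emeasure_N'_greater)
  then show ?thesis using assms by (simp add: emeasure_N'_greater ennreal_minus W_nonneg)
qed

text \<open>\<open>N'\<close> is infinite near 0, so it is first cut off below
  \<open>a = x/2\<close>. Beyond \<open>a\<close>, \<open>W\<close> is a constant minus the
  distribution function of the finite remainder, which is continuous because \<open>N'\<close> has
  no atoms.\<close>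

lemma isCont_W: assumes "0 < x" shows "isCont W x"
proof -
  define a where "a = x/2"
  have a: "0 < a" "a < x" using assms by (auto simp: a_def)
  define Q where "Q = density N' (indicator {a<..})"
  have eQ: "emeasure Q A = emeasure N' (A \<inter> {a<..})" if "A \<in> sets borel" for A
  proof -
    have "emeasure Q A = (\<integral>\<^sup>+x. indicator (A \<inter> {a<..}) x \<partial>N')"
      unfolding Q_def using that by (subst emeasure_density) (auto intro!: nn_integral_cong split: split_indicator simp del: nn_integral_indicator)
    also have "\<dots> = emeasure N' (A \<inter> {a<..})" using that by (intro nn_integral_indicator) auto
    finally show ?thesis .
  qed
  have "finite_measure Q"
    using eQ[of UNIV] emeasure_N'_greater[OF a(1)] by (intro finite_measureI) (simp add: Q_def)
  then interpret Q: finite_borel_measure Q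
    by (simp add: finite_borel_measure_def finite_borel_measure_axioms_def Q_def)
  have "measure Q {x} = 0" using eQ[of "{x}"] a by (simp add: measure_def emeasure_N'_single)
  then have c: "isCont (cdf Q) x" by (simp add: Q.isCont_cdf)
  have "W s = W a - cdf Q s" if "a < s" for s
  proof -
    have "{..s} \<inter> {a<..} = {a<..s}" by auto
    then show ?thesis
      using a that W_antimono[of a s] by (simp add: cdf_def measure_def eQ emeasure_N'_Ioc)
  qed
  then have "\<forall>\<^sub>F s in nhds x. W s = W a - cdf Q s"
    using a by (intro eventually_mono[OF eventually_nhds_in_open[of "{a<..}" x]]) auto
  then have "isCont W x \<longleftrightarrow> isCont (\<lambda>s. W a - cdf Q s) x" by (rule isCont_cong)
  then show ?thesis using c by (simp add: continuous_intros)
qed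

text \<open>On \<open>(t, t']\<close> the measure \<open>N\<close> is \<open>s^p\<close> times
  \<open>N'\<close>, so the increment of \<open>V\<close> lies between \<open>t^p\<close> and
  \<open>t'^p\<close> times the decrement of \<open>W\<close>. Inserted into the increment of
  \<open>V + t^p W\<close> this cancels the variation of \<open>W\<close> and leaves
  \<open>W d(t^p)\<close>, although \<open>V\<close> need not be differentiable.\<close>

lemma omega_diff:
  assumes "0 < t" "t \<le> t'"
  shows "(t' powr p - t powr p) * W t' \<le> \<omega> t' - \<omega> t \<and> \<omega> t' - \<omega> t \<le> (t' powr p - t powr p) * W t"
proof -
  let ?A = "{t<..t'}"
  have N: "emeasure N ?A = (\<integral>\<^sup>+s. ennreal (s powr p) * indicator ?A s \<partial>N')"
    using assms by (subst nn_integral_N', measurable, subst emeasure_N, simp)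
      (auto intro!: nn_integral_cong simp: indicator_def powr_minus phi_nonneg simp flip: ennreal_mult)
  have W0: "0 \<le> W t - W t'" using W_antimono[OF assms] by simp
  have "ennreal (t powr p) * emeasure N' ?A \<le> emeasure N ?A" "emeasure N ?A \<le> ennreal (t' powr p) * emeasure N' ?A"
    unfolding N using assms p_gt
    by (auto simp flip: nn_integral_cmult_indicator simp: indicator_def intro!: nn_integral_mono ennreal_leI powr_mono2)
  then have 1: "t powr p * (W t - W t') \<le> V t' - V t" and 2: "V t' - V t \<le> t' powr p * (W t - W t')"
    using V_mono[OF assms(2)] W0 by (simp_all add: emeasure_N_Ioc[OF assms(2)] emeasure_N'_Ioc[OF assms] flip: ennreal_mult)
  show ?thesis using 1 2 unfolding \<omega>_def by (simp add: algebra_simps)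
qed

lemma omega_mono: assumes "0 < s" "s \<le> t" shows "\<omega> s \<le> \<omega> t"
proof -
  have "s powr p \<le> t powr p" using assms p_gt by (intro powr_mono2) auto
  then have "0 \<le> (t powr p - s powr p) * W t" using W_nonneg by simp
  then show ?thesis using omega_diff[OF assms] by linarith
qed

lemma omega_deriv: assumes "0 < t" shows "(\<omega> has_real_derivative p * t powr (p-1) * W t) (at t)"
  by (rule has_real_derivative_between_Stieltjes[OF omega_diff assms isCont_W[OF assms]])
    (use assms in \<open>auto intro!: derivative_eq_intros\<close>)

lemma omega_nonneg: "0 \<le> \<omega> t"
  unfolding \<omega>_def using V_nonneg W_nonneg by (intro add_nonneg_nonneg mult_nonneg_nonneg) auto

lemma omega_pos: "0 < t \<Longrightarrow> 0 < \<omega> t"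
  unfolding \<omega>_def using V_pos[of t] W_nonneg[of t] by (intro add_pos_nonneg) auto

lemma y_pos: "0 < t \<Longrightarrow> 0 < y t" using omega_pos by (simp add: y_def)

lemma y_eq: "0 < t \<Longrightarrow> y t = V t * t powr (-p) + W t"
  by (simp add: y_def \<omega>_def algebra_simps powr_minus)

lemma omega_y: "0 < t \<Longrightarrow> \<omega> t = y t * t powr p" by (simp add: y_def powr_minus)

lemma y_deriv: assumes "0 < t" shows "(y has_real_derivative - (p * t powr (-p-1) * V t)) (at t)"
proof -
  have "(y has_real_derivative (p * t powr (p-1) * W t) * t powr (-p) + \<omega> t * (-p * t powr (-p-1))) (at t)"
    unfolding y_def[abs_def] using assms by (auto intro!: derivative_eq_intros omega_deriv)
  moreover have "t powr (p-1) * t powr (-p) = t powr p * t powr (-p-1)" by (simp flip: powr_add)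
  then have "(p * t powr (p-1) * W t) * t powr (-p) + \<omega> t * (-p * t powr (-p-1)) = - (p * t powr (-p-1) * V t)"
    unfolding \<omega>_def by (simp add: algebra_simps)
  ultimately show ?thesis by simp
qed

lemma V_le_omega: "V t \<le> \<omega> t" unfolding \<omega>_def using W_nonneg by simp
lemma W_le_y: "0 < t \<Longrightarrow> W t \<le> y t" by (simp add: y_eq V_nonneg)

lemma V_meas[measurable]: "V \<in> borel_measurable borel"
  by (rule borel_measurable_mono) (simp add: mono_def V_mono)

text \<open>Here \<open>N' {t<..}\<close> is infinite, and \<open>measure\<close> returns the
  default value 0.\<close>

lemma W_nonpos: assumes "t \<le> 0" shows "W t = 0"
proof -
  have "\<infinity> = emeasure N' {..1}" using inf_left[of 1] by (simp add: emeasure_N')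
  also have "\<dots> \<le> emeasure N' {t<..}"
    using assms by (auto simp: emeasure_N' phi_zero intro!: nn_integral_mono split: split_indicator)
  finally show ?thesis by (simp add: W_def measure_def top_unique)
qed

lemma W_meas[measurable]: "W \<in> borel_measurable borel"
proof -
  have "continuous_on {0<..} W" by (intro continuous_at_imp_continuous_on ballI isCont_W) auto
  then have "(\<lambda>t. indicator {0<..} t *\<^sub>R W t) \<in> borel_measurable borel"
    by (intro borel_measurable_continuous_on_indicator) auto
  also have "(\<lambda>t. indicator {0<..} t *\<^sub>R W t) = W" by (auto simp: fun_eq_iff indicator_def W_nonpos)
  finally show ?thesis .
qed

lemma omega_meas[measurable]: "\<omega> \<in> borel_measurable borel" unfolding \<omega>_def[abs_def] by measurable
lemma y_meas[measurable]: "y \<in> borel_measurable borel" unfolding y_def[abs_def] by measurable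
lemma phi'_meas[measurable]: "\<phi>' \<in> borel_measurable borel" unfolding \<phi>'_def[abs_def] by measurable

end

subsection \<open>Integrals for the Schur test\<close>

text \<open>If \<open>\<nu>\<close> were \<open>dF\<close>, this would be the integral of a power.
  Only \<open>\<nu> (J u) \<le> F u\<close> is available, so \<open>F s powr (-r)\<close> is written
  as its value at \<open>t\<close> plus the integral of its derivative over those \<open>u\<close>
  with \<open>s \<in> J u\<close>; Tonelli then produces \<open>\<nu> (J u)\<close>. The constant is
  \<open>1 + r/(1-r) = 1/(1-r)\<close>.\<close>

lemma nn_integral_powr_le_of_primitive:
  fixes F g :: "real \<Rightarrow> real"
  assumes "sigma_finite_measure \<nu>" and [measurable_cong]: "sets \<nu> = sets borel"
    and [measurable]: "F \<in> borel_measurable borel" "g \<in> borel_measurable borel" "S \<in> sets borel" "U \<in> sets borel"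
      "Measurable.pred (borel \<Otimes>\<^sub>M borel) (\<lambda>(s, u). s \<in> J u)" "\<And>u. J u \<in> sets borel"
    and r: "0 < r" "r < 1" and F: "0 < F t" "\<And>u. u \<in> U \<Longrightarrow> 0 < F u" and g: "\<And>u. u \<in> U \<Longrightarrow> 0 \<le> g u"
    and S: "emeasure \<nu> S \<le> ennreal (F t)" and J: "\<And>u. u \<in> U \<Longrightarrow> emeasure \<nu> (J u) \<le> ennreal (F u)"
    and primitive: "\<And>s. s \<in> S \<Longrightarrow>
      ennreal (F s powr (-r)) \<le> ennreal (F t powr (-r)) + (\<integral>\<^sup>+u\<in>U. ennreal (r * F u powr (-r-1) * g u) * indicator (J u) s \<partial>lborel)"
    and bound: "(\<integral>\<^sup>+u\<in>U. ennreal (r * F u powr (-r) * g u) \<partial>lborel) \<le> ennreal (r / (1-r) * F t powr (1-r))"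
  shows "(\<integral>\<^sup>+s\<in>S. ennreal (F s powr (-r)) \<partial>\<nu>) \<le> ennreal (F t powr (1-r) / (1-r))"
proof -
  interpret \<nu>: sigma_finite_measure \<nu> by fact
  interpret P: pair_sigma_finite \<nu> lborel ..
  define k where "k u = ennreal (r * F u powr (-r-1) * g u) * indicator U u" for u
  have [measurable]: "k \<in> borel_measurable borel" unfolding k_def[abs_def] by measurable
  have [measurable]: "(\<lambda>(s, u). indicator (J u) s :: ennreal) \<in> borel_measurable (\<nu> \<Otimes>\<^sub>M lborel)"
    unfolding indicator_def by measurable
  have powr: "F u powr (-r-1) * F u = F u powr (-r)" "F u powr (-r) * F u = F u powr (1-r)" if "0 < F u" for u
    using that by (simp_all add: powr_diff powr_minus field_simps)
  have "(\<integral>\<^sup>+s\<in>S. ennreal (F s powr (-r)) \<partial>\<nu>)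
      \<le> (\<integral>\<^sup>+s. ennreal (F t powr (-r)) * indicator S s + (\<integral>\<^sup>+u. k u * indicator (J u) s \<partial>lborel) \<partial>\<nu>)"
    using primitive by (intro nn_integral_mono) (auto simp: indicator_def k_def mult_ac if_distrib cong: if_cong)
  also have "\<dots> = (\<integral>\<^sup>+s\<in>S. ennreal (F t powr (-r)) \<partial>\<nu>) + (\<integral>\<^sup>+s. (\<integral>\<^sup>+u. k u * indicator (J u) s \<partial>lborel) \<partial>\<nu>)"
    by (intro nn_integral_add) measurable
  also have "(\<integral>\<^sup>+s. (\<integral>\<^sup>+u. k u * indicator (J u) s \<partial>lborel) \<partial>\<nu>) = (\<integral>\<^sup>+u. (\<integral>\<^sup>+s\<in>(J u). k u \<partial>\<nu>) \<partial>lborel)"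
    by (rule P.Fubini'[symmetric]) measurable
  also have "\<dots> = (\<integral>\<^sup>+u. k u * emeasure \<nu> (J u) \<partial>lborel)"
    by (simp add: nn_integral_cmult)
  also have "\<dots> \<le> (\<integral>\<^sup>+u\<in>U. ennreal (r * F u powr (-r) * g u) \<partial>lborel)"
  proof (rule nn_integral_mono)
    fix u
    have "ennreal (r * F u powr (-r-1) * g u) * emeasure \<nu> (J u) \<le> ennreal (r * F u powr (-r) * g u)" if u: "u \<in> U"
    proof -
      have "ennreal (r * F u powr (-r-1) * g u) * emeasure \<nu> (J u) \<le> ennreal (r * F u powr (-r-1) * g u) * ennreal (F u)"
        by (intro mult_left_mono J u) simp
      also have "\<dots> = ennreal (r * (F u powr (-r-1) * F u) * g u)"
        using r g[OF u] F(2)[OF u] by (simp add: mult_ac flip: ennreal_mult)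
      finally show ?thesis by (simp add: powr F(2)[OF u])
    qed
    then show "k u * emeasure \<nu> (J u) \<le> ennreal (r * F u powr (-r) * g u) * indicator U u"
      by (auto simp: k_def indicator_def)
  qed
  also note bound
  also have "(\<integral>\<^sup>+s\<in>S. ennreal (F t powr (-r)) \<partial>\<nu>) \<le> ennreal (F t powr (-r)) * ennreal (F t)"
    using S by (simp add: nn_integral_cmult mult_left_mono)
  also have "\<dots> = ennreal (F t powr (1-r))" using F(1) by (simp add: powr flip: ennreal_mult)
  also have "\<dots> + ennreal (r / (1-r) * F t powr (1-r)) = ennreal (F t powr (1-r) / (1-r))"
    using r by (subst ennreal_plus[symmetric]) (auto simp: field_simps)
  finally show ?thesis by (simp add: add_mono)
qed

context rearr_weight
begin

lemma phi'_nonneg: "0 \<le> \<phi>' t"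
  unfolding \<phi>'_def \<omega>_def using V_nonneg W_nonneg by (intro divide_nonneg_nonneg mult_nonneg_nonneg add_nonneg_nonneg) auto

text \<open>The bound is the derivative of \<open>\<omega>\<close> divided by \<open>p\<close>. Its
  companion \<open>phi'_le_V\<close> is \<open>t^p / p\<close> times minus the derivative of
  \<open>y\<close>. They use \<open>V \<le> \<omega>\<close> and \<open>t^p W \<le> \<omega>\<close>
  respectively.\<close>

lemma phi'_le_W: assumes "0 < t" shows "\<phi>' t \<le> t powr (p-1) * W t"
proof -
  have "\<phi>' t = (t powr (p-1) * W t) * (V t / \<omega> t)" by (simp add: \<phi>'_def)
  also have "\<dots> \<le> (t powr (p-1) * W t) * 1"
    using W_nonneg V_le_omega omega_pos[OF assms] by (intro mult_left_mono) (auto simp: divide_simps)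
  finally show ?thesis by simp
qed

lemma phi'_le_V: assumes "0 < t" shows "\<phi>' t \<le> V t / t"
proof -
  have "\<phi>' t = (V t / t) * (t powr p * W t / \<omega> t)" using assms by (simp add: \<phi>'_def powr_diff)
  also have "\<dots> \<le> (V t / t) * 1"
    using assms V_nonneg W_nonneg omega_pos[OF assms] by (intro mult_left_mono) (auto simp: divide_simps \<omega>_def)
  finally show ?thesis by simp
qed

lemma omega_powr_deriv:
  assumes "0 < t"
  shows "((\<lambda>t. \<omega> t powr c) has_real_derivative c * \<omega> t powr (c - 1) * (p * t powr (p-1) * W t)) (at t)"
  using omega_pos[OF assms] by (auto intro!: derivative_eq_intros omega_deriv assms simp: )

lemma y_powr_deriv:
  assumes "0 < t"
  shows "((\<lambda>t. y t powr c) has_real_derivative - (c * y t powr (c - 1) * (p * t powr (-p-1) * V t))) (at t)"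
  using y_pos[OF assms] by (auto intro!: derivative_eq_intros y_deriv assms simp: )

text \<open>The general lemma with \<open>F = \<omega>\<close>, which increases: the primitive runs
  from \<open>s\<close> up to \<open>t\<close>, and \<open>s \<in> (0, u]\<close> selects exactly
  \<open>u \<ge> s\<close>.\<close>

lemma nn_integral_omega_powr_N:
  assumes r: "0 < r" "r < 1" and "0 < t"
  shows "(\<integral>\<^sup>+s\<in>{0<..t}. ennreal (\<omega> s powr (-r)) \<partial>N) \<le> ennreal (\<omega> t powr (1-r) / (1-r))"
proof (rule nn_integral_powr_le_of_primitive[where U="{0<..t}" and J="\<lambda>u. {0<..u}" and g="\<lambda>u. p * u powr (p-1) * W u"])
  have N: "emeasure N {0<..u} \<le> ennreal (\<omega> u)" for u
    using emeasure_mono[of "{0<..u}" "{..u}" N] V_le_omega[of u] by (force simp: emeasure_N_atMost intro: order_trans ennreal_leI)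
  show "emeasure N {0<..t} \<le> ennreal (\<omega> t)" "emeasure N {0<..u} \<le> ennreal (\<omega> u)" for u by (rule N)+
  have g0: "0 \<le> r * \<omega> u powr c * (p * u powr (p-1) * W u)" for u c using r p_gt W_nonneg by simp
  show "ennreal (\<omega> s powr (-r)) \<le> ennreal (\<omega> t powr (-r))
      + (\<integral>\<^sup>+u\<in>{0<..t}. ennreal (r * \<omega> u powr (-r-1) * (p * u powr (p-1) * W u)) * indicator {0<..u} s \<partial>lborel)" (is "_ \<le> _ + ?I")
    if s: "s \<in> {0<..t}" for s
  proof -
    have "ennreal (- (\<omega> t powr (-r)) - - (\<omega> s powr (-r))) = (\<integral>\<^sup>+u\<in>{s..t}. ennreal (r * \<omega> u powr (-r-1) * (p * u powr (p-1) * W u)) \<partial>lborel)"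
    proof (rule nn_integral_FTC_Icc[symmetric, where F="\<lambda>x. - (\<omega> x powr (-r))"])
      fix x assume "x \<in> {s..t}"
      then show "((\<lambda>x. - (\<omega> x powr (-r))) has_real_derivative r * \<omega> x powr (-r-1) * (p * x powr (p-1) * W x)) (at x)"
        using s DERIV_minus[OF omega_powr_deriv[of x "-r"]] by (simp add: mult.assoc)
    qed (use s g0 in auto)
    also have "\<dots> \<le> ?I" using s by (intro nn_integral_mono) (auto simp: indicator_def)
    finally have "ennreal (\<omega> t powr (-r)) + ennreal (\<omega> s powr (-r) - \<omega> t powr (-r)) \<le> ennreal (\<omega> t powr (-r)) + ?I"
      by (simp add: add_left_mono)
    moreover have "\<omega> t powr (-r) \<le> \<omega> s powr (-r)" using s r by (intro powr_mono2' omega_pos omega_mono) auto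
    ultimately show ?thesis by (simp flip: ennreal_plus)
  qed
  show "(\<integral>\<^sup>+u\<in>{0<..t}. ennreal (r * \<omega> u powr (-r) * (p * u powr (p-1) * W u)) \<partial>lborel) \<le> ennreal (r / (1-r) * \<omega> t powr (1-r))"
  proof (rule nn_integral_deriv_left_le)
    fix x :: real assume "0 < x"
    show "((\<lambda>x. r / (1-r) * \<omega> x powr (1-r)) has_real_derivative r * \<omega> x powr - r * (p * x powr (p - 1) * W x)) (at x)"
      using DERIV_cmult[OF omega_powr_deriv[OF \<open>0 < x\<close>, of "1-r"], of "r / (1-r)"] r by (simp add: mult.assoc)
  qed (use \<open>0 < t\<close> r g0 in auto)
qed (use assms p_gt W_nonneg in \<open>auto simp: sigma_finite_N omega_pos\<close>)

text \<open>The mirror image with the decreasing \<open>F = y\<close>: the primitive runs from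
  \<open>t\<close> up to \<open>s\<close>. The closed end of \<open>J u = {u..}\<close> is harmless
  because \<open>N'\<close> has no atoms.\<close>

lemma nn_integral_y_powr_N':
  assumes r: "0 < r" "r < 1" and "0 < t"
  shows "(\<integral>\<^sup>+s\<in>{t<..}. ennreal (y s powr (-r)) \<partial>N') \<le> ennreal (y t powr (1-r) / (1-r))"
proof (rule nn_integral_powr_le_of_primitive[where U="{t..}" and J="\<lambda>u. {u..}" and g="\<lambda>u. p * u powr (-p-1) * V u"])
  have g0: "0 \<le> r * y u powr c * (p * u powr (-p-1) * V u)" for u c using r p_gt V_nonneg by simp
  show "emeasure N' {t<..} \<le> ennreal (y t)" "u \<in> {t..} \<Longrightarrow> emeasure N' {u..} \<le> ennreal (y u)" for u
    using \<open>0 < t\<close> by (simp_all add: emeasure_N'_greater emeasure_N'_atLeast W_le_y ennreal_leI)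
  show "ennreal (y s powr (-r)) \<le> ennreal (y t powr (-r))
      + (\<integral>\<^sup>+u\<in>{t..}. ennreal (r * y u powr (-r-1) * (p * u powr (-p-1) * V u)) * indicator {u..} s \<partial>lborel)" (is "_ \<le> _ + ?I")
    if s: "s \<in> {t<..}" for s
  proof -
    have "ennreal (y s powr (-r) - y t powr (-r)) = (\<integral>\<^sup>+u\<in>{t..s}. ennreal (r * y u powr (-r-1) * (p * u powr (-p-1) * V u)) \<partial>lborel)"
    proof (rule nn_integral_FTC_Icc[symmetric, where F="\<lambda>x. y x powr (-r)"])
      fix x assume "x \<in> {t..s}"
      then show "((\<lambda>x. y x powr (-r)) has_real_derivative r * y x powr (-r-1) * (p * x powr (-p-1) * V x)) (at x)"
        using \<open>0 < t\<close> y_powr_deriv[of x "-r"] by (simp add: mult.assoc)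
    qed (use s g0 in auto)
    also have "\<dots> \<le> ?I" using s by (intro nn_integral_mono) (auto simp: indicator_def)
    finally have "ennreal (y t powr (-r)) + ennreal (y s powr (-r) - y t powr (-r)) \<le> ennreal (y t powr (-r)) + ?I"
      by (rule add_left_mono)
    moreover have "ennreal (y s powr (-r)) \<le> ennreal (y t powr (-r)) + ennreal (y s powr (-r) - y t powr (-r))"
      using s by (simp add: ennreal_plus_if ennreal_leI)
    ultimately show ?thesis by (rule order_trans[rotated])
  qed
  show "(\<integral>\<^sup>+u\<in>{t..}. ennreal (r * y u powr (-r) * (p * u powr (-p-1) * V u)) \<partial>lborel) \<le> ennreal (r / (1-r) * y t powr (1-r))"
  proof (rule nn_integral_deriv_right_le)
    fix x :: real assume "0 < x"
    show "((\<lambda>x. - (r / (1-r) * y x powr (1-r))) has_real_derivative r * y x powr - r * (p * x powr (-p - 1) * V x)) (at x)"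
      using DERIV_minus[OF DERIV_cmult[OF y_powr_deriv[OF \<open>0 < x\<close>, of "1-r"], of "r / (1-r)"]] r by (simp add: mult.assoc)
  qed (use \<open>0 < t\<close> r g0 in auto)
qed (use assms p_gt V_nonneg in \<open>auto simp: sigma_finite_N' y_pos\<close>)

text \<open>By \<open>phi'_le_W\<close> the integrand is at most minus the derivative of
  \<open>\<omega> powr (-r) / (p * r)\<close>; the nonnegative value at infinity is dropped.\<close>

lemma nn_integral_omega_phi':
  assumes r: "0 < r" and "0 < s"
  shows "(\<integral>\<^sup>+t\<in>{s..}. ennreal (\<omega> t powr (-1-r) * \<phi>' t) \<partial>lborel) \<le> ennreal (\<omega> s powr (-r) / (p * r))"
proof -
  have "(\<integral>\<^sup>+t\<in>{s..}. ennreal (\<omega> t powr (-1-r) * \<phi>' t) \<partial>lborel)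
     \<le> (\<integral>\<^sup>+t\<in>{s..}. ennreal (\<omega> t powr (-1-r) * (t powr (p-1) * W t)) \<partial>lborel)"
    using \<open>0 < s\<close> by (intro nn_integral_mono) (auto intro!: ennreal_leI mult_left_mono phi'_le_W split: split_indicator)
  also have "\<dots> \<le> ennreal (\<omega> s powr (-r) / (p * r))"
  proof (rule nn_integral_deriv_right_le)
    fix x :: real assume "0 < x"
    have e: "- r - 1 = -1 - r" by simp
    show "((\<lambda>x. - (1 / (p * r) * \<omega> x powr (-r))) has_real_derivative \<omega> x powr (-1-r) * (x powr (p-1) * W x)) (at x)"
      using DERIV_minus[OF DERIV_cmult[OF omega_powr_deriv[OF \<open>0 < x\<close>, of "-r"], of "1 / (p*r)"]] r p_gt by (simp add: divide_simps e)
  qed (use assms p_gt W_nonneg in auto)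
  finally show ?thesis .
qed

text \<open>By \<open>phi'_le_V\<close> the integrand is at most the derivative of
  \<open>y powr (-r) / (p * r)\<close>; the nonnegative value near 0 is dropped.\<close>

lemma nn_integral_y_phi':
  assumes r: "0 < r" and "0 < s"
  shows "(\<integral>\<^sup>+t\<in>{0<..s}. ennreal (t powr (-p) * y t powr (-1-r) * \<phi>' t) \<partial>lborel) \<le> ennreal (y s powr (-r) / (p * r))"
proof -
  have "(\<integral>\<^sup>+t\<in>{0<..s}. ennreal (t powr (-p) * y t powr (-1-r) * \<phi>' t) \<partial>lborel)
     \<le> (\<integral>\<^sup>+t\<in>{0<..s}. ennreal (y t powr (-1-r) * (t powr (-p-1) * V t)) \<partial>lborel)"
  proof (intro nn_integral_mono)
    fix t
    have "t powr (-p) * y t powr (-1-r) * \<phi>' t \<le> y t powr (-1-r) * (t powr (-p-1) * V t)" if "0 < t"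
    proof -
      have "y t powr (-1-r) * (t powr (-p-1) * V t) = t powr (-p) * y t powr (-1-r) * (V t / t)"
        using that by (simp add: powr_diff)
      moreover have "t powr (-p) * y t powr (-1-r) * \<phi>' t \<le> t powr (-p) * y t powr (-1-r) * (V t / t)"
        using that by (intro mult_left_mono phi'_le_V) auto
      ultimately show ?thesis by simp
    qed
    then show "ennreal (t powr (-p) * y t powr (-1-r) * \<phi>' t) * indicator {0<..s} t \<le> ennreal (y t powr (-1-r) * (t powr (-p-1) * V t)) * indicator {0<..s} t"
      by (auto intro!: ennreal_leI split: split_indicator)
  qed
  also have "\<dots> \<le> ennreal (y s powr (-r) / (p * r))"
  proof (rule nn_integral_deriv_left_le)
    fix x :: real assume "0 < x"
    have e: "- r - 1 = -1 - r" by simp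
    show "((\<lambda>x. 1 / (p * r) * y x powr (-r)) has_real_derivative y x powr (-1-r) * (x powr (-p-1) * V x)) (at x)"
      using DERIV_cmult[OF y_powr_deriv[OF \<open>0 < x\<close>, of "-r"], of "1 / (p*r)"] r p_gt by (simp add: divide_simps e)
  qed (use assms p_gt V_nonneg in auto)
  finally show ?thesis .
qed

subsection \<open>The Schur test\<close>

lemma phi'_nonpos: "t \<le> 0 \<Longrightarrow> \<phi>' t = 0"
  by (simp add: \<phi>'_def V_nonpos)

lemma nn_integral_N_N':
  assumes [measurable]: "f \<in> borel_measurable borel"
  shows "(\<integral>\<^sup>+s. ennreal (s powr (-p)) * f s \<partial>N) = (\<integral>\<^sup>+s. f s \<partial>N')"
  by (simp add: nn_integral_N nn_integral_N' ennreal_mult' phi_nonneg mult.assoc)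

text \<open>With conjugate exponents \<open>q\<close>, \<open>q'\<close> the Schur test needs
  \<open>c = p/q'\<close>. This is \<open>p - 1\<close> for \<open>q = p\<close> and 1 for
  \<open>q = p'\<close>, the two cases used.\<close>

definition "K c t s = min 1 (t / s) powr c / \<omega> t"

lemma K_meas[measurable (raw)]:
  assumes [measurable]: "f \<in> borel_measurable M" "g \<in> borel_measurable M"
  shows "(\<lambda>x. K c (f x) (g x)) \<in> borel_measurable M"
  unfolding K_def by measurable

lemma K_nonneg: "0 \<le> K c t s"
  unfolding K_def \<omega>_def using V_nonneg W_nonneg by (intro divide_nonneg_nonneg add_nonneg_nonneg mult_nonneg_nonneg) auto

lemma K_left: "0 < s \<Longrightarrow> s \<le> t \<Longrightarrow> K c t s = 1 / \<omega> t"
  by (simp add: K_def min_def divide_simps)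

lemma K_right: "0 < t \<Longrightarrow> t \<le> s \<Longrightarrow> K c t s = t powr c * s powr (-c) / \<omega> t"
  by (simp add: K_def min_def divide_simps powr_divide powr_minus)

text \<open>For \<open>s > t\<close> the kernel contributes \<open>s^(-p/q')\<close> and the test
  function is \<open>y^(-1/q) s^(-p/q)\<close>. The powers of \<open>s\<close> combine to
  \<open>s^(-p)\<close>, which turns \<open>N\<close> into \<open>N'\<close>, so each side of
  \<open>t\<close> is covered by one of the two power integrals.\<close>

lemma schur_N:
  assumes q: "1 < q" "1 < q'" "1/q + 1/q' = 1" and "0 < t"
  shows "(\<integral>\<^sup>+s. ennreal (K (p/q') t s * \<omega> s powr (-(1/q))) \<partial>N) \<le> ennreal (2 * q' * \<omega> t powr (-(1/q)))"
proof -
  define r where "r = 1/q"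
  have r: "0 < r" "r < 1" "1 - r = 1/q'" using q by (auto simp: r_def algebra_simps)
  have o: "0 < \<omega> t" by (rule omega_pos) fact
  have "(\<integral>\<^sup>+s. ennreal (K (p/q') t s * \<omega> s powr (-r)) \<partial>N) \<le>
     (\<integral>\<^sup>+s. ennreal (1 / \<omega> t) * (ennreal (\<omega> s powr (-r)) * indicator {0<..t} s)
        + ennreal (t powr (p/q') / \<omega> t) * (ennreal (s powr (-p)) * (ennreal (y s powr (-r)) * indicator {t<..} s)) \<partial>N)"
  proof (rule nn_integral_N_mono)
    fix s :: real assume s: "0 < s"
    show "ennreal (K (p/q') t s * \<omega> s powr (-r)) \<le> ennreal (1 / \<omega> t) * (ennreal (\<omega> s powr (-r)) * indicator {0<..t} s)
        + ennreal (t powr (p/q') / \<omega> t) * (ennreal (s powr (-p)) * (ennreal (y s powr (-r)) * indicator {t<..} s))"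
    proof (cases "s \<le> t")
      case True
      then show ?thesis using s o by (simp add: K_left ennreal_mult[symmetric])
    next
      case False
      have "s powr (-(p/q')) * \<omega> s powr (-r) = s powr (-(p/q')) * (y s powr (-r) * (s powr p) powr (-r))"
        using y_pos[OF s] by (simp add: omega_y[OF s] powr_mult)
      also have "\<dots> = s powr (-(p/q') + p * (-r)) * y s powr (-r)" by (simp add: powr_powr powr_diff powr_minus field_simps)
      also have "-(p/q') + p * (-r) = - (p * (1/q + 1/q'))" by (simp add: r_def algebra_simps)
      finally have "s powr (-(p/q')) * \<omega> s powr (-r) = s powr (-p) * y s powr (-r)" by (simp add: q(3))
      then have "K (p/q') t s * \<omega> s powr (-r) = t powr (p/q') / \<omega> t * (s powr (-p) * y s powr (-r))"
        using False \<open>0 < t\<close> by (simp add: K_right field_simps)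
      then show ?thesis using False o by (simp add: ennreal_mult[symmetric])
    qed
  qed
  also have "\<dots> = ennreal (1 / \<omega> t) * (\<integral>\<^sup>+s\<in>{0<..t}. ennreal (\<omega> s powr (-r)) \<partial>N)
     + ennreal (t powr (p/q') / \<omega> t) * (\<integral>\<^sup>+s\<in>{t<..}. ennreal (y s powr (-r)) \<partial>N')"
    by (subst nn_integral_add) (auto simp: nn_integral_cmult nn_integral_N_N')
  also have "\<dots> \<le> ennreal (1 / \<omega> t) * ennreal (\<omega> t powr (1-r) / (1-r)) + ennreal (t powr (p/q') / \<omega> t) * ennreal (y t powr (1-r) / (1-r))"
    using r \<open>0 < t\<close> by (intro add_mono mult_left_mono nn_integral_omega_powr_N nn_integral_y_powr_N') auto
  also have "\<dots> = ennreal (1 / \<omega> t * (\<omega> t powr (1-r) / (1-r)) + t powr (p/q') / \<omega> t * (y t powr (1-r) / (1-r)))"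
    using q r o by (simp add: ennreal_mult[symmetric])
  \<comment> \<open>Since \<open>\<omega> = y t^p\<close> and \<open>1 - r = 1/q'\<close>, both
    sides of \<open>t\<close> contribute the same amount.\<close>
  also have "t powr (p/q') / \<omega> t * (y t powr (1-r) / (1-r)) = 1 / \<omega> t * (\<omega> t powr (1-r) / (1-r))"
  proof -
    have "\<omega> t powr (1-r) = y t powr (1-r) * t powr (p * (1-r))" using y_pos[OF \<open>0 < t\<close>] \<open>0 < t\<close> by (simp add: omega_y powr_mult powr_powr)
    then show ?thesis by (simp add: r(3))
  qed
  also have "1 / \<omega> t * (\<omega> t powr (1-r) / (1-r)) + 1 / \<omega> t * (\<omega> t powr (1-r) / (1-r)) = 2 * q' * \<omega> t powr (-r)"
  proof -
    have "\<omega> t powr (-r) = \<omega> t powr (1-r) / \<omega> t" using o by (simp add: powr_diff powr_minus divide_simps)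
    then show ?thesis by (simp add: r(3))
  qed
  finally show ?thesis by (simp add: r_def)
qed

text \<open>For \<open>t < s\<close> the identity \<open>\<omega> = y t^p\<close> turns
  \<open>t^(p/q') \<omega>^(-1-1/q')\<close> into \<open>t^(-p) y^(-1-1/q')\<close>, the integrand
  of \<open>nn_integral_y_phi'\<close>.\<close>

lemma schur_phi':
  assumes q: "1 < q'" and "0 < s"
  shows "(\<integral>\<^sup>+t. ennreal (K (p/q') t s * \<omega> t powr (-(1/q')) * \<phi>' t) \<partial>lborel) \<le> ennreal (2 * q' * \<omega> s powr (-(1/q')))"
proof -
  define r where "r = 1/q'"
  have r: "0 < r" using q by (auto simp: r_def)
  have "(\<integral>\<^sup>+t. ennreal (K (p/q') t s * \<omega> t powr (-r) * \<phi>' t) \<partial>lborel) \<le>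
     (\<integral>\<^sup>+t. ennreal (\<omega> t powr (-1-r) * \<phi>' t) * indicator {s..} t
        + ennreal (s powr (-(p/q'))) * (ennreal (t powr (-p) * y t powr (-1-r) * \<phi>' t) * indicator {0<..s} t) \<partial>lborel)"
  proof (rule nn_integral_mono)
    fix t :: real
    show "ennreal (K (p/q') t s * \<omega> t powr (-r) * \<phi>' t) \<le> ennreal (\<omega> t powr (-1-r) * \<phi>' t) * indicator {s..} t
        + ennreal (s powr (-(p/q'))) * (ennreal (t powr (-p) * y t powr (-1-r) * \<phi>' t) * indicator {0<..s} t)"
    proof (cases "0 < t")
      case t: True
      have e: "\<omega> t powr (-1-r) = \<omega> t powr (-r) / \<omega> t"
        using omega_pos[OF t] by (simp add: powr_diff powr_minus divide_simps)
      show ?thesis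
      proof (cases "s \<le> t")
        case True
        then have "K (p/q') t s * \<omega> t powr (-r) * \<phi>' t = \<omega> t powr (-1-r) * \<phi>' t"
          using \<open>0 < s\<close> by (simp add: K_left e)
        then show ?thesis using True by (simp only: indicator_simps atLeast_iff) simp
      next
        case False
        have "\<omega> t powr (-1-r) = y t powr (-1-r) * t powr (p * (-1-r))" using y_pos[OF t] by (simp add: omega_y[OF t] powr_mult powr_powr)
        then have "t powr (p/q') * \<omega> t powr (-1-r) = t powr (p/q' + p * (-1-r)) * y t powr (-1-r)" by (simp add: powr_add)
        also have "p/q' + p * (-1-r) = -p" by (simp add: r_def algebra_simps)
        finally have "t powr (p/q') * (\<omega> t powr (-r) / \<omega> t) = t powr (-p) * y t powr (-1-r)" unfolding e .
        moreover have "K (p/q') t s * \<omega> t powr (-r) * \<phi>' t = s powr (-(p/q')) * (t powr (p/q') * (\<omega> t powr (-r) / \<omega> t) * \<phi>' t)"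
          using False t by (simp add: K_right)
        ultimately have k: "K (p/q') t s * \<omega> t powr (-r) * \<phi>' t = s powr (-(p/q')) * (t powr (-p) * y t powr (-1-r) * \<phi>' t)"
          by (simp only:)
        show ?thesis using False t unfolding k by (simp add: ennreal_mult[symmetric] phi'_nonneg)
      qed
    qed (simp add: phi'_nonpos)
  qed
  also have "\<dots> = (\<integral>\<^sup>+t\<in>{s..}. ennreal (\<omega> t powr (-1-r) * \<phi>' t) \<partial>lborel)
        + ennreal (s powr (-(p/q'))) * (\<integral>\<^sup>+t\<in>{0<..s}. ennreal (t powr (-p) * y t powr (-1-r) * \<phi>' t) \<partial>lborel)"
    by (subst nn_integral_add) (auto simp: nn_integral_cmult)
  also have "\<dots> \<le> ennreal (\<omega> s powr (-r) / (p * r)) + ennreal (s powr (-(p/q'))) * ennreal (y s powr (-r) / (p * r))"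
    using r \<open>0 < s\<close> by (intro add_mono mult_left_mono nn_integral_omega_phi' nn_integral_y_phi') auto
  also have "\<dots> = ennreal (\<omega> s powr (-r) / (p * r) + s powr (-(p/q')) * (y s powr (-r) / (p * r)))"
    using r p_gt by (simp add: ennreal_mult[symmetric])
  also have "s powr (-(p/q')) * (y s powr (-r) / (p * r)) = \<omega> s powr (-r) / (p * r)"
  proof -
    have "\<omega> s powr (-r) = y s powr (-r) * s powr (p * (-r))" using y_pos[OF \<open>0 < s\<close>] \<open>0 < s\<close> by (simp add: omega_y powr_mult powr_powr)
    then show ?thesis by (simp add: r_def)
  qed
  also have "\<omega> s powr (-r) / (p * r) + \<omega> s powr (-r) / (p * r) = 2 * q' / p * \<omega> s powr (-r)" by (simp add: r_def)
  \<comment> \<open>The factor \<open>1/p\<close> is given away so that the constant agrees with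
    that of \<open>schur_N\<close>.\<close>
  also have "\<dots> \<le> 2 * q' * \<omega> s powr (-r)"
    using p_gt q by (intro mult_right_mono) (auto simp: divide_simps)
  finally show ?thesis by (simp add: r_def ennreal_leI)
qed

text \<open>Young's inequality, weighted by a power of \<open>\<omega> t / \<omega> s\<close>, gives
  a sum of two integrals instead of a product of norms. In the upper estimate scaling recovers the
  norm; in the lower estimate the additive form allows absorption.\<close>

lemma schur_bilinear:
  assumes q: "1 < q" "1 < q'" "1/q + 1/q' = 1"
    and [measurable]: "h \<in> borel_measurable borel" "u \<in> borel_measurable borel"
    and h: "\<And>s. 0 \<le> h s" and u: "\<And>t. 0 \<le> u t"
  shows "(\<integral>\<^sup>+t. \<integral>\<^sup>+s. ennreal (K (p/q') t s * h s * u t * \<phi>' t) \<partial>N \<partial>lborel)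
    \<le> ennreal (2 * q') * ((\<integral>\<^sup>+s. ennreal (h s powr q) \<partial>N) + (\<integral>\<^sup>+t. ennreal (u t powr q' * \<phi>' t) \<partial>lborel))"
proof -
  interpret N: sigma_finite_measure N by (rule sigma_finite_N)
  interpret P: pair_sigma_finite N lborel ..
  define k where "k = K (p/q')"
  have [measurable (raw)]: "(\<lambda>x. k (f x) (g x)) \<in> borel_measurable M"
    if "f \<in> borel_measurable M" "g \<in> borel_measurable M" for f g and M :: "'x measure"
    unfolding k_def using that by (rule K_meas)
  have k0: "0 \<le> k t s" for t s by (simp add: k_def K_nonneg)
  define F1 where "F1 = (\<lambda>t s. ennreal (h s powr q * \<omega> s powr (1/q')) * ennreal (k t s * \<omega> t powr (-(1/q')) * \<phi>' t))"
  define F2 where "F2 = (\<lambda>t s. ennreal (u t powr q' * \<omega> t powr (1/q) * \<phi>' t) * ennreal (k t s * \<omega> s powr (-(1/q))))"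
  have [measurable]: "(\<lambda>(s, t). F1 t s) \<in> borel_measurable (N \<Otimes>\<^sub>M lborel)" "(\<lambda>(t, s). F1 t s) \<in> borel_measurable (lborel \<Otimes>\<^sub>M N)"
    "(\<lambda>(t, s). F2 t s) \<in> borel_measurable (lborel \<Otimes>\<^sub>M N)"
    unfolding F1_def F2_def by measurable
  have "(\<integral>\<^sup>+t. \<integral>\<^sup>+s. ennreal (k t s * h s * u t * \<phi>' t) \<partial>N \<partial>lborel)
     \<le> (\<integral>\<^sup>+t. (\<integral>\<^sup>+s. F1 t s + F2 t s \<partial>N) \<partial>lborel)"
  proof (rule nn_integral_mono, rule nn_integral_N_mono)
    fix t s :: real assume s: "0 < s"
    show "ennreal (k t s * h s * u t * \<phi>' t) \<le> F1 t s + F2 t s"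
    proof (cases "0 < t")
      case t: True
      \<comment> \<open>This exponent gives \<open>h s powr q\<close> the factor
        \<open>(\<omega> s / \<omega> t)^(1/q')\<close> and \<open>u t powr q'\<close> the factor
        \<open>(\<omega> t / \<omega> s)^(1/q)\<close>, so that \<open>schur_phi'\<close> and
        \<open>schur_N\<close> apply to the two terms.\<close>
      define c where "c = 1 / (q * q')"
      define A where "A = (h s * (\<omega> t powr (-c) * \<omega> s powr c)) powr q"
      define B where "B = (u t * (\<omega> t powr c * \<omega> s powr (-c))) powr q'"
      have o: "0 < \<omega> t" "0 < \<omega> s" using s t by (auto simp: omega_pos)
      have c: "c * q = 1/q'" "c * q' = 1/q" using q by (auto simp: c_def)
      have A: "A = h s powr q * (\<omega> t powr (-(1/q')) * \<omega> s powr (1/q'))"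
        unfolding A_def using h o by (simp add: powr_mult powr_powr c)
      have B: "B = u t powr q' * (\<omega> t powr (1/q) * \<omega> s powr (-(1/q)))"
        unfolding B_def using u o by (simp add: powr_mult powr_powr c)
      have "h s * u t = (h s * (\<omega> t powr (-c) * \<omega> s powr c)) * (u t * (\<omega> t powr c * \<omega> s powr (-c)))"
        using o by (simp add: powr_minus divide_simps)
      also have "\<dots> \<le> A / q + B / q'"
        unfolding A_def B_def using h u o q by (intro Youngs_inequality) auto
      also have "\<dots> \<le> A + B" using q by (intro add_mono) (auto simp: divide_simps A_def B_def mult_le_cancel_left1)
      finally have "(k t s * \<phi>' t) * (h s * u t) \<le> (k t s * \<phi>' t) * (A + B)"
        using k0 phi'_nonneg by (intro mult_left_mono) auto
      then have "ennreal (k t s * h s * u t * \<phi>' t) \<le> ennreal ((k t s * \<phi>' t) * A + (k t s * \<phi>' t) * B)"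
        by (intro ennreal_leI) (simp add: algebra_simps)
      also have "\<dots> = F1 t s + F2 t s"
        unfolding F1_def F2_def A B using h u o k0[of t s] phi'_nonneg[of t]
        by (simp add: ennreal_mult[symmetric] ennreal_plus[symmetric] mult_ac del: ennreal_plus)
      finally show ?thesis .
    qed (simp add: phi'_nonpos)
  qed
  also have "\<dots> = (\<integral>\<^sup>+t. (\<integral>\<^sup>+s. F1 t s \<partial>N) \<partial>lborel) + (\<integral>\<^sup>+t. (\<integral>\<^sup>+s. F2 t s \<partial>N) \<partial>lborel)"
    by (simp add: nn_integral_add)
  also have "(\<integral>\<^sup>+t. (\<integral>\<^sup>+s. F1 t s \<partial>N) \<partial>lborel) = (\<integral>\<^sup>+s. (\<integral>\<^sup>+t. F1 t s \<partial>lborel) \<partial>N)"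
    by (rule P.Fubini') measurable
  also have "\<dots> \<le> (\<integral>\<^sup>+s. ennreal (2 * q') * ennreal (h s powr q) \<partial>N)"
  proof (rule nn_integral_N_mono)
    fix s :: real assume s: "0 < s"
    have "(\<integral>\<^sup>+t. F1 t s \<partial>lborel) = ennreal (h s powr q * \<omega> s powr (1/q')) * (\<integral>\<^sup>+t. ennreal (k t s * \<omega> t powr (-(1/q')) * \<phi>' t) \<partial>lborel)"
      unfolding F1_def by (intro nn_integral_cmult) measurable
    also have "\<dots> \<le> ennreal (h s powr q * \<omega> s powr (1/q')) * ennreal (2 * q' * \<omega> s powr (-(1/q')))"
      unfolding k_def by (intro mult_left_mono schur_phi' q s) auto
    also have "\<dots> = ennreal (2 * q') * ennreal (h s powr q)"
      using omega_pos[OF s] q by (simp add: ennreal_mult[symmetric] powr_minus)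
    finally show "(\<integral>\<^sup>+t. F1 t s \<partial>lborel) \<le> ennreal (2 * q') * ennreal (h s powr q)" .
  qed
  also have "(\<integral>\<^sup>+t. (\<integral>\<^sup>+s. F2 t s \<partial>N) \<partial>lborel) \<le> (\<integral>\<^sup>+t. ennreal (2 * q') * ennreal (u t powr q' * \<phi>' t) \<partial>lborel)"
  proof (rule nn_integral_mono)
    fix t :: real
    show "(\<integral>\<^sup>+s. F2 t s \<partial>N) \<le> ennreal (2 * q') * ennreal (u t powr q' * \<phi>' t)"
    proof (cases "0 < t")
      case t: True
      have "(\<integral>\<^sup>+s. F2 t s \<partial>N) = ennreal (u t powr q' * \<omega> t powr (1/q) * \<phi>' t) * (\<integral>\<^sup>+s. ennreal (k t s * \<omega> s powr (-(1/q))) \<partial>N)"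
        unfolding F2_def by (intro nn_integral_cmult) measurable
      also have "\<dots> \<le> ennreal (u t powr q' * \<omega> t powr (1/q) * \<phi>' t) * ennreal (2 * q' * \<omega> t powr (-(1/q)))"
        unfolding k_def by (intro mult_left_mono schur_N q t) auto
      also have "\<dots> = ennreal (2 * q') * ennreal (u t powr q' * \<phi>' t)"
        using omega_pos[OF t] q phi'_nonneg[of t] by (simp add: ennreal_mult[symmetric] powr_minus)
      finally show ?thesis .
    qed (simp add: F2_def phi'_nonpos)
  qed
  finally show ?thesis by (simp add: k_def nn_integral_cmult distrib_left add_mono)
qed

subsection \<open>Smoothing of quasi-concave functions\<close>

text \<open>The integrand is the exact derivative of \<open>y powr (-2) / (2 * p)\<close>. The value
  at the lower end \<open>a\<close> tends to 0 because \<open>y \<ge> W\<close> is unbounded near 0;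
  this is where the divergence condition yields a lower bound.\<close>

lemma nn_integral_y_lower:
  assumes "0 < s"
  shows "ennreal (y s powr (-2) / (2 * p)) \<le> (\<integral>\<^sup>+t\<in>{0<..s}. ennreal (t powr (-p-1) * V t * y t powr (-3)) \<partial>lborel)"
    (is "_ \<le> ?I")
proof (rule ennreal_le_epsilon)
  fix e :: real assume "0 < e"
  \<comment> \<open>With \<open>y a \<ge> W a \<ge> c \<ge> 1\<close>, the lost value is
    \<open>y a powr (-2) \<le> 1 / y a \<le> 1 / c \<le> e\<close>.\<close>
  define c where "c = max 1 (1 / e)"
  obtain a where a: "0 < a" "a < s" "c \<le> W a" using W_unbounded[OF assms] by blast
  have c: "1 \<le> c" "1 / c \<le> e" using \<open>0 < e\<close> by (auto simp: c_def max_def field_simps)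
  have "y a powr (-2) \<le> y a powr (-1)"
    using W_le_y[OF a(1)] a(3) c by (intro powr_mono) auto
  also have "\<dots> \<le> 1 / c" using W_le_y[OF a(1)] a(3) c by (simp add: powr_minus divide_simps)
  also have "\<dots> \<le> e" by (rule c)
  finally have e: "y a powr (-2) \<le> e" .
  have "(\<integral>\<^sup>+t\<in>{a..s}. ennreal (t powr (-p-1) * V t * y t powr (-3)) \<partial>lborel)
      = ennreal (1 / (2 * p) * y s powr (-2) - 1 / (2 * p) * y a powr (-2))"
  proof (rule nn_integral_FTC_Icc[where F="\<lambda>x. 1 / (2 * p) * y x powr (-2)"])
    fix x assume "x \<in> {a..s}"
    then have "0 < x" using a by simp
    show "((\<lambda>x. 1 / (2 * p) * y x powr (-2)) has_real_derivative x powr (-p-1) * V x * y x powr (-3)) (at x)"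
      using DERIV_cmult[OF y_powr_deriv[OF \<open>0 < x\<close>, of "-2"], of "1 / (2*p)"] p_gt by (simp add: mult_ac)
    show "0 \<le> x powr (-p-1) * V x * y x powr (-3)" using V_nonneg by simp
  qed (use a in auto)
  moreover have "\<dots> \<le> ?I"
    unfolding calculation[symmetric] using a by (intro nn_integral_mono) (auto split: split_indicator)
  ultimately have 1: "ennreal (1 / (2 * p) * y s powr (-2) - 1 / (2 * p) * y a powr (-2)) \<le> ?I" by simp
  have "1 / (2 * p) * y a powr (-2) \<le> 1 * e" using e p_gt by (intro mult_mono) (auto simp: divide_simps)
  then have "y s powr (-2) / (2 * p) \<le> max 0 (1 / (2 * p) * y s powr (-2) - 1 / (2 * p) * y a powr (-2)) + e"
    by simp
  then have "ennreal (y s powr (-2) / (2 * p)) \<le> ennreal (1 / (2 * p) * y s powr (-2) - 1 / (2 * p) * y a powr (-2)) + ennreal e"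
    using \<open>0 < e\<close> by (metis (no_types) ennreal_leI ennreal_max_0 ennreal_plus less_imp_le max.cobounded1)
  then show "ennreal (y s powr (-2) / (2 * p)) \<le> ?I + ennreal e"
    using 1 by (meson add_right_mono order_trans)
qed

text \<open>The counterpart with \<open>\<omega> powr (-2)\<close>. Since \<open>\<omega>\<close>
  may stay bounded, the value at \<open>T\<close> has to be kept; it becomes the \<open>L^1\<close>
  term.\<close>

lemma nn_integral_omega_lower:
  assumes "0 < s" "s < T"
  shows "ennreal ((\<omega> s powr (-2) - \<omega> T powr (-2)) / (2 * p)) \<le> (\<integral>\<^sup>+t\<in>{s..}. ennreal (t powr (p-1) * W t * \<omega> t powr (-3)) \<partial>lborel)"
    (is "_ \<le> ?I")
proof -
  have "(\<integral>\<^sup>+t\<in>{s..T}. ennreal (t powr (p-1) * W t * \<omega> t powr (-3)) \<partial>lborel)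
      = ennreal (- (1 / (2 * p) * \<omega> T powr (-2)) - - (1 / (2 * p) * \<omega> s powr (-2)))"
  proof (rule nn_integral_FTC_Icc[where F="\<lambda>x. - (1 / (2 * p) * \<omega> x powr (-2))"])
    fix x assume "x \<in> {s..T}"
    then have "0 < x" using assms by simp
    show "((\<lambda>x. - (1 / (2 * p) * \<omega> x powr (-2))) has_real_derivative x powr (p-1) * W x * \<omega> x powr (-3)) (at x)"
      using DERIV_minus[OF DERIV_cmult[OF omega_powr_deriv[OF \<open>0 < x\<close>, of "-2"], of "1 / (2*p)"]] p_gt by (simp add: mult_ac)
    show "0 \<le> x powr (p-1) * W x * \<omega> x powr (-3)" using W_nonneg by simp
  qed (use assms in auto)
  moreover have "\<dots> \<le> ?I"
    unfolding calculation[symmetric] by (intro nn_integral_mono) (auto split: split_indicator)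
  ultimately show ?thesis by (simp add: diff_divide_distrib)
qed

text \<open>The weight of the \<open>L\<^sup>1\<close> term in the duality theorem.\<close>

definition "e = (if emeasure N UNIV = \<infinity> then 0 else measure N UNIV powr (-(1/p)))"

text \<open>Boundary terms at \<open>T = n\<close> carry the factor
  \<open>V T powr (-(1/p))\<close>, and \<open>e\<close> is its limit. In the finite case
  \<open>V 1 > 0\<close> keeps the base away from 0, where the power would be discontinuous.\<close>

lemma V_powr_tendsto: "(\<lambda>n. V (real n) powr (-(1/p))) \<longlonglongrightarrow> e"
proof -
  have "(\<Union>n. {..real n}) = (UNIV :: real set)" using real_arch_simple by auto
  then have lim: "(\<lambda>n. emeasure N {..real n}) \<longlonglongrightarrow> emeasure N UNIV"
    using Lim_emeasure_incseq[of "\<lambda>n. {..real n}" N] by (auto simp: incseq_def image_subset_iff)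
  show ?thesis
  proof (cases "emeasure N UNIV = \<infinity>")
    case True
    have "filterlim (\<lambda>n. V (real n)) at_top sequentially"
      using lim True by (simp add: emeasure_N_atMost ennreal_tendsto_top_eq_at_top)
    then show ?thesis using True p_gt unfolding e_def by (auto intro!: tendsto_neg_powr)
  next
    case False
    then have eq: "emeasure N UNIV = ennreal (measure N UNIV)" by (simp add: emeasure_eq_ennreal_measure)
    have "(\<lambda>n. V (real n)) \<longlonglongrightarrow> measure N UNIV"
      using lim unfolding eq emeasure_N_atMost by (subst (asm) tendsto_ennreal_iff) (auto simp: V_nonneg)
    moreover have "measure N UNIV \<noteq> 0"
    proof -
      have "ennreal (V 1) \<le> emeasure N UNIV" unfolding emeasure_N_atMost[symmetric] by (intro emeasure_mono) auto
      then show ?thesis using V_pos[of 1] eq by auto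
    qed
    ultimately show ?thesis using False unfolding e_def by (auto intro!: tendsto_powr)
  qed
qed

lemma e_nonneg: "0 \<le> e" by (simp add: e_def)

definition "avg h t = (\<integral>\<^sup>+r. ennreal (K (p-1) t r * h r) \<partial>N)"

lemma avg_meas[measurable]:
  assumes [measurable]: "h \<in> borel_measurable borel" shows "avg h \<in> borel_measurable borel"
proof -
  interpret N: sigma_finite_measure N by (rule sigma_finite_N)
  show ?thesis unfolding avg_def[abs_def] by measurable
qed

context
  fixes k :: "real \<Rightarrow> real"
  assumes k_meas[measurable]: "k \<in> borel_measurable borel" and k0: "\<And>t. 0 \<le> k t"
    and mono: "\<And>s t. 0 < s \<Longrightarrow> s \<le> t \<Longrightarrow> k s \<le> k t"
    and anti: "\<And>s t. 0 < s \<Longrightarrow> s \<le> t \<Longrightarrow> k t / t \<le> k s / s"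
    and norm: "(\<integral>\<^sup>+s. ennreal ((k s / s) powr p) \<partial>N) \<le> 1"
begin

text \<open>Monotonicity of \<open>k\<close> and of \<open>k t / t\<close> bounds the average from
  below by a multiple of \<open>k s\<close> on each side of \<open>s\<close>. Integration over
  \<open>t\<close> gives \<open>k s / (2 * p)\<close> times
  \<open>(1 - \<theta>)^2 + \<theta>^2\<close>, with \<open>\<theta> = V s / \<omega> s\<close>, up
  to a boundary term at \<open>T\<close>. The bracket is at least \<open>1/2\<close>, whence the
  constant \<open>4 * p\<close>.\<close>

lemma quasiconcave_le_smoothing_aux:
  assumes "0 < s" "s < T"
  shows "ennreal (k s / (4 * p)) \<le>
     (\<integral>\<^sup>+t. avg (\<lambda>r. k r / r) t * ennreal (min s t / \<omega> t * \<phi>' t) \<partial>lborel)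
     + ennreal (s * V T powr (-(1/p)) / (2 * p))"
proof -
  define I where "I = avg (\<lambda>r. k r / r)"
  have s: "0 < s" and os: "0 < \<omega> s" and oT: "0 < \<omega> T" and ys: "0 < y s" and VT: "0 < V T" and Vs: "0 < V s"
    using \<open>0 < s\<close> \<open>s < T\<close> by (auto simp: omega_pos y_pos V_pos)
  \<comment> \<open>For \<open>t \<le> s\<close> only the part \<open>r > s\<close> of the average
    is kept, where \<open>k r \<ge> k s\<close>; the kernel turns \<open>N\<close> into
    \<open>N'\<close> and produces \<open>W s\<close>.\<close>
  have I1: "ennreal (t powr (p-1) * k s * W s / \<omega> t) \<le> I t" if t: "0 < t" "t \<le> s" for t
  proof -
    have "ennreal (t powr (p-1) * k s * W s / \<omega> t) = ennreal (t powr (p-1) * k s / \<omega> t) * emeasure N' {s<..}"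
      using s k0 W_nonneg omega_pos[OF t(1)] by (simp add: emeasure_N'_greater ennreal_mult[symmetric])
    also have "\<dots> = (\<integral>\<^sup>+r\<in>{s<..}. ennreal (t powr (p-1) * k s / \<omega> t) \<partial>N')"
      using s by (simp add: nn_integral_cmult)
    also have "\<dots> = (\<integral>\<^sup>+r. ennreal (r powr (-p)) * (ennreal (t powr (p-1) * k s / \<omega> t) * indicator {s<..} r) \<partial>N)"
      using s by (subst nn_integral_N_N') auto
    also have "\<dots> \<le> I t"
      unfolding I_def avg_def
    proof (rule nn_integral_mono)
      fix r
      show "ennreal (r powr (-p)) * (ennreal (t powr (p-1) * k s / \<omega> t) * indicator {s<..} r) \<le> ennreal (K (p-1) t r * (k r / r))"
      proof (cases "s < r")
        case True
        have "r powr (-p) = r powr (-(p-1)) / r" using True s by (simp add: powr_diff powr_minus divide_simps)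
        then have "r powr (-p) * (t powr (p-1) * k s / \<omega> t) = t powr (p-1) * r powr (-(p-1)) / \<omega> t * (k s / r)" by (simp add: mult_ac)
        also have "\<dots> \<le> t powr (p-1) * r powr (-(p-1)) / \<omega> t * (k r / r)"
          using True s mono[of s r] omega_pos[OF t(1)] by (intro mult_left_mono divide_right_mono) auto
        also have "\<dots> = K (p-1) t r * (k r / r)" using True t by (simp add: K_right)
        finally show ?thesis using True k0 omega_pos[OF t(1)] by (simp add: ennreal_mult[symmetric] ennreal_leI)
      qed simp
    qed
    finally show ?thesis .
  qed
  \<comment> \<open>For \<open>t \<ge> s\<close> only the part \<open>r \<le> s\<close> is kept,
    where \<open>k r / r \<ge> k s / s\<close>; it produces \<open>V s\<close>.\<close>
  have I2: "ennreal (k s / s * V s / \<omega> t) \<le> I t" if t: "s \<le> t" for t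
  proof -
    have o: "0 < \<omega> t" using t s by (intro omega_pos) auto
    have "ennreal (k s / s * V s / \<omega> t) = ennreal (k s / s / \<omega> t) * emeasure N {..s}"
      using s k0 V_nonneg o by (simp add: emeasure_N_atMost ennreal_mult[symmetric])
    also have "\<dots> = (\<integral>\<^sup>+r\<in>{..s}. ennreal (k s / s / \<omega> t) \<partial>N)"
      by (simp add: nn_integral_cmult)
    also have "\<dots> \<le> I t"
      unfolding I_def avg_def
    proof (rule nn_integral_N_mono)
      fix r :: real assume r: "0 < r"
      show "ennreal (k s / s / \<omega> t) * indicator {..s} r \<le> ennreal (K (p-1) t r * (k r / r))"
      proof (cases "r \<le> s")
        case True
        have "k s / s / \<omega> t \<le> k r / r / \<omega> t" using True r o by (intro divide_right_mono anti) auto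
        also have "\<dots> = K (p-1) t r * (k r / r)" using True r t by (simp add: K_left)
        finally show ?thesis using True by (simp add: ennreal_leI)
      qed simp
    qed
    finally show ?thesis .
  qed
  let ?a = "\<lambda>t. ennreal (t powr (-p-1) * V t * y t powr (-3)) * indicator {0<..s} t" and ?b = "\<lambda>t. ennreal (t powr (p-1) * W t * \<omega> t powr (-3)) * indicator {s..} t"
    and ?w = "ennreal (k s * (W s)\<^sup>2)" and ?v = "ennreal (k s * (V s)\<^sup>2)"
  have "?w * ennreal (y s powr (-2) / (2 * p)) + ?v * ennreal ((\<omega> s powr (-2) - \<omega> T powr (-2)) / (2 * p))
     \<le> ?w * (\<integral>\<^sup>+t. ?a t \<partial>lborel)
      + ?v * (\<integral>\<^sup>+t. ?b t \<partial>lborel)"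
    using \<open>0 < s\<close> \<open>s < T\<close> by (intro add_mono mult_left_mono nn_integral_y_lower nn_integral_omega_lower) auto
  also have "\<dots> = (\<integral>\<^sup>+t. ?w * ?a t
      + ?v * ?b t \<partial>lborel)"
    by (subst nn_integral_add) (auto simp: nn_integral_cmult)
  also have "\<dots> \<le> (\<integral>\<^sup>+t. I t * ennreal (min s t / \<omega> t * \<phi>' t) \<partial>lborel)"
  proof (rule nn_integral_mono_AE, use AE_lborel_singleton[of s] in eventually_elim)
    \<comment> \<open>At \<open>t = s\<close> both indicators equal 1 and the two halves would be
      counted twice; the point is null.\<close>
    fix t assume "t \<noteq> s"
    show "?w * ?a t
      + ?v * ?b t
      \<le> I t * ennreal (min s t / \<omega> t * \<phi>' t)"
    proof (cases "0 < t")
      case t: True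
      have o: "0 < \<omega> t" by (rule omega_pos) fact
      have o3: "\<omega> t powr (-3) = 1 / \<omega> t ^ 3" using o by (simp add: powr_minus divide_simps)
      show ?thesis
      proof (cases "t < s")
        case True
        have W: "W s \<le> W t" using t True by (intro W_antimono) auto
        have "t powr p = t * t powr (p-1)" using t by (simp add: powr_diff)
        have "\<omega> t powr (-3) = y t powr (-3) * t powr (p * (-3))"
          using y_pos[OF t] by (simp add: omega_y[OF t] powr_mult powr_powr)
        then have "t powr (p-1) * t powr p * \<omega> t powr (-3) = t powr (p - 1 + p + p * (-3)) * y t powr (-3)"
          unfolding powr_add by simp
        also have "p - 1 + p + p * (-3) = -p-1" by simp
        finally have e: "t powr (-p-1) * y t powr (-3) = t powr (p-1) * t powr p / \<omega> t ^ 3" by (simp add: o3)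
        have "k s * (W s)\<^sup>2 * (t powr (-p-1) * V t * y t powr (-3)) = k s * (W s)\<^sup>2 * V t * (t powr (-p-1) * y t powr (-3))" by simp
        also have "\<dots> = (t powr (p-1) * k s * W s / \<omega> t) * (t / \<omega> t * (V t * W s * t powr (p-1) / \<omega> t))"
          unfolding e \<open>t powr p = t * t powr (p-1)\<close> by (simp add: power2_eq_square power3_eq_cube mult_ac)
        also have "\<dots> \<le> (t powr (p-1) * k s * W s / \<omega> t) * (t / \<omega> t * \<phi>' t)"
          unfolding \<phi>'_def using W o t k0[of s] W_nonneg[of s] V_nonneg[of t]
          by (intro mult_left_mono divide_right_mono mult_right_mono) auto
        finally have "ennreal (k s * (W s)\<^sup>2 * (t powr (-p-1) * V t * y t powr (-3))) \<le> ennreal (t powr (p-1) * k s * W s / \<omega> t) * ennreal (t / \<omega> t * \<phi>' t)"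
          using o t k0[of s] W_nonneg[of s] phi'_nonneg[of t] by (simp add: ennreal_mult[symmetric] ennreal_leI)
        also have "\<dots> \<le> I t * ennreal (t / \<omega> t * \<phi>' t)" using t True by (intro mult_right_mono I1) auto
        finally show ?thesis using True t k0 V_nonneg by (simp add: ennreal_mult[symmetric])
      next
        case False
        have V: "V s \<le> V t" using False by (intro V_mono) auto
        have "k s * (V s)\<^sup>2 * (t powr (p-1) * W t * \<omega> t powr (-3)) = (k s / s * V s / \<omega> t) * (s / \<omega> t * (V s * W t * t powr (p-1) / \<omega> t))"
          unfolding o3 using s by (simp add: power2_eq_square power3_eq_cube mult_ac)
        also have "\<dots> \<le> (k s / s * V s / \<omega> t) * (s / \<omega> t * \<phi>' t)"
          unfolding \<phi>'_def using V o s k0[of s] W_nonneg[of t] V_nonneg[of s]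
          by (intro mult_left_mono divide_right_mono mult_right_mono) auto
        finally have "ennreal (k s * (V s)\<^sup>2 * (t powr (p-1) * W t * \<omega> t powr (-3))) \<le> ennreal (k s / s * V s / \<omega> t) * ennreal (s / \<omega> t * \<phi>' t)"
          using o s k0[of s] V_nonneg[of s] phi'_nonneg[of t] by (simp add: ennreal_mult[symmetric] ennreal_leI)
        also have "\<dots> \<le> I t * ennreal (s / \<omega> t * \<phi>' t)" using False by (intro mult_right_mono I2) auto
        finally show ?thesis using False \<open>t \<noteq> s\<close> k0 W_nonneg by (simp add: ennreal_mult[symmetric])
      qed
    qed (use s in auto)
  qed
  finally have main: "?w * ennreal (y s powr (-2) / (2 * p)) + ?v * ennreal ((\<omega> s powr (-2) - \<omega> T powr (-2)) / (2 * p))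
     \<le> (\<integral>\<^sup>+t. I t * ennreal (min s t / \<omega> t * \<phi>' t) \<partial>lborel)" .

  \<comment> \<open>The boundary term: since \<open>k r / r\<close> decreases, the norm bound gives
    \<open>k s / s \<le> V s powr (-(1/p))\<close>. As \<open>2 - 1/p > 0\<close>,
    \<open>V s\<close> may be replaced by \<open>V T\<close> in \<open>(k s / s) * (V s)^2\<close>,
    and \<open>V T \<le> \<omega> T\<close> cancels the square.\<close>
  have "ennreal ((k s / s) powr p * V s) = (\<integral>\<^sup>+r\<in>{..s}. ennreal ((k s / s) powr p) \<partial>N)"
    by (simp add: nn_integral_cmult emeasure_N_atMost ennreal_mult V_nonneg)
  also have "\<dots> \<le> (\<integral>\<^sup>+r. ennreal ((k r / r) powr p) \<partial>N)"
  proof (rule nn_integral_N_mono)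
    fix r :: real assume "0 < r"
    then show "ennreal ((k s / s) powr p) * indicator {..s} r \<le> ennreal ((k r / r) powr p)"
      using p_gt k0 s by (auto intro!: ennreal_leI powr_mono2 anti split: split_indicator)
  qed
  also note norm
  finally have "(k s / s) powr p * V s \<le> 1" by simp
  then have "(k s / s) powr p \<le> 1 / V s" using Vs by (simp add: field_simps)
  then have "((k s / s) powr p) powr (1/p) \<le> (1 / V s) powr (1/p)" using p_gt by (intro powr_mono2) auto
  then have hs: "k s / s \<le> V s powr (-(1/p))"
    using p_gt k0[of s] s Vs by (simp add: powr_powr powr_divide powr_minus divide_simps)
  have "k s / s * (V s)\<^sup>2 \<le> V s powr (-(1/p)) * V s powr 2"
    using mult_right_mono[OF hs, of "(V s)\<^sup>2"] Vs by simp
  also have "\<dots> = V s powr (2 - 1/p)" by (simp flip: powr_add)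
  also have "\<dots> \<le> V T powr (2 - 1/p)" using Vs p_gt V_mono[of s T] \<open>s < T\<close> by (intro powr_mono2) (auto simp: divide_simps)
  also have "\<dots> = V T powr (-(1/p)) * V T powr 2" by (simp flip: powr_add)
  finally have "k s / s * (V s)\<^sup>2 \<le> V T powr (-(1/p)) * (V T)\<^sup>2" using VT by simp
  then have "k s / s * (V s)\<^sup>2 \<le> V T powr (-(1/p)) * (\<omega> T)\<^sup>2"
    using V_le_omega[of T] VT by (smt (verit) mult_left_mono power_mono powr_ge_zero)
  then have bdry: "k s * (V s)\<^sup>2 / (\<omega> T)\<^sup>2 \<le> s * V T powr (-(1/p))"
    using s oT by (simp add: field_simps)
  have "ennreal (k s / (4 * p)) \<le> ennreal (k s * (W s)\<^sup>2 * (y s powr (-2) / (2 * p)) + k s * (V s)\<^sup>2 * ((\<omega> s powr (-2) - \<omega> T powr (-2)) / (2 * p)) + s * V T powr (-(1/p)) / (2 * p))"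
  proof (rule ennreal_leI)
    \<comment> \<open>\<open>V s\<close> and \<open>s^p W s\<close> add up to
      \<open>\<omega> s\<close>, so \<open>W s / y s = 1 - \<theta>\<close>: whichever share is
      large, one of the two halves is substantial.\<close>
    define \<theta> where "\<theta> = V s / \<omega> s"
    have "(W s)\<^sup>2 * y s powr (-2) = (W s / y s)\<^sup>2" using ys by (simp add: powr_minus power_divide divide_simps)
    also have "W s / y s = 1 - \<theta>" using os s unfolding \<theta>_def y_def by (simp add: powr_minus divide_simps) (simp add: \<omega>_def algebra_simps)
    finally have 1: "(W s)\<^sup>2 * y s powr (-2) = (1 - \<theta>)\<^sup>2" .
    have 2: "(V s)\<^sup>2 * \<omega> s powr (-2) = \<theta>\<^sup>2" using os unfolding \<theta>_def by (simp add: powr_minus power_divide divide_simps)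
    have 3: "(V s)\<^sup>2 * \<omega> T powr (-2) = (V s)\<^sup>2 / (\<omega> T)\<^sup>2" using oT by (simp add: powr_minus divide_simps)
    have "1 / 2 \<le> (1 - \<theta>)\<^sup>2 + \<theta>\<^sup>2" 
      using zero_le_power2[of "\<theta> - 1/2"] by (simp add: power2_eq_square algebra_simps)
    then have "k s * (1 / 2) \<le> k s * ((1 - \<theta>)\<^sup>2 + \<theta>\<^sup>2)" using k0 by (intro mult_left_mono) auto
    then have 4: "k s / 2 \<le> k s * (1 - \<theta>)\<^sup>2 + k s * \<theta>\<^sup>2 - k s * ((V s)\<^sup>2 / (\<omega> T)\<^sup>2) + s * V T powr (-(1/p))"
      using bdry by (simp add: distrib_left)
    have "k s * (W s)\<^sup>2 * (y s powr (-2) / (2 * p)) + k s * (V s)\<^sup>2 * ((\<omega> s powr (-2) - \<omega> T powr (-2)) / (2 * p)) + s * V T powr (-(1/p)) / (2 * p)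
      = (k s * ((W s)\<^sup>2 * y s powr (-2)) + k s * ((V s)\<^sup>2 * \<omega> s powr (-2)) - k s * ((V s)\<^sup>2 * \<omega> T powr (-2)) + s * V T powr (-(1/p))) / (2 * p)"
      by (simp add: add_divide_distrib diff_divide_distrib right_diff_distrib mult.assoc)
    also have "\<dots> \<ge> (k s / 2) / (2 * p)" unfolding 1 2 3 using 4 p_gt by (intro divide_right_mono) auto
    finally show "k s / (4 * p) \<le> k s * (W s)\<^sup>2 * (y s powr (-2) / (2 * p)) + k s * (V s)\<^sup>2 * ((\<omega> s powr (-2) - \<omega> T powr (-2)) / (2 * p)) + s * V T powr (-(1/p)) / (2 * p)"
      by simp
  qed
  note lower = this
  have "\<omega> s \<le> \<omega> T" using s \<open>s < T\<close> by (intro omega_mono) auto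
  then have "\<omega> T powr (-2) \<le> \<omega> s powr (-2)" using os by (intro powr_mono2') auto
  then have "ennreal (k s * (W s)\<^sup>2 * (y s powr (-2) / (2 * p)) + k s * (V s)\<^sup>2 * ((\<omega> s powr (-2) - \<omega> T powr (-2)) / (2 * p)) + s * V T powr (-(1/p)) / (2 * p)) = ennreal (k s * (W s)\<^sup>2) * ennreal (y s powr (-2) / (2 * p)) + ennreal (k s * (V s)\<^sup>2) * ennreal ((\<omega> s powr (-2) - \<omega> T powr (-2)) / (2 * p)) + ennreal (s * V T powr (-(1/p)) / (2 * p))"
    using k0[of s] s p_gt by (simp add: ennreal_mult[symmetric] del: times_divide_eq_right)
  also have "\<dots> \<le> (\<integral>\<^sup>+t. I t * ennreal (min s t / \<omega> t * \<phi>' t) \<partial>lborel) + ennreal (s * V T powr (-(1/p)) / (2 * p))"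
    by (intro add_right_mono main)
  finally show ?thesis using lower unfolding I_def by (rule order_trans[rotated])
qed

text \<open>\<open>T = n\<close> tends to infinity in the preceding estimate. Clearing the factor
  \<open>1/(4 * p)\<close> turns the boundary coefficient \<open>1/(2 * p)\<close> into 2.\<close>

lemma quasiconcave_le_smoothing:
  assumes "0 < s"
  shows "ennreal (k s) \<le> ennreal (4 * p) * (\<integral>\<^sup>+t. avg (\<lambda>r. k r / r) t * ennreal (min s t / \<omega> t * \<phi>' t) \<partial>lborel) + ennreal (2 * e * s)"
    (is "_ \<le> ennreal (4 * p) * ?J + _")
proof (rule LIMSEQ_le_const)
  show "(\<lambda>n. ennreal (4 * p) * ?J + ennreal (2 * V (real n) powr (-(1/p)) * s)) \<longlonglongrightarrow> ennreal (4 * p) * ?J + ennreal (2 * e * s)"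
    by (intro tendsto_add tendsto_const tendsto_ennrealI tendsto_mult V_powr_tendsto)
  obtain n0 where "s < real n0" using reals_Archimedean2 by blast
  show "\<exists>n0. \<forall>n\<ge>n0. ennreal (k s) \<le> ennreal (4 * p) * ?J + ennreal (2 * V (real n) powr (-(1/p)) * s)"
  proof (intro exI[of _ n0] allI impI)
    fix n assume "n0 \<le> n"
    then have sn: "s < real n" using \<open>s < real n0\<close> by linarith
    have "ennreal (k s) = ennreal (4 * p) * ennreal (k s / (4 * p))"
      using p_gt k0[of s] by (simp flip: ennreal_mult)
    also have "\<dots> \<le> ennreal (4 * p) * (?J + ennreal (s * V (real n) powr (-(1/p)) / (2 * p)))"
      by (intro mult_left_mono quasiconcave_le_smoothing_aux assms sn) auto
    also have "\<dots> = ennreal (4 * p) * ?J + ennreal (2 * V (real n) powr (-(1/p)) * s)"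
      using p_gt \<open>0 < s\<close> by (simp add: distrib_left mult_ac flip: ennreal_mult)
    finally show "ennreal (k s) \<le> ennreal (4 * p) * ?J + ennreal (2 * V (real n) powr (-(1/p)) * s)" .
  qed
qed

end

end

subsection \<open>Rearrangements and the K-functional\<close>

text \<open>\<open>t f**(t)\<close> by the layer cake formula; \<open>t\<close> is extended so that it may be the measure of a set.\<close>

definition kfun :: "'a measure \<Rightarrow> ('a \<Rightarrow> real) \<Rightarrow> ennreal \<Rightarrow> ennreal" where
  "kfun M f t = (\<integral>\<^sup>+l\<in>{0<..}. min t (distr_fun M f l) \<partial>lborel)"

lemma kfun_mono: "s \<le> t \<Longrightarrow> kfun M f s \<le> kfun M f t"
  unfolding kfun_def by (intro nn_integral_mono mult_right_mono min.mono) auto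

lemma kfun_mono_fun:
  assumes [measurable]: "g \<in> borel_measurable M" and "\<And>x. x \<in> space M \<Longrightarrow> \<bar>f x\<bar> \<le> \<bar>g x\<bar>"
  shows "kfun M f t \<le> kfun M g t"
  unfolding kfun_def distr_fun_def
  using assms(2) by (intro nn_integral_mono mult_right_mono min.mono emeasure_mono) (auto intro: less_le_trans)

lemma min_cmult_ennreal_le: "1 \<le> c \<Longrightarrow> min (c * t) D \<le> c * min t D" for c t D :: ennreal
  by (cases "t \<le> D") (auto simp: min_def mult_left_mono intro: order_trans[OF _ mult_right_mono[of 1 c D]])

lemma emeasure_lborel_Ioo': "emeasure lborel {a<..<b::real} = ennreal (b - a)"
  by (cases a b rule: linorder_cases) (auto simp: ennreal_neg)

context sigma_finite_measure
begin

lemma distr_fun_meas[measurable]: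
  assumes [measurable]: "f \<in> borel_measurable M"
  shows "distr_fun M f \<in> borel_measurable borel"
  unfolding distr_fun_def[abs_def] by measurable

text \<open>This is what makes \<open>K(f,t) / t\<close> decreasing.\<close>

lemma kfun_cmult_le:
  assumes [measurable]: "f \<in> borel_measurable M" and "1 \<le> c"
  shows "kfun M f (c * t) \<le> c * kfun M f t"
proof -
  have "kfun M f (c * t) \<le> (\<integral>\<^sup>+l. c * (min t (distr_fun M f l) * indicator {0<..} l) \<partial>lborel)"
    unfolding kfun_def mult.assoc[symmetric] by (intro nn_integral_mono mult_right_mono min_cmult_ennreal_le assms) auto
  also have "\<dots> = c * kfun M f t" unfolding kfun_def by (intro nn_integral_cmult) measurable
  finally show ?thesis .
qed

text \<open>The distribution function decreases, so the \<open>l > 0\<close> at which it exceeds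
  \<open>s\<close> form an interval with left end 0, and its length is the infimum defining
  \<open>rearr\<close>. In this form Tonelli applies.\<close>

lemma rearr_eq_nn_integral:
  assumes [measurable]: "f \<in> borel_measurable M"
  shows "rearr M f s = (\<integral>\<^sup>+l. indicator {l. 0 < l \<and> ennreal s < distr_fun M f l} l \<partial>lborel)"
proof -
  let ?S = "{l. 0 < l \<and> ennreal s < distr_fun M f l}"
  have [measurable]: "?S \<in> sets borel" by measurable
  have anti: "distr_fun M f l' \<le> distr_fun M f l" if "l \<le> l'" for l l'
    unfolding distr_fun_def using that by (intro emeasure_mono) auto
  have up: "ennreal l \<le> rearr M f s" if "l \<in> ?S" for l
    unfolding rearr_def
  proof (rule INF_greatest)
    fix l' assume l': "l' \<in> {l. 0 < l \<and> distr_fun M f l \<le> ennreal s}"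
    have "l \<le> l'"
    proof (rule ccontr)
      assume "\<not> l \<le> l'"
      with l' anti[of l' l] that show False by auto
    qed
    then show "ennreal l \<le> ennreal l'" by (rule ennreal_leI)
  qed
  have low: "l \<in> ?S" if "0 < l" "ennreal l < rearr M f s" for l
  proof (rule ccontr)
    assume "l \<notin> ?S"
    then have "rearr M f s \<le> ennreal l" unfolding rearr_def using that by (intro INF_lower) auto
    then show False using that by simp
  qed
  have "emeasure lborel ?S = rearr M f s"
  proof (cases "rearr M f s")
    case (real r)
    have "?S \<subseteq> {0<..r}" using up real by (force simp: ennreal_le_iff)
    then have 1: "emeasure lborel ?S \<le> ennreal r" using emeasure_mono[of ?S "{0<..r}" lborel] real by simp
    have "{0<..<r} \<subseteq> ?S" using low real by (force simp: ennreal_less_iff)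
    then have "ennreal r \<le> emeasure lborel ?S" using emeasure_mono[of "{0<..<r}" ?S lborel] real by simp
    with 1 real show ?thesis by simp
  next
    case top
    then have "?S = {0<..}" using low by (auto simp: less_top[symmetric])
    moreover have "emeasure lborel {0::real<..} = \<infinity>"
    proof (rule ccontr)
      assume "emeasure lborel {0::real<..} \<noteq> \<infinity>"
      then obtain c where c: "emeasure lborel {0::real<..} = ennreal c" "0 \<le> c"
        by (cases "emeasure lborel {0::real<..}") auto
      have "emeasure lborel {0<..c+1} \<le> emeasure lborel {0::real<..}" by (intro emeasure_mono) auto
      then show False using c by (simp add: ennreal_less_iff)
    qed
    ultimately show ?thesis using top by simp
  qed
  then show ?thesis by simp
qed

lemma rearr_meas[measurable]:
  assumes [measurable]: "f \<in> borel_measurable M"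
  shows "rearr M f \<in> borel_measurable borel"
proof -
  have "(\<lambda>s. \<integral>\<^sup>+l. indicator {l. 0 < l \<and> ennreal s < distr_fun M f l} l \<partial>lborel) \<in> borel_measurable borel"
    unfolding indicator_def by measurable
  then show ?thesis by (subst measurable_cong[OF rearr_eq_nn_integral[OF assms]])
qed

text \<open>Tonelli on the region of \<open>(s, l)\<close> with \<open>0 < s < t\<close>,
  \<open>l > 0\<close> and \<open>s < \<mu>_f(l)\<close>: its section at height \<open>l\<close> has
  length \<open>min t (\<mu>_f(l))\<close>.\<close>

lemma nn_integral_rearr:
  assumes [measurable]: "f \<in> borel_measurable M"
  shows "(\<integral>\<^sup>+s\<in>{0<..<t}. rearr M f s \<partial>lebesgue) = kfun M f (ennreal t)"
proof -
  have "(\<integral>\<^sup>+s\<in>{0<..<t}. rearr M f s \<partial>lebesgue)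
     = (\<integral>\<^sup>+s. (\<integral>\<^sup>+l. indicator {l. 0 < l \<and> ennreal s < distr_fun M f l} l * indicator {0<..<t} s \<partial>lborel) \<partial>lborel)"
    unfolding nn_integral_completion rearr_eq_nn_integral[OF assms]
    by (intro nn_integral_cong nn_integral_multc[symmetric]) measurable
  also have "\<dots> = (\<integral>\<^sup>+l. (\<integral>\<^sup>+s\<in>{0<..<t}. indicator {l. 0 < l \<and> ennreal s < distr_fun M f l} l \<partial>lborel) \<partial>lborel)"
    by (rule lborel_pair.Fubini') (simp add: indicator_def, measurable)
  also have "\<dots> = kfun M f (ennreal t)"
    unfolding kfun_def
  proof (rule nn_integral_cong)
    fix l :: real
    let ?D = "distr_fun M f l"
    show "(\<integral>\<^sup>+s\<in>{0<..<t}. indicator {l. 0 < l \<and> ennreal s < distr_fun M f l} l \<partial>lborel) = min (ennreal t) ?D * indicator {0<..} l"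
    proof (cases "0 < l")
      case True
      have "(\<integral>\<^sup>+s\<in>{0<..<t}. indicator {l. 0 < l \<and> ennreal s < distr_fun M f l} l \<partial>lborel)
         = (\<integral>\<^sup>+s. indicator {s. 0 < s \<and> s < t \<and> ennreal s < ?D} s \<partial>lborel)"
        using True by (intro nn_integral_cong) (auto simp: indicator_def)
      also have "\<dots> = emeasure lborel {s. 0 < s \<and> s < t \<and> ennreal s < ?D}" by simp
      also have "\<dots> = min (ennreal t) ?D"
      proof (cases ?D)
        case (real d)
        have "{s. 0 < s \<and> s < t \<and> ennreal s < ?D} = {0<..<min t d}" using real by (auto simp: ennreal_less_iff)
        also have "emeasure lborel \<dots> = min (ennreal t) (ennreal d)"
          using real by (cases "0 \<le> t") (auto simp: min_def ennreal_leI ennreal_neg not_le ennreal_less_iff)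
        finally show ?thesis using real by simp
      next
        case top
        have "{s. 0 < s \<and> s < t \<and> ennreal s < ?D} = {0<..<t}" using top by (auto simp: less_top[symmetric])
        then have "emeasure lborel {s. 0 < s \<and> s < t \<and> ennreal s < ?D} = ennreal t" by (simp only: emeasure_lborel_Ioo') simp
        then show ?thesis using top by simp
      qed
      finally show ?thesis using True by simp
    qed simp
  qed
  finally show ?thesis .
qed

lemma max_rearr_eq:
  assumes "f \<in> borel_measurable M"
  shows "max_rearr M f t = kfun M f (ennreal t) / ennreal t"
  by (simp add: max_rearr_def nn_integral_rearr assms)

lemma nn_integral_layer:
  assumes [measurable]: "f \<in> borel_measurable M" "g \<in> borel_measurable M" and "0 \<le> c"
  shows "(\<integral>\<^sup>+l. (\<integral>\<^sup>+x. g x * indicator {x. \<bar>f x\<bar> > l} x \<partial>M) * indicator {c<..} l \<partial>lborel) = (\<integral>\<^sup>+x. g x * ennreal (\<bar>f x\<bar> - c) \<partial>M)"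
proof -
  interpret P: pair_sigma_finite M lborel ..
  have "(\<integral>\<^sup>+l. (\<integral>\<^sup>+x. g x * indicator {x. \<bar>f x\<bar> > l} x \<partial>M) * indicator {c<..} l \<partial>lborel)
     = (\<integral>\<^sup>+l. (\<integral>\<^sup>+x. g x * indicator {x. \<bar>f x\<bar> > l} x * indicator {c<..} l \<partial>M) \<partial>lborel)"
    by (intro nn_integral_cong nn_integral_multc[symmetric]) measurable
  also have "\<dots> = (\<integral>\<^sup>+x. (\<integral>\<^sup>+l\<in>{c<..}. g x * indicator {x. \<bar>f x\<bar> > l} x \<partial>lborel) \<partial>M)"
    by (rule P.Fubini') (simp add: indicator_def, measurable)
  also have "\<dots> = (\<integral>\<^sup>+x. g x * ennreal (\<bar>f x\<bar> - c) \<partial>M)"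
  proof (rule nn_integral_cong)
    fix x
    have "(\<integral>\<^sup>+l\<in>{c<..}. g x * indicator {x. \<bar>f x\<bar> > l} x \<partial>lborel) = (\<integral>\<^sup>+l\<in>{c<..<\<bar>f x\<bar>}. g x \<partial>lborel)"
      by (intro nn_integral_cong) (auto simp: indicator_def)
    also have "\<dots> = g x * ennreal (\<bar>f x\<bar> - c)"
      by (subst nn_integral_cmult_indicator) (auto simp: emeasure_lborel_Ioo')
    finally show "(\<integral>\<^sup>+l\<in>{c<..}. g x * indicator {x. \<bar>f x\<bar> > l} x \<partial>lborel) = g x * ennreal (\<bar>f x\<bar> - c)" .
  qed
  finally show ?thesis .
qed

lemma nn_integral_distr_fun:
  assumes [measurable]: "f \<in> borel_measurable M" and "0 \<le> c"
  shows "(\<integral>\<^sup>+l\<in>{c<..}. distr_fun M f l \<partial>lborel) = (\<integral>\<^sup>+x. ennreal (\<bar>f x\<bar> - c) \<partial>M)"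
proof -
  have "distr_fun M f l = (\<integral>\<^sup>+x. 1 * indicator {x. \<bar>f x\<bar> > l} x \<partial>M)" for l
  proof -
    have "(\<integral>\<^sup>+x. 1 * indicator {x. \<bar>f x\<bar> > l} x \<partial>M) = (\<integral>\<^sup>+x. indicator {x \<in> space M. \<bar>f x\<bar> > l} x \<partial>M)"
      by (intro nn_integral_cong) (auto simp: indicator_def)
    then show ?thesis by (simp add: distr_fun_def)
  qed
  then show ?thesis using nn_integral_layer[OF assms(1), of "\<lambda>_. 1"] assms by simp
qed

text \<open>Layer by layer, \<open>E \<inter> {|f| > l}\<close> has measure at most
  \<open>\<mu>(E)\<close> and at most \<open>\<mu>_f(l)\<close>.\<close>

lemma set_nn_integral_le_kfun:
  assumes [measurable]: "f \<in> borel_measurable M" "E \<in> sets M"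
  shows "(\<integral>\<^sup>+x\<in>E. ennreal \<bar>f x\<bar> \<partial>M) \<le> kfun M f (emeasure M E)"
proof -
  have "(\<integral>\<^sup>+x\<in>E. ennreal \<bar>f x\<bar> \<partial>M) = (\<integral>\<^sup>+x. indicator E x * ennreal (\<bar>f x\<bar> - 0) \<partial>M)"
    by (simp add: mult.commute)
  also have "\<dots> = (\<integral>\<^sup>+l. (\<integral>\<^sup>+x. indicator E x * indicator {x. \<bar>f x\<bar> > l} x \<partial>M) * indicator {0<..} l \<partial>lborel)"
    by (rule nn_integral_layer[symmetric]) auto
  also have "\<dots> \<le> kfun M f (emeasure M E)"
    unfolding kfun_def
  proof (intro nn_integral_mono mult_right_mono min.boundedI)
    fix l
    have "(\<integral>\<^sup>+x. indicator E x * indicator {x. \<bar>f x\<bar> > l} x \<partial>M) \<le> (\<integral>\<^sup>+x. indicator E x \<partial>M)"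
      by (intro nn_integral_mono) (auto simp: indicator_def)
    then show "(\<integral>\<^sup>+x. indicator E x * indicator {x. \<bar>f x\<bar> > l} x \<partial>M) \<le> emeasure M E" by simp
    have "(\<integral>\<^sup>+x. indicator E x * indicator {x. \<bar>f x\<bar> > l} x \<partial>M) \<le> (\<integral>\<^sup>+x. indicator {x\<in>space M. \<bar>f x\<bar> > l} x \<partial>M)"
      by (intro nn_integral_mono) (auto simp: indicator_def)
    then show "(\<integral>\<^sup>+x. indicator E x * indicator {x. \<bar>f x\<bar> > l} x \<partial>M) \<le> distr_fun M f l" by (simp add: distr_fun_def)
  qed auto
  finally show ?thesis .
qed

text \<open>The Hardy-Littlewood inequality with only \<open>g\<close> cut into layers: over
  \<open>{|g| > l}\<close>, a set of measure \<open>\<mu>_g(l)\<close>, the integral of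
  \<open>|f|\<close> is bounded by the preceding lemma.\<close>

lemma nn_integral_mult_le_kfun:
  assumes [measurable]: "f \<in> borel_measurable M" "g \<in> borel_measurable M"
  shows "(\<integral>\<^sup>+x. ennreal \<bar>f x * g x\<bar> \<partial>M) \<le> (\<integral>\<^sup>+l\<in>{0<..}. kfun M f (distr_fun M g l) \<partial>lborel)"
proof -
  have "(\<integral>\<^sup>+x. ennreal \<bar>f x * g x\<bar> \<partial>M) = (\<integral>\<^sup>+x. ennreal \<bar>f x\<bar> * ennreal (\<bar>g x\<bar> - 0) \<partial>M)"
    by (simp add: abs_mult ennreal_mult)
  also have "\<dots> = (\<integral>\<^sup>+l. (\<integral>\<^sup>+x. ennreal \<bar>f x\<bar> * indicator {x. \<bar>g x\<bar> > l} x \<partial>M) * indicator {0<..} l \<partial>lborel)"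
    by (rule nn_integral_layer[symmetric]) auto
  also have "\<dots> \<le> (\<integral>\<^sup>+l\<in>{0<..}. kfun M f (distr_fun M g l) \<partial>lborel)"
  proof (intro nn_integral_mono mult_right_mono)
    fix l
    have "(\<integral>\<^sup>+x. ennreal \<bar>f x\<bar> * indicator {x. \<bar>g x\<bar> > l} x \<partial>M) = (\<integral>\<^sup>+x\<in>{x \<in> space M. \<bar>g x\<bar> > l}. ennreal \<bar>f x\<bar> \<partial>M)"
      by (intro nn_integral_cong) (auto simp: indicator_def)
    also have "\<dots> \<le> kfun M f (distr_fun M g l)"
      unfolding distr_fun_def by (intro set_nn_integral_le_kfun) auto
    finally show "(\<integral>\<^sup>+x. ennreal \<bar>f x\<bar> * indicator {x. \<bar>g x\<bar> > l} x \<partial>M) \<le> kfun M f (distr_fun M g l)" .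
  qed auto
  finally show ?thesis .
qed

text \<open>The easy half of the formula for the K-functional of \<open>L^1\<close> and
  \<open>L^\<infinity>\<close>: \<open>|f|\<close> is split at height \<open>c\<close>, with
  \<open>\<mu>_f\<close> used above \<open>c\<close> and \<open>t\<close> below.\<close>

lemma kfun_le_add:
  assumes [measurable]: "f \<in> borel_measurable M" and "0 \<le> c"
  shows "kfun M f t \<le> (\<integral>\<^sup>+x. ennreal (\<bar>f x\<bar> - c) \<partial>M) + ennreal c * t"
proof -
  have "kfun M f t \<le> (\<integral>\<^sup>+l. distr_fun M f l * indicator {c<..} l + t * indicator {0<..c} l \<partial>lborel)"
    unfolding kfun_def using assms by (intro nn_integral_mono) (auto simp: indicator_def add_increasing2)
  also have "\<dots> = (\<integral>\<^sup>+x. ennreal (\<bar>f x\<bar> - c) \<partial>M) + ennreal c * t"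
    using assms by (subst nn_integral_add) (auto simp: nn_integral_distr_fun nn_integral_cmult mult.commute)
  finally show ?thesis .
qed

end

subsection \<open>Near-extremal functions for the K-functional\<close>

text \<open>A real-valued \<open>g*(t)\<close>; for bounded \<open>g\<close> the set is nonempty, so
  the real infimum is meaningful.\<close>

definition level :: "'a measure \<Rightarrow> ('a \<Rightarrow> real) \<Rightarrow> real \<Rightarrow> real" where
  "level M g t = Inf {l. 0 \<le> l \<and> distr_fun M g l \<le> ennreal t}"

text \<open>When \<open>{level \<le> |g|}\<close> has infinite measure, \<open>measure\<close> and then the quotient have the junk value \<open>0\<close>.
  For truncated \<open>g\<close> this happens only at level \<open>0\<close>, where that summand is irrelevant.\<close>

definition near_extremal :: "'a measure \<Rightarrow> ('a \<Rightarrow> real) \<Rightarrow> real \<Rightarrow> 'a \<Rightarrow> real" where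
  "near_extremal M g t x =
     (if level M g t < \<bar>g x\<bar> then 1 else 0) +
     (if level M g t \<le> \<bar>g x\<bar> then min 1 (t / measure M {x \<in> space M. level M g t \<le> \<bar>g x\<bar>}) else 0)"

lemma near_extremal_nonneg: "0 \<le> t \<Longrightarrow> 0 \<le> near_extremal M g t x"
  by (simp add: near_extremal_def)

lemma near_extremal_le: "near_extremal M g t x \<le> 2"
  by (auto simp: near_extremal_def min_def)

locale truncated_fun = sigma_finite_measure M for M :: "'a measure" +
  fixes g :: "'a \<Rightarrow> real" and B :: real
  assumes g_meas[measurable]: "g \<in> borel_measurable M"
    and bounded: "x \<in> space M \<Longrightarrow> \<bar>g x\<bar> \<le> B"
    and fin_supp: "emeasure M {x \<in> space M. g x \<noteq> 0} < \<infinity>"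
begin

lemma B_in: "0 \<le> t \<Longrightarrow> max B 0 \<in> {l. 0 \<le> l \<and> distr_fun M g l \<le> ennreal t}"
proof -
  have "{x \<in> space M. max B 0 < \<bar>g x\<bar>} = {}" using bounded by force
  then have "distr_fun M g (max B 0) = 0" unfolding distr_fun_def by (metis emeasure_empty)
  then show ?thesis by simp
qed

lemma distr_fun_antimono: "l \<le> l' \<Longrightarrow> distr_fun M g l' \<le> distr_fun M g l"
  unfolding distr_fun_def by (intro emeasure_mono) auto

lemma level_nonneg: "0 \<le> t \<Longrightarrow> 0 \<le> level M g t"
  unfolding level_def by (rule cInf_greatest) (use B_in[of t] in blast, simp)

lemma level_antimono: "0 \<le> s \<Longrightarrow> s \<le> t \<Longrightarrow> level M g t \<le> level M g s"
  unfolding level_def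
  by (rule cInf_superset_mono)
    (use B_in[of s] in blast, auto intro!: bdd_belowI[of _ 0] intro: order_trans[OF _ ennreal_leI])

lemma level_meas[measurable]: "(\<lambda>t. level M g (max 0 t)) \<in> borel_measurable borel"
proof -
  have "mono (\<lambda>t. - level M g (max 0 t))" by (auto simp: mono_def intro!: level_antimono)
  then have "(\<lambda>t. - (- level M g (max 0 t))) \<in> borel_measurable borel"
    by (intro borel_measurable_uminus borel_measurable_mono)
  then show ?thesis by simp
qed

text \<open>Right continuity of the distribution function: \<open>{|g| > level}\<close> is the
  increasing union of the sets \<open>{|g| > level + 1/(n+1)}\<close>.\<close>

lemma distr_fun_level: assumes "0 \<le> t" shows "distr_fun M g (level M g t) \<le> ennreal t"
proof -
  let ?l = "level M g t" and ?A = "\<lambda>n. {x \<in> space M. level M g t + 1 / real (Suc n) < \<bar>g x\<bar>}"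
  have le: "emeasure M (?A n) \<le> ennreal t" for n
  proof -
    have "?l < ?l + 1 / real (Suc n)" by simp
    then obtain l where "l \<in> {l. 0 \<le> l \<and> distr_fun M g l \<le> ennreal t}" "l < ?l + 1 / real (Suc n)"
      unfolding level_def using B_in[OF assms] cInf_lessD by (metis (no_types, lifting) empty_iff)
    then have "distr_fun M g (?l + 1 / real (Suc n)) \<le> ennreal t"
      using distr_fun_antimono[of l "?l + 1 / real (Suc n)"] by auto
    then show ?thesis by (simp add: distr_fun_def)
  qed
  have inc: "incseq ?A"
  proof (intro incseq_SucI subsetI)
    fix n x assume "x \<in> ?A n"
    moreover have "1 / real (Suc (Suc n)) \<le> 1 / real (Suc n)" by (intro divide_left_mono) auto
    ultimately show "x \<in> ?A (Suc n)" by auto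
  qed
  have "{x \<in> space M. ?l < \<bar>g x\<bar>} = (\<Union>n. ?A n)"
  proof (intro equalityI subsetI)
    fix x assume "x \<in> {x \<in> space M. ?l < \<bar>g x\<bar>}"
    then show "x \<in> (\<Union>n. ?A n)" using nat_approx_posE[of "\<bar>g x\<bar> - ?l"] by (auto simp: less_diff_eq add.commute)
  qed (auto intro: less_trans[rotated] simp: add_strict_increasing)
  then have "distr_fun M g ?l = emeasure M (\<Union>n. ?A n)" by (simp add: distr_fun_def)
  also have "\<dots> = (SUP n. emeasure M (?A n))" using inc by (intro SUP_emeasure_incseq[symmetric]) auto
  also have "\<dots> \<le> ennreal t" by (intro SUP_least le)
  finally show ?thesis .
qed

text \<open>Every nonnegative height below the infimum has a superlevel set of measure greater than
  \<open>t\<close>. \<open>{|g| \<ge> level}\<close> is the intersection of such sets, and the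
  finite support permits continuity from above.\<close>

lemma emeasure_level_ge:
  assumes "0 \<le> t" "0 < level M g t"
  shows "ennreal t \<le> emeasure M {x \<in> space M. level M g t \<le> \<bar>g x\<bar>}"
    "emeasure M {x \<in> space M. level M g t \<le> \<bar>g x\<bar>} < \<infinity>"
proof -
  let ?l = "level M g t"
  let ?A = "\<lambda>n. {x \<in> space M. ?l * (1 - 1 / real (Suc (Suc n))) < \<bar>g x\<bar>}"
  have q: "0 \<le> 1 - 1 / real (Suc (Suc n))" "1 - 1 / real (Suc (Suc n)) < 1" for n by auto
  have low: "0 \<le> ?l * (1 - 1 / real (Suc (Suc n)))" "?l * (1 - 1 / real (Suc (Suc n))) < ?l" for n
    using q[of n] assms by (auto simp del: of_nat_Suc simp: mult_less_cancel_left2)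
  have fin: "emeasure M (?A n) < \<infinity>" for n
    using low(1)[of n] by (intro le_less_trans[OF emeasure_mono fin_supp]) (auto simp del: of_nat_Suc)
  show "emeasure M {x \<in> space M. level M g t \<le> \<bar>g x\<bar>} < \<infinity>"
    using assms by (intro le_less_trans[OF emeasure_mono fin_supp]) auto
  have ge: "ennreal t \<le> emeasure M (?A n)" for n
  proof (rule ccontr)
    assume "\<not> ?thesis"
    then have "?l * (1 - 1 / real (Suc (Suc n))) \<in> {l. 0 \<le> l \<and> distr_fun M g l \<le> ennreal t}"
      using low(1)[of n] by (auto simp: distr_fun_def not_le simp del: of_nat_Suc)
    then have "?l \<le> ?l * (1 - 1 / real (Suc (Suc n)))"
      by (subst (1) level_def) (intro cInf_lower bdd_belowI[of _ 0], auto)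
    then show False using low(2)[of n] by simp
  qed
  have dec: "decseq ?A"
  proof (intro decseq_SucI subsetI)
    fix n x assume x: "x \<in> ?A (Suc n)"
    have "1 / real (Suc (Suc (Suc n))) \<le> 1 / real (Suc (Suc n))" by (intro divide_left_mono) auto
    then have "?l * (1 - 1 / real (Suc (Suc n))) \<le> ?l * (1 - 1 / real (Suc (Suc (Suc n))))"
      using assms by (intro mult_left_mono) auto
    with x show "x \<in> ?A n" by (auto simp del: of_nat_Suc)
  qed
  have "{x \<in> space M. ?l \<le> \<bar>g x\<bar>} = (\<Inter>n. ?A n)"
  proof (intro equalityI subsetI)
    fix x assume "x \<in> {x \<in> space M. ?l \<le> \<bar>g x\<bar>}"
    then show "x \<in> (\<Inter>n. ?A n)" using low(2) by (auto simp del: of_nat_Suc intro: less_le_trans)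
  next
    fix x assume x: "x \<in> (\<Inter>n. ?A n)"
    have "(\<lambda>n. ?l * (1 - 1 / real (Suc (Suc n)))) \<longlonglongrightarrow> ?l * (1 - 0)"
      by (intro tendsto_intros) (rule LIMSEQ_Suc[OF LIMSEQ_Suc[OF lim_inverse_n'[unfolded inverse_eq_divide]]])
    then have "?l * (1 - 0) \<le> \<bar>g x\<bar>"
      by (rule LIMSEQ_le_const2) (use x in \<open>auto simp del: of_nat_Suc intro!: less_imp_le exI[of _ 0]\<close>)
    then show "x \<in> {x \<in> space M. ?l \<le> \<bar>g x\<bar>}" using x by auto
  qed
  then have "emeasure M {x \<in> space M. ?l \<le> \<bar>g x\<bar>} = emeasure M (\<Inter>n. ?A n)" by simp
  also have "\<dots> = (INF n. emeasure M (?A n))"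
    using dec fin by (intro INF_emeasure_decseq[symmetric]) (auto simp del: of_nat_Suc simp: less_top[symmetric])
  also have "\<dots> \<ge> ennreal t" by (intro INF_greatest ge)
  finally show "ennreal t \<le> emeasure M {x \<in> space M. ?l \<le> \<bar>g x\<bar>}" .
qed

lemma near_extremal_meas[measurable]:
  "(\<lambda>(t, x). near_extremal M g (max 0 t) x) \<in> borel_measurable (lborel \<Otimes>\<^sub>M M)"
  unfolding near_extremal_def measure_def by measurable

lemma near_extremal_meas'[measurable]:
  assumes "0 \<le> t" shows "near_extremal M g t \<in> borel_measurable M"
  unfolding near_extremal_def[abs_def] by measurable

text \<open>An atom may prevent any set from having measure \<open>t\<close>. Here
  \<open>{|g| > level}\<close> has measure at most \<open>t\<close>, and the constant
  \<open>t / m\<close> on \<open>{|g| \<ge> level}\<close> spreads mass at most \<open>t\<close>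
  evenly over the whole set. Hence the factor 2.\<close>

lemma nn_integral_near_extremal:
  assumes t: "0 \<le> t"
  shows "(\<integral>\<^sup>+x. ennreal (near_extremal M g t x) \<partial>M) \<le> 2 * ennreal t"
proof -
  let ?l = "level M g t"
  define m where "m = measure M {x \<in> space M. ?l \<le> \<bar>g x\<bar>}"
  have "(\<integral>\<^sup>+x. ennreal (near_extremal M g t x) \<partial>M)
    = (\<integral>\<^sup>+x. indicator {x\<in>space M. ?l < \<bar>g x\<bar>} x + ennreal (min 1 (t / m)) * indicator {x\<in>space M. ?l \<le> \<bar>g x\<bar>} x \<partial>M)"
    unfolding near_extremal_def m_def[symmetric] using t
    by (intro nn_integral_cong) (auto simp: indicator_def m_def)
  also have "\<dots> = distr_fun M g ?l + ennreal (min 1 (t / m)) * emeasure M {x\<in>space M. ?l \<le> \<bar>g x\<bar>}"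
    by (subst nn_integral_add) (auto simp: distr_fun_def nn_integral_cmult)
  also have "\<dots> \<le> ennreal t + ennreal t"
  proof (intro add_mono distr_fun_level t)
    show "ennreal (min 1 (t / m)) * emeasure M {x\<in>space M. ?l \<le> \<bar>g x\<bar>} \<le> ennreal t"
    \<comment> \<open>If the set is null or has infinite measure, then \<open>m = 0\<close>, the
      quotient is 0, and the term vanishes.\<close>
    proof (cases "m = 0")
      case False
      then have "emeasure M {x\<in>space M. ?l \<le> \<bar>g x\<bar>} = ennreal m" unfolding m_def
        by (intro emeasure_eq_ennreal_measure) (auto simp: measure_def)
      moreover have "min 1 (t / m) * m \<le> t" using False t
        by (auto simp: min_def m_def divide_simps split: if_splits)
      ultimately show ?thesis using t by (simp add: m_def ennreal_leI flip: ennreal_mult)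
    qed simp
  qed
  finally show ?thesis by (simp add: mult_2)
qed

text \<open>\<open>g\<close> is split at height \<open>level\<close>. The first summand of
  \<open>near_extremal\<close> pays for the excess over the level, the second for
  \<open>level * t\<close>: if \<open>level > 0\<close>, then \<open>t \<le> m\<close>, and
  \<open>t / m\<close> integrates to exactly \<open>t\<close> over
  \<open>{|g| \<ge> level}\<close>.\<close>

lemma kfun_le_near_extremal:
  assumes t: "0 \<le> t"
  shows "kfun M g (ennreal t) \<le> (\<integral>\<^sup>+x. ennreal (near_extremal M g t x) * ennreal \<bar>g x\<bar> \<partial>M)"
proof -
  let ?l = "level M g t"
  define m where "m = measure M {x \<in> space M. ?l \<le> \<bar>g x\<bar>}"
  have l: "0 \<le> ?l" by (rule level_nonneg[OF t])
  have "kfun M g (ennreal t) \<le> (\<integral>\<^sup>+x. ennreal (\<bar>g x\<bar> - ?l) \<partial>M) + ennreal ?l * ennreal t"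
    by (intro kfun_le_add l) auto
  also have "\<dots> \<le> (\<integral>\<^sup>+x. ennreal (\<bar>g x\<bar> - ?l) \<partial>M) + (\<integral>\<^sup>+x. ennreal (min 1 (t / m) * ?l) * indicator {x\<in>space M. ?l \<le> \<bar>g x\<bar>} x \<partial>M)"
  proof (cases "?l = 0")
    case False
    with l have l0: "0 < ?l" by simp
    have em: "emeasure M {x\<in>space M. ?l \<le> \<bar>g x\<bar>} = ennreal m" unfolding m_def
      using emeasure_level_ge(2)[OF t l0] by (intro emeasure_eq_ennreal_measure) auto
    then have "t \<le> m" using emeasure_level_ge(1)[OF t l0] by (simp add: m_def)
    then have "min 1 (t / m) * m = t" using t by (cases "m = 0") (auto simp: min_def divide_simps split: if_splits)
    then have "ennreal (min 1 (t / m) * ?l) * ennreal m = ennreal ?l * ennreal t"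
      using l t by (simp add: m_def mult_ac flip: ennreal_mult)
    then show ?thesis by (simp add: nn_integral_cmult em)
  qed simp
  also have "\<dots> = (\<integral>\<^sup>+x. ennreal (\<bar>g x\<bar> - ?l) + ennreal (min 1 (t / m) * ?l) * indicator {x\<in>space M. ?l \<le> \<bar>g x\<bar>} x \<partial>M)"
    by (intro nn_integral_add[symmetric]) auto
  also have "\<dots> \<le> (\<integral>\<^sup>+x. ennreal (near_extremal M g t x) * ennreal \<bar>g x\<bar> \<partial>M)"
  proof (rule nn_integral_mono)
    fix x assume x: "x \<in> space M"
    define a where "a = min 1 (t / m)"
    have a: "0 \<le> a" using t by (simp add: a_def m_def)
    show "ennreal (\<bar>g x\<bar> - ?l) + ennreal (min 1 (t / m) * ?l) * indicator {x\<in>space M. ?l \<le> \<bar>g x\<bar>} x \<le> ennreal (near_extremal M g t x) * ennreal \<bar>g x\<bar>"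
    proof (cases "?l \<le> \<bar>g x\<bar>")
      case True
      have n: "near_extremal M g t x = (if ?l < \<bar>g x\<bar> then 1 else 0) + a" using True by (simp add: near_extremal_def a_def m_def)
      have "(\<bar>g x\<bar> - ?l) + a * ?l \<le> near_extremal M g t x * \<bar>g x\<bar>"
        unfolding n using True a l mult_left_mono[OF True a] by (auto simp: distrib_right)
      then show ?thesis using True x l a unfolding a_def[symmetric]
        by (simp add: near_extremal_nonneg[OF t] ennreal_leI flip: ennreal_mult ennreal_plus)
    qed (simp add: ennreal_neg)
  qed
  finally show ?thesis .
qed

text \<open>\<open>f\<close> is the average of the near-extremal functions for \<open>g\<close> with
  weight \<open>w\<close>. Each has supremum at most 2 and \<open>L^1\<close> norm at most
  \<open>2 t\<close>: those with \<open>t > s\<close> together form a bounded function, those with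
  \<open>t \<le> s\<close> an integrable one, and their sizes add up to the integral of
  \<open>w t * min s t\<close>.\<close>

lemma exists_averaged_extremal:
  assumes w[measurable]: "w \<in> borel_measurable borel" and w0: "\<And>t. 0 \<le> w t" and wz: "\<And>t. t \<le> 0 \<Longrightarrow> w t = 0"
    and fin: "(\<integral>\<^sup>+t. ennreal (w t) \<partial>lborel) < \<infinity>"
  shows "\<exists>f\<in>borel_measurable M.
    (\<integral>\<^sup>+t. ennreal (w t) * kfun M g (ennreal t) \<partial>lborel) \<le> (\<integral>\<^sup>+x. ennreal \<bar>f x * g x\<bar> \<partial>M) \<and>
    (\<forall>s>0. kfun M f (ennreal s) \<le> 2 * (\<integral>\<^sup>+t. ennreal (w t * min s t) \<partial>lborel))"
proof -
  interpret P: pair_sigma_finite lborel M ..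
  define F where "F t x = near_extremal M g (max 0 t) x" for t x
  have [measurable]: "(\<lambda>(t, x). F t x) \<in> borel_measurable (lborel \<Otimes>\<^sub>M M)" unfolding F_def by measurable
  have [measurable]: "(\<lambda>(x, t). F t x) \<in> borel_measurable (M \<Otimes>\<^sub>M lborel)"
    using measurable_compose[OF measurable_pair_swap' \<open>(\<lambda>(t, x). F t x) \<in> _\<close>] by (simp add: split_def)
  have F0: "0 \<le> F t x" and F2: "F t x \<le> 2" for t x by (auto simp: F_def near_extremal_nonneg near_extremal_le)
  define f0 where "f0 x = (\<integral>\<^sup>+t. ennreal (w t * F t x) \<partial>lborel)" for x
  define f where "f x = enn2real (f0 x)" for x
  have [measurable]: "f0 \<in> borel_measurable M" unfolding f0_def[abs_def] by measurable
  have [measurable]: "f \<in> borel_measurable M" unfolding f_def[abs_def] by measurable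
  have "f0 x < \<infinity>" for x
  proof -
    have "f0 x \<le> (\<integral>\<^sup>+t. 2 * ennreal (w t) \<partial>lborel)"
      unfolding f0_def
    proof (rule nn_integral_mono)
      fix t
      have "w t * F t x \<le> 2 * w t" using mult_left_mono[OF F2[of t x] w0[of t]] by simp
      then have "ennreal (w t * F t x) \<le> ennreal (2 * w t)" by (rule ennreal_leI)
      then show "ennreal (w t * F t x) \<le> 2 * ennreal (w t)" by (simp add: ennreal_mult')
    qed
    also have "\<dots> < \<infinity>" using fin by (simp add: nn_integral_cmult ennreal_mult_less_top)
    finally show ?thesis .
  qed
  then have f: "ennreal (f x) = f0 x" for x by (simp add: f_def)
  have f_nonneg: "0 \<le> f x" for x by (simp add: f_def)
  show ?thesis
  proof (intro bexI[of _ f] conjI allI impI)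
    show "f \<in> borel_measurable M" by measurable
    have "(\<integral>\<^sup>+t. ennreal (w t) * kfun M g (ennreal t) \<partial>lborel) \<le> (\<integral>\<^sup>+t. (\<integral>\<^sup>+x. ennreal (w t * F t x) * ennreal \<bar>g x\<bar> \<partial>M) \<partial>lborel)"
    proof (rule nn_integral_mono)
      fix t
      show "ennreal (w t) * kfun M g (ennreal t) \<le> (\<integral>\<^sup>+x. ennreal (w t * F t x) * ennreal \<bar>g x\<bar> \<partial>M)"
      proof (cases "0 < t")
        case True
        have "ennreal (w t) * kfun M g (ennreal t) \<le> ennreal (w t) * (\<integral>\<^sup>+x. ennreal (F t x) * ennreal \<bar>g x\<bar> \<partial>M)"
          using True by (intro mult_left_mono) (auto simp: F_def kfun_le_near_extremal max_def)
        also have "\<dots> = (\<integral>\<^sup>+x. ennreal (w t) * (ennreal (F t x) * ennreal \<bar>g x\<bar>) \<partial>M)"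
          by (intro nn_integral_cmult[symmetric]) (simp add: F_def)
        also have "\<dots> = (\<integral>\<^sup>+x. ennreal (w t * F t x) * ennreal \<bar>g x\<bar> \<partial>M)"
          using w0 F0 by (simp add: ennreal_mult mult.assoc)
        finally show ?thesis .
      qed (simp add: wz)
    qed
    also have "\<dots> = (\<integral>\<^sup>+x. (\<integral>\<^sup>+t. ennreal (w t * F t x) * ennreal \<bar>g x\<bar> \<partial>lborel) \<partial>M)"
      by (rule P.Fubini'[symmetric]) measurable
    also have "\<dots> = (\<integral>\<^sup>+x. ennreal \<bar>f x * g x\<bar> \<partial>M)"
    proof (rule nn_integral_cong)
      fix x assume [measurable]: "x \<in> space M"
      have "(\<integral>\<^sup>+t. ennreal (w t * F t x) * ennreal \<bar>g x\<bar> \<partial>lborel) = f0 x * ennreal \<bar>g x\<bar>"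
        unfolding f0_def by (intro nn_integral_multc) measurable
      then show "(\<integral>\<^sup>+t. ennreal (w t * F t x) * ennreal \<bar>g x\<bar> \<partial>lborel) = ennreal \<bar>f x * g x\<bar>"
        using f[of x] f_nonneg[of x] by (simp add: abs_mult ennreal_mult)
    qed
    finally show "(\<integral>\<^sup>+t. ennreal (w t) * kfun M g (ennreal t) \<partial>lborel) \<le> (\<integral>\<^sup>+x. ennreal \<bar>f x * g x\<bar> \<partial>M)" .
  next
    fix s :: real assume s: "0 < s"
    \<comment> \<open>The height of the splitting is \<open>2 * c0\<close>, which bounds the part of
      the average over \<open>t > s\<close>.\<close>
    define c0 where "c0 = (\<integral>\<^sup>+t\<in>{s<..}. ennreal (w t) \<partial>lborel)"
    have "c0 \<le> (\<integral>\<^sup>+t. ennreal (w t) \<partial>lborel)" unfolding c0_def by (intro nn_integral_mono) (auto simp: indicator_def)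
    then have "c0 < top" using fin by (simp add: le_less_trans)
    then have c0: "ennreal (enn2real c0) = c0" by simp
    have "kfun M f (ennreal s) \<le> (\<integral>\<^sup>+x. ennreal (\<bar>f x\<bar> - 2 * enn2real c0) \<partial>M) + ennreal (2 * enn2real c0) * ennreal s"
      by (intro kfun_le_add) auto
    also have "(\<integral>\<^sup>+x. ennreal (\<bar>f x\<bar> - 2 * enn2real c0) \<partial>M) \<le> (\<integral>\<^sup>+x. (\<integral>\<^sup>+t\<in>{..s}. ennreal (w t * F t x) \<partial>lborel) \<partial>M)"
    proof (rule nn_integral_mono)
      fix x assume [measurable]: "x \<in> space M"
      have "ennreal (f x) = (\<integral>\<^sup>+t. ennreal (w t * F t x) * indicator {..s} t + ennreal (w t * F t x) * indicator {s<..} t \<partial>lborel)"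
        unfolding f f0_def by (intro nn_integral_cong) (auto simp: indicator_def)
      also have "\<dots> = (\<integral>\<^sup>+t\<in>{..s}. ennreal (w t * F t x) \<partial>lborel) + (\<integral>\<^sup>+t\<in>{s<..}. ennreal (w t * F t x) \<partial>lborel)"
        by (intro nn_integral_add) measurable
      also have "(\<integral>\<^sup>+t\<in>{s<..}. ennreal (w t * F t x) \<partial>lborel) \<le> (\<integral>\<^sup>+t. 2 * (ennreal (w t) * indicator {s<..} t) \<partial>lborel)"
      proof (rule nn_integral_mono)
        fix t
        have "w t * F t x \<le> 2 * w t" using mult_left_mono[OF F2[of t x] w0[of t]] by simp
        then have "ennreal (w t * F t x) \<le> ennreal (2 * w t)" by (rule ennreal_leI)
        then show "ennreal (w t * F t x) * indicator {s<..} t \<le> 2 * (ennreal (w t) * indicator {s<..} t)" by (simp add: ennreal_mult' indicator_def)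
      qed
      also have "\<dots> = 2 * c0" unfolding c0_def by (intro nn_integral_cmult) measurable
      also have "2 * c0 = ennreal (2 * enn2real c0)" using c0 by (simp add: ennreal_mult')
      finally have le: "ennreal (f x) \<le> (\<integral>\<^sup>+t\<in>{..s}. ennreal (w t * F t x) \<partial>lborel) + ennreal (2 * enn2real c0)"
        by (simp add: add_left_mono)
      have "ennreal (\<bar>f x\<bar> - 2 * enn2real c0) = ennreal (f x) - ennreal (2 * enn2real c0)"
        using f_nonneg[of x] by (simp add: ennreal_minus)
      also have "\<dots> \<le> (\<integral>\<^sup>+t\<in>{..s}. ennreal (w t * F t x) \<partial>lborel)"
        using le by (simp add: ennreal_minus_le_iff add.commute)
      finally show "ennreal (\<bar>f x\<bar> - 2 * enn2real c0) \<le> (\<integral>\<^sup>+t\<in>{..s}. ennreal (w t * F t x) \<partial>lborel)" .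
    qed
    also have "\<dots> = (\<integral>\<^sup>+t. (\<integral>\<^sup>+x. ennreal (w t * F t x) * indicator {..s} t \<partial>M) \<partial>lborel)"
      by (rule P.Fubini') measurable
    also have "\<dots> \<le> (\<integral>\<^sup>+t. 2 * (ennreal (w t * t) * indicator {..s} t) \<partial>lborel)"
    proof (rule nn_integral_mono)
      fix t
      show "(\<integral>\<^sup>+x. ennreal (w t * F t x) * indicator {..s} t \<partial>M) \<le> 2 * (ennreal (w t * t) * indicator {..s} t)"
      proof (cases "0 < t")
        case True
        have "(\<integral>\<^sup>+x. ennreal (w t * F t x) * indicator {..s} t \<partial>M) = ennreal (w t) * indicator {..s} t * (\<integral>\<^sup>+x. ennreal (F t x) \<partial>M)"
        proof -
          have "ennreal (w t * F t x) * indicator {..s} t = ennreal (w t) * indicator {..s} t * ennreal (F t x)" for x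
            using w0[of t] F0[of t x] by (simp add: ennreal_mult indicator_def)
          then show ?thesis by (simp add: nn_integral_cmult F_def)
        qed
        also have "\<dots> \<le> ennreal (w t) * indicator {..s} t * (2 * ennreal t)"
          using True nn_integral_near_extremal[of t] by (intro mult_left_mono) (auto simp: F_def max_def)
        finally show ?thesis using True w0 by (simp add: ennreal_mult mult_ac)
      qed (simp add: wz)
    qed
    also have "\<dots> = 2 * (\<integral>\<^sup>+t\<in>{..s}. ennreal (w t * t) \<partial>lborel)" by (intro nn_integral_cmult) measurable
    also have "ennreal (2 * enn2real c0) * ennreal s = 2 * (\<integral>\<^sup>+t\<in>{s<..}. ennreal (w t * s) \<partial>lborel)"
    proof -
      have "(\<integral>\<^sup>+t\<in>{s<..}. ennreal (w t * s) \<partial>lborel) = (\<integral>\<^sup>+t. ennreal (w t) * indicator {s<..} t * ennreal s \<partial>lborel)"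
        using w0 s by (intro nn_integral_cong) (simp add: ennreal_mult mult_ac)
      also have "\<dots> = c0 * ennreal s" unfolding c0_def by (intro nn_integral_multc) measurable
      finally show ?thesis using c0 by (simp add: ennreal_mult' mult.assoc)
    qed
    also have "2 * (\<integral>\<^sup>+t\<in>{..s}. ennreal (w t * t) \<partial>lborel) + 2 * (\<integral>\<^sup>+t\<in>{s<..}. ennreal (w t * s) \<partial>lborel)
       = 2 * (\<integral>\<^sup>+t. ennreal (w t * t) * indicator {..s} t + ennreal (w t * s) * indicator {s<..} t \<partial>lborel)"
      by (subst nn_integral_add) (auto simp: distrib_left)
    also have "(\<integral>\<^sup>+t. ennreal (w t * t) * indicator {..s} t + ennreal (w t * s) * indicator {s<..} t \<partial>lborel) = (\<integral>\<^sup>+t. ennreal (w t * min s t) \<partial>lborel)"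
      by (intro nn_integral_cong) (auto simp: indicator_def min_def)
    finally show "kfun M f (ennreal s) \<le> 2 * (\<integral>\<^sup>+t. ennreal (w t * min s t) \<partial>lborel)" by (simp add: add_right_mono)
  qed
qed

end

subsection \<open>The upper estimate\<close>

lemma (in sigma_finite_measure) kfun_meas[measurable]:
  assumes [measurable]: "f \<in> borel_measurable M"
  shows "(\<lambda>t. kfun M f (ennreal t)) \<in> borel_measurable borel"
  unfolding kfun_def by measurable

context truncated_fun
begin

definition "k t = enn2real (kfun M g (ennreal t))"

lemma k_meas[measurable]: "k \<in> borel_measurable borel"
  unfolding k_def[abs_def] by measurable

lemma k_nonneg: "0 \<le> k t" by (simp add: k_def)

text \<open>Finiteness: splitting at a height above all values leaves only the linear term.\<close>

lemma kfun_eq: "kfun M g (ennreal t) = ennreal (k t)"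
proof -
  have "(\<integral>\<^sup>+x. ennreal (\<bar>g x\<bar> - max B 0) \<partial>M) = (\<integral>\<^sup>+x. 0 \<partial>M)"
    using bounded by (intro nn_integral_cong) (force intro: ennreal_neg)
  then have "kfun M g (ennreal t) \<le> ennreal (max B 0) * ennreal t"
    using kfun_le_add[of g "max B 0" "ennreal t"] by simp
  also have "\<dots> < top" by (simp add: ennreal_mult_less_top)
  finally show ?thesis by (simp add: k_def)
qed

lemma k_mono: "s \<le> t \<Longrightarrow> k s \<le> k t"
  using kfun_mono[of "ennreal s" "ennreal t" M g] by (simp add: kfun_eq ennreal_leI k_nonneg)

lemma k_anti: assumes "0 < s" "s \<le> t" shows "k t / t \<le> k s / s"
proof -
  have "kfun M g (ennreal (t / s) * ennreal s) \<le> ennreal (t / s) * kfun M g (ennreal s)"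
    using assms by (intro kfun_cmult_le) (auto simp: divide_simps ennreal_ge_1)
  then have "ennreal (k t) \<le> ennreal (t / s * k s)"
    using assms by (simp add: kfun_eq k_nonneg flip: ennreal_mult)
  then have "k t \<le> t / s * k s" using assms k_nonneg by (subst (asm) ennreal_le_iff) auto
  then show ?thesis using assms by (simp add: field_simps)
qed

lemma distr_fun_finite: "0 < l \<Longrightarrow> distr_fun M g l < \<infinity>"
  unfolding distr_fun_def by (intro le_less_trans[OF emeasure_mono fin_supp]) auto

end

section \<open>Powers of extended nonnegative reals and the scaling argument\<close>

lemma ennpowr_mono: "0 < r \<Longrightarrow> x \<le> z \<Longrightarrow> ennpowr x r \<le> ennpowr z r"
  by (cases x; cases z) (auto simp: ennpowr_def top_unique intro!: ennreal_leI powr_mono2)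

lemma ennpowr_inverse: "0 < r \<Longrightarrow> ennpowr (ennpowr x r) (1 / r) = x" "0 < r \<Longrightarrow> ennpowr (ennpowr x (1 / r)) r = x"
  by (cases x; simp add: ennpowr_def powr_powr)+

text \<open>A monotone bijection with monotone inverse commutes with suprema, so no continuity
  argument is required.\<close>

lemma ennpowr_SUP_le:
  assumes "0 < r" shows "ennpowr (SUP n. X n) r \<le> (SUP n. ennpowr (X n) r)"
proof -
  have "X n \<le> ennpowr (SUP n. ennpowr (X n) r) (1 / r)" for n
  proof -
    have "ennpowr (X n) r \<le> (SUP n. ennpowr (X n) r)" by (rule SUP_upper) simp
    then have "ennpowr (ennpowr (X n) r) (1 / r) \<le> ennpowr (SUP n. ennpowr (X n) r) (1 / r)"
      using assms by (intro ennpowr_mono) auto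
    then show ?thesis using assms by (simp add: ennpowr_inverse)
  qed
  then have "ennpowr (SUP n. X n) r \<le> ennpowr (ennpowr (SUP n. ennpowr (X n) r) (1 / r)) r"
    using assms by (intro ennpowr_mono SUP_least) auto
  then show ?thesis using assms by (simp add: ennpowr_inverse)
qed

lemma ennpowr_meas[measurable (raw)]:
  assumes [measurable]: "f \<in> borel_measurable M" shows "(\<lambda>x. ennpowr (f x) r) \<in> borel_measurable M"
  unfolding ennpowr_def by measurable

lemma ennpowr_le_1_iff: assumes "0 < r" shows "ennpowr x r \<le> 1 \<longleftrightarrow> x \<le> 1"
  using ennpowr_mono[OF assms, of x 1] ennpowr_mono[of "1 / r" "ennpowr x r" 1] assms
  by (auto simp: ennpowr_inverse) (simp_all add: ennpowr_def)

lemma ennpowr_ennreal: "0 \<le> x \<Longrightarrow> ennpowr (ennreal x) r = ennreal (x powr r)"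
  by (simp add: ennpowr_def)

text \<open>The choice \<open>\<kappa> = Y^(-1/q)\<close> makes the bracket equal to 2 and turns an
  additive estimate into a norm estimate. For \<open>Y = 0\<close> large \<open>\<kappa>\<close>
  forces \<open>X = 0\<close>.\<close>

lemma ennreal_le_ennpowr_of_scaling:
  assumes q: "0 < q" and c: "0 < c" 
    and le: "\<And>\<kappa>::real. 0 < \<kappa> \<Longrightarrow> ennreal \<kappa> * X \<le> ennreal c * (1 + ennreal (\<kappa> powr q) * Y)"
  shows "X \<le> ennreal (2 * c) * ennpowr Y (1/q)"
proof (cases Y)
  case top
  then show ?thesis using c by (simp add: ennpowr_def ennreal_mult_top)
next
  case (real y)
  show ?thesis
  proof (cases "y = 0")
    case True
    have "X = 0"
    proof (rule ccontr)
      assume "X \<noteq> 0"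
      have le1: "ennreal \<kappa> * X \<le> ennreal c" if "0 < \<kappa>" for \<kappa> using le[OF that] True real by simp
      have "X \<noteq> top" using le1[of 1] by (auto simp: top_unique)
      then obtain x where x: "X = ennreal x" "0 < x" using \<open>X \<noteq> 0\<close>
        by (cases X) (auto simp: less_le)
      have "ennreal ((2 * c / x) * x) = ennreal (2 * c / x) * X" using x c by (subst ennreal_mult) auto
      also have "\<dots> \<le> ennreal c" using x c by (intro le1) auto
      finally have "ennreal ((2 * c / x) * x) \<le> ennreal c" .
      then have "(2 * c / x) * x \<le> c" using c by (subst (asm) ennreal_le_iff) auto
      then show False using x c by simp
    qed
    then show ?thesis by simp
  next
    case False
    then have y: "0 < y" using real by simp
    define \<kappa> where "\<kappa> = y powr (-(1/q))"
    have l: "0 < \<kappa>" using y by (simp add: \<kappa>_def)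
    have "\<kappa> powr q = 1 / y" unfolding \<kappa>_def powr_powr using y q by (simp add: powr_minus divide_simps)
    then have "\<kappa> powr q * y = 1" using y by simp
    then have "ennreal \<kappa> * X \<le> ennreal c * (1 + 1)" using le[OF l] real by (simp flip: ennreal_mult)
    also have "\<dots> = ennreal (2 * c)" using c by (simp add: ennreal_mult mult.commute)
    finally have "ennreal (1 / \<kappa>) * (ennreal \<kappa> * X) \<le> ennreal (1 / \<kappa>) * ennreal (2 * c)" by (rule mult_left_mono) simp
    moreover have "ennreal (1 / \<kappa>) * (ennreal \<kappa> * X) = X"
      using l by (simp add: mult.assoc[symmetric] ennreal_mult[symmetric])
    moreover have "1 / \<kappa> = y powr (1/q)" by (simp add: \<kappa>_def powr_minus divide_simps)
    ultimately show ?thesis using real by (simp add: ennpowr_ennreal mult.commute)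
  qed
qed

context rearr_weight
begin

definition "p' = p / (p - 1)"

lemma p': "1 < p'" "1/p + 1/p' = 1" "1/p' + 1/p = 1" "p / p' = p - 1" "(p - 1) * p' = p" "(p' - 1) * p = p'" "(p' - 1) * (p - 1) = 1"
  using p_gt by (auto simp: p'_def field_simps)

definition primal :: "'a measure \<Rightarrow> ('a \<Rightarrow> real) \<Rightarrow> ennreal" where
  "primal M f = (\<integral>\<^sup>+s. ennpowr (kfun M f (ennreal s) / ennreal s) p \<partial>N)"

text \<open>In the smoothing bound for \<open>K(f,s)\<close> put \<open>s = \<mu>_g(l)\<close> and
  integrate over \<open>l\<close>: \<open>min s t\<close> becomes \<open>K(g,t)\<close>, and the
  linear term becomes the \<open>L^1\<close> norm of \<open>g\<close>. What remains is the bilinear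
  form of the Schur test. The constant is \<open>4 p\<close> from the smoothing, \<open>2 p'\<close>
  from the Schur test and 2 from the scaling.\<close>

lemma upper_estimate:
  assumes "truncated_fun M f Bf" "truncated_fun M g Bg"
    and norm: "(\<integral>\<^sup>+s. ennreal ((truncated_fun.k M f s / s) powr p) \<partial>N) \<le> 1"
  shows "(\<integral>\<^sup>+x. ennreal \<bar>f x * g x\<bar> \<partial>M) \<le>
    ennreal (16 * p * p') * ennpowr (\<integral>\<^sup>+t. ennreal ((truncated_fun.k M g t / \<omega> t) powr p' * \<phi>' t) \<partial>lborel) (1 / p')
      + ennreal (2 * e) * (\<integral>\<^sup>+x. ennreal \<bar>g x\<bar> \<partial>M)"
proof -
  interpret f: truncated_fun M f Bf by fact
  interpret g: truncated_fun M g Bg by fact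
  interpret N: sigma_finite_measure N by (rule sigma_finite_N)
  define h where "h = (\<lambda>r. f.k r / r)"
  define J where "J = (\<lambda>t. avg h t * ennreal (\<phi>' t / \<omega> t))"
  have [measurable]: "h \<in> borel_measurable borel" unfolding h_def by measurable
  have [measurable]: "J \<in> borel_measurable borel" unfolding J_def by measurable
  have u0: "0 \<le> g.k t / \<omega> t" for t by (intro divide_nonneg_nonneg g.k_nonneg omega_nonneg)
  let ?m = "\<lambda>t l. min (ennreal t) (distr_fun M g l) * indicator {0<..} l"
  let ?H = "\<lambda>t r. ennreal (K (p-1) t r * h r * (g.k t / \<omega> t) * \<phi>' t)"
  define X where "X = (\<integral>\<^sup>+t. \<integral>\<^sup>+r. ?H t r \<partial>N \<partial>lborel)"
  have "(\<integral>\<^sup>+x. ennreal \<bar>f x * g x\<bar> \<partial>M) \<le> (\<integral>\<^sup>+l\<in>{0<..}. kfun M f (distr_fun M g l) \<partial>lborel)"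
    by (intro f.nn_integral_mult_le_kfun) auto
  also have "\<dots> \<le> (\<integral>\<^sup>+l. ennreal (4 * p) * (\<integral>\<^sup>+t. J t * ?m t l \<partial>lborel)
      + ennreal (2 * e) * (distr_fun M g l * indicator {0<..} l) \<partial>lborel)"
  proof (rule nn_integral_mono)
    fix l :: real
    show "kfun M f (distr_fun M g l) * indicator {0<..} l \<le> ennreal (4 * p) * (\<integral>\<^sup>+t. J t * ?m t l \<partial>lborel)
      + ennreal (2 * e) * (distr_fun M g l * indicator {0<..} l)"
    proof (cases "0 < l")
      case True
      obtain s where s: "distr_fun M g l = ennreal s" "0 \<le> s"
        using g.distr_fun_finite[OF True] by (cases "distr_fun M g l") auto
      show ?thesis
      proof (cases "s = 0")
        case False
        with s have "0 < s" by simp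
        have "ennreal (f.k s) \<le> ennreal (4 * p) * (\<integral>\<^sup>+t. avg h t * ennreal (min s t / \<omega> t * \<phi>' t) \<partial>lborel) + ennreal (2 * e * s)"
          unfolding h_def by (intro quasiconcave_le_smoothing f.k_nonneg f.k_mono f.k_anti norm \<open>0 < s\<close>) auto
        also have "(\<integral>\<^sup>+t. avg h t * ennreal (min s t / \<omega> t * \<phi>' t) \<partial>lborel) = (\<integral>\<^sup>+t. J t * min (ennreal t) (ennreal s) \<partial>lborel)"
        proof (rule nn_integral_cong)
          fix t
          show "avg h t * ennreal (min s t / \<omega> t * \<phi>' t) = J t * min (ennreal t) (ennreal s)"
          proof (cases "0 < t")
            case True
            have "min (ennreal t) (ennreal s) = ennreal (min s t)" using True s(2) by (auto simp: min_def ennreal_le_iff)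
            moreover have "ennreal (min s t / \<omega> t * \<phi>' t) = ennreal (\<phi>' t / \<omega> t) * ennreal (min s t)"
              using True s(2) omega_nonneg[of t] phi'_nonneg[of t] by (simp add: mult_ac flip: ennreal_mult)
            ultimately show ?thesis by (simp add: J_def mult.assoc)
          qed (simp add: phi'_nonpos J_def)
        qed
        finally show ?thesis using True s e_nonneg by (simp add: f.kfun_eq ennreal_mult)
      qed (use s in \<open>simp add: kfun_def\<close>)
    qed simp
  qed
  also have "\<dots> = ennreal (4 * p) * (\<integral>\<^sup>+l. (\<integral>\<^sup>+t. J t * ?m t l \<partial>lborel) \<partial>lborel)
      + ennreal (2 * e) * (\<integral>\<^sup>+l\<in>{0<..}. distr_fun M g l \<partial>lborel)"
    by (subst nn_integral_add) (auto simp: nn_integral_cmult)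
  also have "(\<integral>\<^sup>+l\<in>{0<..}. distr_fun M g l \<partial>lborel) = (\<integral>\<^sup>+x. ennreal \<bar>g x\<bar> \<partial>M)"
    using f.nn_integral_distr_fun[of g 0] by simp
  also have "(\<integral>\<^sup>+l. (\<integral>\<^sup>+t. J t * ?m t l \<partial>lborel) \<partial>lborel)
     = (\<integral>\<^sup>+t. (\<integral>\<^sup>+l. J t * ?m t l \<partial>lborel) \<partial>lborel)"
    by (rule lborel_pair.Fubini') measurable
  also have "\<dots> = (\<integral>\<^sup>+t. J t * ennreal (g.k t) \<partial>lborel)"
    unfolding g.kfun_eq[symmetric] kfun_def by (intro nn_integral_cong nn_integral_cmult) measurable
  also have "\<dots> = X"
    unfolding X_def
  proof (rule nn_integral_cong)
    fix t
    have "J t * ennreal (g.k t) = avg h t * ennreal (g.k t / \<omega> t * \<phi>' t)"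
    proof -
      have "ennreal (\<phi>' t / \<omega> t) * ennreal (g.k t) = ennreal (g.k t / \<omega> t * \<phi>' t)"
        using g.k_nonneg[of t] omega_nonneg[of t] phi'_nonneg[of t] by (simp add: mult_ac flip: ennreal_mult)
      then show ?thesis by (simp add: J_def mult.assoc)
    qed
    also have "\<dots> = (\<integral>\<^sup>+r. ennreal (K (p-1) t r * h r) * ennreal (g.k t / \<omega> t * \<phi>' t) \<partial>N)"
      unfolding avg_def by (intro nn_integral_multc[symmetric]) measurable
    also have "\<dots> = (\<integral>\<^sup>+r. ?H t r \<partial>N)"
    proof (rule nn_integral_cong)
      fix r
      have "ennreal (K (p-1) t r * h r) * ennreal (g.k t / \<omega> t * \<phi>' t) = ennreal (K (p-1) t r * h r * (g.k t / \<omega> t * \<phi>' t))"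
        by (rule ennreal_mult''[symmetric]) (intro mult_nonneg_nonneg u0 phi'_nonneg)
      then show "ennreal (K (p-1) t r * h r) * ennreal (g.k t / \<omega> t * \<phi>' t) = ?H t r"
        by (simp only: mult.assoc)
    qed
    finally show "J t * ennreal (g.k t) = (\<integral>\<^sup>+r. ?H t r \<partial>N)" .
  qed
  finally have 1: "(\<integral>\<^sup>+x. ennreal \<bar>f x * g x\<bar> \<partial>M) \<le> ennreal (4 * p) * X + ennreal (2 * e) * (\<integral>\<^sup>+x. ennreal \<bar>g x\<bar> \<partial>M)" .

  \<comment> \<open>\<open>schur_bilinear\<close> asks for a nonnegative function on the whole line,
    whereas \<open>N\<close> sees only \<open>r > 0\<close>.\<close>
  define hp where "hp = (\<lambda>r. max 0 (h r))"
  have hp: "h r = hp r" if "0 < r" for r unfolding hp_def h_def using that f.k_nonneg[of r] by simp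
  define Y where "Y = (\<integral>\<^sup>+t. ennreal ((g.k t / \<omega> t) powr p' * \<phi>' t) \<partial>lborel)"
  have "X \<le> ennreal (2 * (2 * p')) * ennpowr Y (1 / p')"
  proof (rule ennreal_le_ennpowr_of_scaling)
    fix \<kappa> :: real assume l: "0 < \<kappa>"
    have "ennreal \<kappa> * X = (\<integral>\<^sup>+t. \<integral>\<^sup>+r. ennreal \<kappa> * ?H t r \<partial>N \<partial>lborel)"
      unfolding X_def by (simp add: nn_integral_cmult)
    also have "\<dots> = (\<integral>\<^sup>+t. \<integral>\<^sup>+r. ennreal (K (p/p') t r * hp r * (\<kappa> * (g.k t / \<omega> t)) * \<phi>' t) \<partial>N \<partial>lborel)"
    proof (rule nn_integral_cong, rule nn_integral_N_cong)
      fix t r :: real assume "0 < r"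
      then show "ennreal \<kappa> * ?H t r = ennreal (K (p/p') t r * hp r * (\<kappa> * (g.k t / \<omega> t)) * \<phi>' t)"
        using l by (simp add: hp p' ennreal_mult'[symmetric] mult_ac)
    qed
    also have "\<dots> \<le> ennreal (2 * p') * ((\<integral>\<^sup>+r. ennreal (hp r powr p) \<partial>N) + (\<integral>\<^sup>+t. ennreal ((\<kappa> * (g.k t / \<omega> t)) powr p' * \<phi>' t) \<partial>lborel))"
    proof (rule schur_bilinear)
      show "0 \<le> \<kappa> * (g.k t / \<omega> t)" for t using l by (intro mult_nonneg_nonneg u0) auto
    qed (use p' p_gt in \<open>auto simp: hp_def\<close>)
    also have "(\<integral>\<^sup>+r. ennreal (hp r powr p) \<partial>N) = (\<integral>\<^sup>+r. ennreal ((f.k r / r) powr p) \<partial>N)"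
      by (rule nn_integral_N_cong) (simp add: hp[symmetric] h_def)
    also have "(\<integral>\<^sup>+t. ennreal ((\<kappa> * (g.k t / \<omega> t)) powr p' * \<phi>' t) \<partial>lborel) = (\<integral>\<^sup>+t. ennreal (\<kappa> powr p') * ennreal ((g.k t / \<omega> t) powr p' * \<phi>' t) \<partial>lborel)"
      using l u0 by (intro nn_integral_cong) (simp add: powr_mult ennreal_mult'[symmetric] mult.assoc del: times_divide_eq_right)
    also have "\<dots> = ennreal (\<kappa> powr p') * Y" unfolding Y_def by (intro nn_integral_cmult) measurable
    finally show "ennreal \<kappa> * X \<le> ennreal (2 * p') * (1 + ennreal (\<kappa> powr p') * Y)"
      using norm by (meson add_right_mono mult_left_mono order_trans zero_le)
  qed (use p' in auto)
  then have "ennreal (4 * p) * X \<le> ennreal (4 * p) * (ennreal (2 * (2 * p')) * ennpowr Y (1 / p'))"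
    by (rule mult_left_mono) simp
  also have "\<dots> = ennreal (16 * p * p') * ennpowr Y (1 / p')"
    using p_gt p'(1) by (simp add: mult.assoc[symmetric] ennreal_mult[symmetric])
  finally show ?thesis using 1 unfolding Y_def by (meson add_right_mono order_trans)
qed

subsection \<open>The lower estimate\<close>

text \<open>With \<open>q = K(g,t) / \<omega>\<close> and \<open>u = q^(p'-1)\<close>, the weight
  \<open>v = u \<phi>' / \<omega>\<close> satisfies \<open>v K(g,t) = q^p' \<phi>'\<close>, the
  integrand of \<open>Y\<close>. The averaged function for \<open>c * v\<close> has
  \<open>f**\<close> at most \<open>2 * c * z\<close>, so the task is to bound \<open>X\<close>, the
  integral of \<open>z^p\<close>, by a multiple of \<open>Y\<close>.\<close>

lemma lower_estimate:
  assumes "truncated_fun M g B" and n: "1 < n"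
  defines "Y \<equiv> (\<integral>\<^sup>+t\<in>{1/n<..<n}. ennreal ((truncated_fun.k M g t / \<omega> t) powr p' * \<phi>' t) \<partial>lborel)"
  shows "\<exists>f\<in>borel_measurable M. primal M f \<le> 1 \<and>
    ennpowr Y (1 / p') \<le> ennreal (8 * p) * (\<integral>\<^sup>+x. ennreal \<bar>f x * g x\<bar> \<partial>M)"
proof -
  interpret g: truncated_fun M g B by fact
  interpret N: sigma_finite_measure N by (rule sigma_finite_N)
  interpret P: pair_sigma_finite N lborel ..
  have n0: "0 < n" "0 < 1/n" "1/n < n" using n by (auto simp: divide_simps intro: less_trans[of _ 1] simp: less_1_mult)
  \<comment> \<open>On this interval \<open>q\<close> and \<open>\<phi>'\<close> are bounded, which
    makes \<open>Y\<close> and the integral of \<open>v\<close> finite.\<close>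
  define A where "A = {1/n<..<n}"
  have Apos: "0 < t" if "t \<in> A" for t using that less_trans[OF n0(2), of t] unfolding A_def by (simp only: greaterThanLessThan_iff)
  have [measurable]: "A \<in> sets borel" by (simp add: A_def)
  define q where "q t = g.k t / \<omega> t" for t
  define b where "b = g.k n / \<omega> (1/n)"
  have [measurable]: "q \<in> borel_measurable borel" unfolding q_def[abs_def] by measurable
  have q0: "0 \<le> q t" for t unfolding q_def by (intro divide_nonneg_nonneg g.k_nonneg omega_nonneg)
  have qb: "q t \<le> b" if "t \<in> A" for t
    unfolding q_def b_def using that n0 by (intro frac_le g.k_mono omega_mono omega_pos g.k_nonneg) (auto simp: A_def)
  have b0: "0 \<le> b" unfolding b_def by (intro divide_nonneg_nonneg g.k_nonneg omega_nonneg)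
  have phib: "\<phi>' t \<le> V n * n" if "t \<in> A" for t
  proof -
    have t: "0 < t" "1/n < t" "t < n" using that Apos by (auto simp: A_def)
    have "\<phi>' t \<le> V t / t" by (rule phi'_le_V) fact
    also have "\<dots> \<le> V n / (1/n)" using t n0 by (intro frac_le V_mono V_nonneg) auto
    finally show ?thesis by simp
  qed
  have fin_on_A: "(\<integral>\<^sup>+t\<in>A. ennreal (F t) \<partial>lborel) < \<infinity>" if "\<And>t. t \<in> A \<Longrightarrow> F t \<le> C" for F and C :: real
  proof -
    have "(\<integral>\<^sup>+t\<in>A. ennreal (F t) \<partial>lborel) \<le> (\<integral>\<^sup>+t\<in>A. ennreal C \<partial>lborel)"
      using that by (intro nn_integral_mono) (auto simp: indicator_def intro: ennreal_leI)
    also have "\<dots> = ennreal C * emeasure lborel A" by (simp add: nn_integral_cmult)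
    also have "\<dots> < \<infinity>" using n0 by (simp add: A_def ennreal_mult_less_top)
    finally show ?thesis .
  qed
  have "Y < \<infinity>"
    unfolding Y_def A_def[symmetric] q_def[symmetric]
  proof (rule fin_on_A)
    fix t assume "t \<in> A"
    then show "q t powr p' * \<phi>' t \<le> b powr p' * (V n * n)"
      using p'(1) q0 qb phib phi'_nonneg by (intro mult_mono powr_mono2) auto
  qed
  define yn where "yn = enn2real Y"
  have Y: "Y = ennreal yn" "0 \<le> yn" using \<open>Y < \<infinity>\<close> by (auto simp: yn_def)
  show ?thesis
  proof (cases "yn = 0")
    case True
    have "kfun M (\<lambda>_. 0) t = (\<integral>\<^sup>+l. 0 \<partial>(lborel :: real measure))" for t :: ennreal
      unfolding kfun_def distr_fun_def by (intro nn_integral_cong) (auto simp: indicator_def)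
    then show ?thesis
      by (intro bexI[of _ "\<lambda>_. 0"]) (use True Y p_gt in \<open>auto simp: ennpowr_def primal_def\<close>)
  next
    case False
    then have yn: "0 < yn" using Y by simp
    define u where "u t = q t powr (p' - 1) * indicator A t" for t
    define v where "v t = u t * \<phi>' t / \<omega> t" for t
    have [measurable]: "u \<in> borel_measurable borel" "v \<in> borel_measurable borel" unfolding u_def[abs_def] v_def[abs_def] by measurable
    have u0: "0 \<le> u t" for t by (simp add: u_def)
    have v0: "0 \<le> v t" for t unfolding v_def by (intro divide_nonneg_nonneg mult_nonneg_nonneg u0 phi'_nonneg omega_nonneg)
    have vA: "v t = 0" if "t \<notin> A" for t using that by (simp add: v_def u_def)
    have "(\<integral>\<^sup>+t\<in>A. ennreal (v t) \<partial>lborel) < \<infinity>"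
    proof (rule fin_on_A)
      fix t assume "t \<in> A"
      then show "v t \<le> b powr (p' - 1) * (V n * n) / \<omega> (1/n)"
        unfolding v_def using p'(1) q0 qb phib phi'_nonneg n0 V_nonneg b0
        by (intro frac_le mult_mono mult_nonneg_nonneg omega_pos omega_mono) (auto simp: u_def A_def intro!: powr_mono2 mult_nonneg_nonneg)
    qed
    moreover have "(\<integral>\<^sup>+t\<in>A. ennreal (v t) \<partial>lborel) = (\<integral>\<^sup>+t. ennreal (v t) \<partial>lborel)"
      by (intro nn_integral_cong) (auto simp: indicator_def vA)
    ultimately have finv: "(\<integral>\<^sup>+t. ennreal (v t) \<partial>lborel) < \<infinity>" by simp
    define c1 where "c1 = enn2real (\<integral>\<^sup>+t. ennreal (v t) \<partial>lborel)"
    have c1: "(\<integral>\<^sup>+t. ennreal (v t) \<partial>lborel) = ennreal c1" "0 \<le> c1" using finv by (auto simp: c1_def)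
    define Z where "Z s = (\<integral>\<^sup>+t. ennreal (v t * min s t) \<partial>lborel)" for s
    have Zb: "Z s \<le> ennreal (a * c1)" if "0 \<le> a" "\<And>t. t \<in> A \<Longrightarrow> min s t \<le> a" for s a
    proof -
      have "Z s \<le> (\<integral>\<^sup>+t. ennreal a * ennreal (v t) \<partial>lborel)"
        unfolding Z_def
      proof (rule nn_integral_mono)
        fix t
        have "v t * min s t \<le> a * v t"
          using that v0[of t] vA[of t] mult_left_mono[of "min s t" a "v t"] by (cases "t \<in> A") (auto simp: mult.commute)
        then show "ennreal (v t * min s t) \<le> ennreal a * ennreal (v t)" using that v0 by (simp add: ennreal_leI flip: ennreal_mult)
      qed
      also have "\<dots> = ennreal (a * c1)" using that c1 by (simp add: nn_integral_cmult ennreal_mult)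
      finally show ?thesis .
    qed
    define z where "z s = enn2real (Z s) / s" for s
    have Zn: "Z s \<le> ennreal (n * c1)" for s using n0 by (intro Zb) (auto simp: A_def)
    have Z: "Z s = ennreal (s * z s)" if "0 < s" for s
    proof -
      have "Z s < \<infinity>" using Zn[of s] by (auto intro: le_less_trans)
      then show ?thesis using that by (simp add: z_def)
    qed
    have z0: "0 \<le> z s" if "0 < s" for s using that by (simp add: z_def)
    have zb1: "z s \<le> c1" if "0 < s" for s
    proof -
      have "ennreal (s * z s) \<le> ennreal (s * c1)" unfolding Z[OF that, symmetric] using that by (intro Zb) auto
      then have "s * z s \<le> s * c1" using that c1 by (subst (asm) ennreal_le_iff) auto
      then show ?thesis using that by simp
    qed
    have zb2: "z s \<le> n * c1 / s" if "0 < s" for s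
    proof -
      have "ennreal (s * z s) \<le> ennreal (n * c1)" unfolding Z[OF that, symmetric] by (rule Zn)
      then have "s * z s \<le> n * c1" using n0 c1 by (subst (asm) ennreal_le_iff) auto
      then show ?thesis using that by (simp add: field_simps)
    qed
    have [measurable]: "Z \<in> borel_measurable borel" unfolding Z_def[abs_def] by measurable
    have [measurable]: "z \<in> borel_measurable borel" unfolding z_def[abs_def] by measurable
    define X where "X = (\<integral>\<^sup>+s. ennreal (z s powr p) \<partial>N)"
    \<comment> \<open>Finiteness of \<open>X\<close>, required for the absorption: \<open>z\<close>
      is bounded by \<open>c1\<close>, integrable against \<open>N\<close> up to 1, and by
      \<open>n * c1 / s\<close>, whose \<open>p\<close>-th power is integrable beyond 1 by
      \<open>fin_right\<close>.\<close>
    have "X \<le> (\<integral>\<^sup>+s. ennreal (c1 powr p) * indicator {..1} s + ennreal ((n * c1) powr p) * (ennreal (s powr (-p)) * indicator {1<..} s) \<partial>N)"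
      unfolding X_def
    proof (rule nn_integral_N_mono)
      fix s :: real assume s: "0 < s"
      show "ennreal (z s powr p) \<le> ennreal (c1 powr p) * indicator {..1} s + ennreal ((n * c1) powr p) * (ennreal (s powr (-p)) * indicator {1<..} s)"
      proof (cases "s \<le> 1")
        case True
        then show ?thesis using zb1[OF s] z0[OF s] p_gt by (auto intro!: ennreal_leI powr_mono2)
      next
        case False
        have "z s powr p \<le> (n * c1 / s) powr p" using zb2[OF s] z0[OF s] p_gt by (intro powr_mono2) auto
        also have "\<dots> = (n * c1) powr p * s powr (-p)" using n0 c1 s by (simp add: powr_divide powr_minus divide_simps)
        finally show ?thesis using False by (simp add: ennreal_leI flip: ennreal_mult)
      qed
    qed
    also have "\<dots> = ennreal (c1 powr p) * emeasure N {..1} + ennreal ((n * c1) powr p) * emeasure N' {1<..}"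
      by (subst nn_integral_add) (auto simp: nn_integral_cmult nn_integral_N_N')
    also have "\<dots> < \<infinity>" by (simp add: emeasure_N_atMost emeasure_N'_greater ennreal_mult_less_top)
    finally have "X < \<infinity>" .
    define x where "x = enn2real X"
    have X: "X = ennreal x" "0 \<le> x" using \<open>X < \<infinity>\<close> by (auto simp: x_def)
    \<comment> \<open>Chosen so that \<open>2 * p * \<kappa> powr p' = \<kappa> / 2\<close>: the
      \<open>X\<close> that reappears on the right is then absorbed by half of the left
      side.\<close>
    define \<kappa> where "\<kappa> = (4 * p) powr (-(p - 1))"
    have k: "0 < \<kappa>" using p_gt by (simp add: \<kappa>_def)
    let ?H = "\<lambda>t s. ennreal (K (p/p) t s * (\<kappa> * z s powr (p-1)) * u t * \<phi>' t)" and ?c = "\<lambda>s. \<kappa> * z s powr (p-1)" and ?u = "\<lambda>t s. K (p/p) t s * u t * \<phi>' t"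
    \<comment> \<open>\<open>z s\<close> is itself the integral of
      \<open>K 1 t s * u t * \<phi>' t\<close> over \<open>t\<close>, so
      \<open>z^p = z^(p-1) z\<close> gives a bilinear form. The Schur test is used with
      \<open>p\<close> and \<open>p'\<close> exchanged; the \<open>p'\<close>-th power of
      \<open>z^(p-1)\<close> is again \<open>z^p\<close>.\<close>
    have "ennreal \<kappa> * X = (\<integral>\<^sup>+s. ennreal (?c s) * ennreal (z s) \<partial>N)"
      unfolding X_def
    proof (subst nn_integral_cmult[symmetric], measurable, rule nn_integral_N_cong)
      fix s :: real assume s: "0 < s"
      have "z s powr p = z s powr (p-1) * z s" using z0[OF s] p_gt by (cases "z s = 0") (auto simp: powr_diff)
      then show "ennreal \<kappa> * ennreal (z s powr p) = ennreal (?c s) * ennreal (z s)"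
        using k z0[OF s] by (simp add: mult.assoc flip: ennreal_mult)
    qed
    also have "\<dots> = (\<integral>\<^sup>+s. (\<integral>\<^sup>+t. ?H t s \<partial>lborel) \<partial>N)"
    proof (rule nn_integral_N_cong)
      fix s :: real assume s: "0 < s"
      have "ennreal (z s) = ennreal (1 / s) * Z s" using s z0[OF s] by (simp add: Z flip: ennreal_mult)
      also have "\<dots> = (\<integral>\<^sup>+t. ennreal (1 / s) * ennreal (v t * min s t) \<partial>lborel)" unfolding Z_def by (intro nn_integral_cmult[symmetric]) measurable
      also have "\<dots> = (\<integral>\<^sup>+t. ennreal (?u t s) \<partial>lborel)"
      proof (rule nn_integral_cong)
        fix t
        show "ennreal (1 / s) * ennreal (v t * min s t) = ennreal (?u t s)"
        proof (cases "t \<in> A")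
          case True
          then have "0 < t" by (rule Apos)
          then have "K (p/p) t s = min s t / s / \<omega> t" using s p_gt by (auto simp: K_def min_def divide_simps)
          then have "1 / s * (v t * min s t) = ?u t s" by (simp add: v_def mult_ac)
          then show ?thesis using s v0[of t] \<open>0 < t\<close> by (simp only: ennreal_mult[symmetric] divide_nonneg_nonneg zero_le_one less_imp_le min.boundedI mult_nonneg_nonneg)
        qed (simp add: vA, simp add: u_def)
      qed
      finally have "ennreal (?c s) * ennreal (z s) = (\<integral>\<^sup>+t. ennreal (?c s) * ennreal (?u t s) \<partial>lborel)"
        by (simp add: nn_integral_cmult)
      also have "\<dots> = (\<integral>\<^sup>+t. ?H t s \<partial>lborel)"
      proof (rule nn_integral_cong)
        fix t
        have "0 \<le> \<kappa> * z s powr (p-1)" using k by simp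
        then have "ennreal (?c s) * ennreal (?u t s) = ennreal (\<kappa> * z s powr (p-1) * ?u t s)"
          by (rule ennreal_mult'[symmetric])
        also have "\<kappa> * z s powr (p-1) * ?u t s = K (p/p) t s * (\<kappa> * z s powr (p-1)) * u t * \<phi>' t" by (simp only: mult_ac)
        finally show "ennreal (?c s) * ennreal (?u t s) = ?H t s" .
      qed
      finally show "ennreal (?c s) * ennreal (z s) = (\<integral>\<^sup>+t. ?H t s \<partial>lborel)" .
    qed
    also have "\<dots> = (\<integral>\<^sup>+t. (\<integral>\<^sup>+s. ?H t s \<partial>N) \<partial>lborel)"
      by (rule P.Fubini'[symmetric]) measurable
    also have "\<dots> \<le> ennreal (2 * p) * ((\<integral>\<^sup>+s. ennreal ((\<kappa> * z s powr (p-1)) powr p') \<partial>N) + (\<integral>\<^sup>+t. ennreal (u t powr p * \<phi>' t) \<partial>lborel))"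
      by (rule schur_bilinear) (use p' p_gt k u0 in auto)
    also have "(\<integral>\<^sup>+s. ennreal ((\<kappa> * z s powr (p-1)) powr p') \<partial>N) = (\<integral>\<^sup>+s. ennreal (\<kappa> powr p') * ennreal (z s powr p) \<partial>N)"
      using k by (intro nn_integral_cong) (simp add: powr_mult powr_powr p' flip: ennreal_mult)
    also have "\<dots> = ennreal (\<kappa> powr p') * X" unfolding X_def by (intro nn_integral_cmult) measurable
    also have "(\<integral>\<^sup>+t. ennreal (u t powr p * \<phi>' t) \<partial>lborel) = Y"
      unfolding Y_def A_def[symmetric] q_def[symmetric]
      by (intro nn_integral_cong) (auto simp: u_def indicator_def powr_powr p')
    finally have "ennreal \<kappa> * ennreal x \<le> ennreal (2 * p) * (ennreal (\<kappa> powr p') * ennreal x + ennreal yn)" by (simp only: X Y)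
    also have "\<dots> = ennreal (2 * p * (\<kappa> powr p' * x + yn))" using X Y p_gt by (simp flip: ennreal_mult ennreal_plus)
    finally have "\<kappa> * x \<le> 2 * p * (\<kappa> powr p' * x + yn)"
      using X Y p_gt k by (simp add: ennreal_mult[symmetric] ennreal_le_iff del: ennreal_plus)
    moreover have "\<kappa> powr p' = \<kappa> / (4 * p)"
    proof -
      have "\<kappa> powr p' = \<kappa> powr (p' - 1) * \<kappa>" using k by (simp add: powr_diff)
      also have "\<kappa> powr (p' - 1) = (4 * p) powr (-((p' - 1) * (p - 1)))" 
      proof -
        have "-(p - 1) * (p' - 1) = -((p' - 1) * (p - 1))" by (simp add: algebra_simps)
        then show ?thesis by (simp only: \<kappa>_def powr_powr)
      qed
      also have "\<dots> = 1 / (4 * p)" using p_gt by (simp only: p') (simp add: powr_minus divide_simps)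
      finally show ?thesis by simp
    qed
    ultimately have xy: "\<kappa> * x \<le> 4 * p * yn" using p_gt by (simp add: field_simps)
    have kC: "4 * p / \<kappa> = (4 * p) powr p"
      unfolding \<kappa>_def using p_gt by (simp add: powr_minus powr_diff)
    have xy': "x \<le> (4 * p) powr p * yn" unfolding kC[symmetric] using xy k by (simp add: field_simps)
    \<comment> \<open>The normalization: together with \<open>x \<le> (4 * p) powr p * yn\<close> it
      gives \<open>(2 * c) powr p * x \<le> 1\<close>, while \<open>8 * p * c * yn\<close> is
      exactly \<open>yn powr (1/p')\<close>.\<close>
    define c where "c = yn powr (-(1/p)) / (8 * p)"
    have c: "0 < c" using yn p_gt by (simp add: c_def)
    have "c powr p = yn powr (-1) / (8 * p) powr p" using yn p_gt by (simp add: c_def powr_divide powr_powr)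
    then have "(2 * c) powr p * (4 * p) powr p * yn = 1"
    proof -
      have "(2 * c) powr p * (4 * p) powr p = (8 * p) powr p * c powr p"
        using p_gt c by (simp add: powr_mult[symmetric] mult_ac)
      also have "\<dots> = yn powr (-1)" using \<open>c powr p = _\<close> p_gt by simp
      finally show ?thesis using yn by (simp add: powr_minus)
    qed
    then have norm: "(2 * c) powr p * x \<le> 1" using mult_left_mono[OF xy', of "(2*c) powr p"] by (simp add: mult_ac)
    define w where "w t = c * v t" for t
    have w: "w \<in> borel_measurable borel" "\<And>t. 0 \<le> w t" "\<And>t. t \<le> 0 \<Longrightarrow> w t = 0"
      unfolding w_def[abs_def] using c v0 vA Apos by (auto simp: zero_le_mult_iff) (meson not_le)
    have "(\<integral>\<^sup>+t. ennreal (w t) \<partial>lborel) = ennreal c * (\<integral>\<^sup>+t. ennreal (v t) \<partial>lborel)"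
      unfolding w_def using c v0 by (simp add: ennreal_mult nn_integral_cmult)
    then have wfin: "(\<integral>\<^sup>+t. ennreal (w t) \<partial>lborel) < \<infinity>" using finv by (simp add: ennreal_mult_less_top)
    obtain f where f: "f \<in> borel_measurable M"
      "(\<integral>\<^sup>+t. ennreal (w t) * kfun M g (ennreal t) \<partial>lborel) \<le> (\<integral>\<^sup>+x. ennreal \<bar>f x * g x\<bar> \<partial>M)"
      "\<And>s. 0 < s \<Longrightarrow> kfun M f (ennreal s) \<le> 2 * (\<integral>\<^sup>+t. ennreal (w t * min s t) \<partial>lborel)"
      using g.exists_averaged_extremal[OF w wfin] by blast
    show ?thesis
    proof (intro bexI[of _ f] conjI)
      show "f \<in> borel_measurable M" by fact
      have "primal M f \<le> (\<integral>\<^sup>+s. ennreal ((2 * c * z s) powr p) \<partial>N)"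
        unfolding primal_def
      proof (rule nn_integral_N_mono)
        fix s :: real assume s: "0 < s"
        have "(\<integral>\<^sup>+t. ennreal (w t * min s t) \<partial>lborel) = (\<integral>\<^sup>+t. ennreal c * ennreal (v t * min s t) \<partial>lborel)"
          unfolding w_def using c by (intro nn_integral_cong) (simp add: mult.assoc ennreal_mult')
        also have "\<dots> = ennreal c * Z s" unfolding Z_def by (intro nn_integral_cmult) measurable
        finally have "kfun M f (ennreal s) \<le> ennreal (s * (2 * c * z s))"
          using f(3)[OF s] c z0[OF s] s by (simp add: Z ennreal_mult mult_ac)
        then have "ennpowr (kfun M f (ennreal s) / ennreal s) p \<le> ennpowr (ennreal (s * (2 * c * z s)) / ennreal s) p"
          using p_gt by (intro ennpowr_mono divide_right_mono_ennreal) auto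
        then show "ennpowr (kfun M f (ennreal s) / ennreal s) p \<le> ennreal ((2 * c * z s) powr p)"
          using s c z0[OF s] by (simp add: divide_ennreal ennpowr_ennreal)
      qed
      also have "\<dots> = (\<integral>\<^sup>+s. ennreal ((2 * c) powr p) * ennreal (z s powr p) \<partial>N)"
        using c by (intro nn_integral_N_cong) (simp add: powr_mult z0 flip: ennreal_mult)
      also have "\<dots> = ennreal ((2 * c) powr p) * X" unfolding X_def by (intro nn_integral_cmult) measurable
      also have "\<dots> \<le> 1" using norm X by (simp flip: ennreal_mult)
      finally show "primal M f \<le> 1" .
      have "ennreal c * Y = (\<integral>\<^sup>+t. ennreal c * (ennreal (q t powr p' * \<phi>' t) * indicator A t) \<partial>lborel)"
        unfolding Y_def A_def[symmetric] q_def[symmetric] by (intro nn_integral_cmult[symmetric]) measurable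
      also have "\<dots> = (\<integral>\<^sup>+t. ennreal (w t) * kfun M g (ennreal t) \<partial>lborel)"
      proof (rule nn_integral_cong)
        fix t
        show "ennreal c * (ennreal (q t powr p' * \<phi>' t) * indicator A t) = ennreal (w t) * kfun M g (ennreal t)"
        proof (cases "t \<in> A")
          case True
          have "q t powr p' = q t powr (p' - 1) * q t" using q0[of t] p' by (cases "q t = 0") (auto simp: powr_diff)
          then have "c * (q t powr p' * \<phi>' t) = w t * g.k t" using True by (simp add: w_def v_def u_def q_def)
          then show ?thesis using True c v0[of t] g.k_nonneg[of t] phi'_nonneg[of t]
            by (simp add: g.kfun_eq w_def flip: ennreal_mult)
        qed (simp add: w_def vA)
      qed
      also have "\<dots> \<le> (\<integral>\<^sup>+x. ennreal \<bar>f x * g x\<bar> \<partial>M)" by (rule f(2))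
      finally have "ennreal (8 * p) * ennreal (c * yn) \<le> ennreal (8 * p) * (\<integral>\<^sup>+x. ennreal \<bar>f x * g x\<bar> \<partial>M)"
        using c yn by (simp add: Y mult_left_mono ennreal_mult)
      moreover have "8 * p * (c * yn) = yn powr (1 / p')"
      proof -
        have "1 / p' = -(1/p) + 1" using p'(2) by simp
        then have "yn powr (1 / p') = yn powr (- (1/p)) * yn" using yn by (simp only: powr_add) simp
        then show ?thesis using p_gt by (simp add: c_def)
      qed
      ultimately show "ennpowr Y (1 / p') \<le> ennreal (8 * p) * (\<integral>\<^sup>+x. ennreal \<bar>f x * g x\<bar> \<partial>M)"
        using p_gt c yn by (simp add: Y ennpowr_ennreal flip: ennreal_mult)
    qed
  qed
qed

end

subsection \<open>Reduction to truncated functions and Borel weights\<close>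

context sigma_finite_measure
begin

definition exhaustion :: "nat \<Rightarrow> 'a set" where
  "exhaustion = (SOME A. range A \<subseteq> sets M \<and> (\<Union>i. A i) = space M \<and> (\<forall>i. emeasure M (A i) \<noteq> \<infinity>) \<and> incseq A)"

lemma exhaustion:
  "range exhaustion \<subseteq> sets M" "(\<Union>i. exhaustion i) = space M" "emeasure M (exhaustion i) \<noteq> \<infinity>" "incseq exhaustion"
proof -
  have "\<exists>A :: nat \<Rightarrow> 'a set. range A \<subseteq> sets M \<and> (\<Union>i. A i) = space M \<and> (\<forall>i. emeasure M (A i) \<noteq> \<infinity>) \<and> incseq A"
    using sigma_finite_incseq by metis
  from someI_ex[OF this] show "range exhaustion \<subseteq> sets M" "(\<Union>i. exhaustion i) = space M"
    "emeasure M (exhaustion i) \<noteq> \<infinity>" "incseq exhaustion"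
    unfolding exhaustion_def[symmetric] by auto
qed

text \<open>The modulus is truncated, since all quantities depend on \<open>|f|\<close> only; this
  makes the truncations increase with \<open>n\<close>.\<close>

definition trunc :: "nat \<Rightarrow> ('a \<Rightarrow> real) \<Rightarrow> 'a \<Rightarrow> real" where
  "trunc n f x = min \<bar>f x\<bar> (real n) * indicator (exhaustion n) x"

lemma trunc_meas[measurable]:
  assumes [measurable]: "f \<in> borel_measurable M"
  shows "trunc n f \<in> borel_measurable M"
proof -
  have [measurable]: "exhaustion n \<in> sets M" using exhaustion(1) by auto
  show ?thesis unfolding trunc_def[abs_def] by measurable
qed

lemma truncated_trunc: assumes "f \<in> borel_measurable M" shows "truncated_fun M (trunc n f) (real n)"
proof
  show "trunc n f \<in> borel_measurable M" using assms by measurable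
  show "\<bar>trunc n f x\<bar> \<le> real n" for x by (auto simp: trunc_def indicator_def)
  have "emeasure M {x \<in> space M. trunc n f x \<noteq> 0} \<le> emeasure M (exhaustion n)"
    using exhaustion(1) by (intro emeasure_mono) (auto simp: trunc_def indicator_def)
  also have "\<dots> < \<infinity>" using exhaustion(3) by (simp add: less_top)
  finally show "emeasure M {x \<in> space M. trunc n f x \<noteq> 0} < \<infinity>" .
qed

lemma trunc_nonneg: "0 \<le> trunc n f x" and trunc_le: "trunc n f x \<le> \<bar>f x\<bar>"
  by (auto simp: trunc_def indicator_def)

lemma trunc_mono: "m \<le> n \<Longrightarrow> trunc m f x \<le> trunc n f x"
  using incseqD[OF exhaustion(4), of m n] by (auto simp: trunc_def indicator_def min_def)

lemma trunc_eventually: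
  assumes "x \<in> space M" shows "\<exists>n. \<forall>k\<ge>n. trunc k f x = \<bar>f x\<bar>"
proof -
  obtain m where m: "x \<in> exhaustion m" using assms exhaustion(2) by auto
  obtain l where "\<bar>f x\<bar> \<le> real l" using real_arch_simple by blast
  then show ?thesis
    using m incseqD[OF exhaustion(4), of m] by (intro exI[of _ "max m l"]) (auto simp: trunc_def min_def indicator_def)
qed

lemma kfun_trunc_mono:
  assumes "f \<in> borel_measurable M"
  shows "m \<le> n \<Longrightarrow> kfun M (trunc m f) t \<le> kfun M (trunc n f) t" and "kfun M (trunc n f) t \<le> kfun M f t"
  using assms trunc_nonneg[of _ f] trunc_le[of n f] trunc_mono[of m n f] by (auto intro!: kfun_mono_fun)

text \<open>Monotone convergence twice: for the superlevel sets, which increase to those of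
  \<open>g\<close>, and for the integral over \<open>l\<close>.\<close>

lemma kfun_SUP_trunc:
  assumes [measurable]: "g \<in> borel_measurable M"
  shows "kfun M g t = (SUP n. kfun M (trunc n g) t)"
proof -
  let ?D = "\<lambda>n l. {x \<in> space M. l < \<bar>trunc n g x\<bar>}"
  have sub: "?D m l \<subseteq> ?D n l" if "m \<le> n" for m n l
    using that trunc_nonneg[of _ g] trunc_mono[of m n g] by (auto intro: less_le_trans)
  have D: "distr_fun M g l = (SUP n. distr_fun M (trunc n g) l)" for l
  proof -
    have "{x \<in> space M. l < \<bar>g x\<bar>} = (\<Union>n. ?D n l)"
    proof (intro equalityI subsetI)
      fix x assume x: "x \<in> {x \<in> space M. l < \<bar>g x\<bar>}"
      then obtain n where "trunc n g x = \<bar>g x\<bar>" using trunc_eventually[of x g] by blast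
      then show "x \<in> (\<Union>n. ?D n l)" using x by (auto intro!: exI[of _ n])
    qed (use trunc_nonneg[of _ g] trunc_le[of _ g] in \<open>auto intro: less_le_trans\<close>)
    then show ?thesis
      unfolding distr_fun_def using sub by (subst SUP_emeasure_incseq) (auto simp: incseq_def)
  qed
  have "kfun M g t = (\<integral>\<^sup>+l. (SUP n. min t (distr_fun M (trunc n g) l) * indicator {0<..} l) \<partial>lborel)"
    unfolding kfun_def D by (intro nn_integral_cong) (simp add: inf_SUP SUP_mult_right_ennreal flip: inf_min)
  also have "\<dots> = (SUP n. kfun M (trunc n g) t)"
    unfolding kfun_def
  proof (rule nn_integral_monotone_convergence_SUP)
    show "incseq (\<lambda>n l. min t (distr_fun M (trunc n g) l) * indicator {0<..} l)"
      using sub by (auto simp: incseq_def le_fun_def distr_fun_def intro!: mult_right_mono min.mono emeasure_mono)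
  qed measurable
  finally show ?thesis .
qed

end

section \<open>From a Lebesgue measurable weight on \<open>Ib b\<close> to a Borel function on the
  line\<close>

lemma Ib_cases:
  assumes "0 < b"
  obtains "b = \<infinity>" "Ib b = {0<..}" | \<beta> where "b = ennreal \<beta>" "0 < \<beta>" "Ib b = {0<..<\<beta>}"
proof (cases b)
  case (real r)
  then have "Ib b = {0<..<r}" by (auto simp: Ib_def ennreal_less_iff)
  then show ?thesis using that(2)[of r] real assms by (auto simp: less_le)
next
  case top
  then have "Ib b = {0<..}" by (auto simp: Ib_def)
  then show ?thesis using that(1) top by simp
qed

lemma Ib_borel[measurable]: "Ib b \<in> sets borel"
  unfolding Ib_def by measurable

text \<open>Measurability is extracted from integrability on the intervals \<open>(0,t)\<close>:
  with \<open>t = b\<close> if \<open>b\<close> is finite, and as a limit over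
  \<open>t = n + 1\<close> otherwise.\<close>

lemma weight_on_measurable:
  assumes "0 < b" and "weight_on b \<phi>"
  shows "(\<lambda>x. indicator (Ib b) x * \<phi> x) \<in> borel_measurable lebesgue"
proof -
  have int: "set_integrable lebesgue {0<..<t} \<phi>" if "0 < t" "ennreal t \<le> b" for t
    using assms(2) that by (auto simp: weight_on_def)
  have meas: "(\<lambda>x. indicator {0<..<t} x * \<phi> x) \<in> borel_measurable lebesgue" if "0 < t" "ennreal t \<le> b" for t
    using int[OF that] borel_measurable_integrable unfolding set_integrable_def by fastforce
  show ?thesis
  proof (cases rule: Ib_cases[OF assms(1)])
    case 1
    show ?thesis
    proof (rule borel_measurable_LIMSEQ_real[where u="\<lambda>n x. indicator {0<..<real (Suc n)} x * \<phi> x"])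
      fix x :: real
      obtain m where m: "x < real m" using reals_Archimedean2 by blast
      show "(\<lambda>n. indicator {0<..<real (Suc n)} x * \<phi> x) \<longlonglongrightarrow> indicator (Ib b) x * \<phi> x"
        using m by (intro tendsto_eventually eventually_sequentiallyI[of m]) (auto simp: 1(2) indicator_def)
    qed (rule meas; simp add: 1(1))
  next
    case (2 \<beta>)
    then show ?thesis using meas[of \<beta>] by simp
  qed
qed

text \<open>The Borel representative agrees with the weight only almost everywhere, so its sign and
  its vanishing off \<open>Ib b\<close> are enforced separately.\<close>

lemma weight_on_borel:
  assumes "0 < b" and "weight_on b \<phi>"
  obtains \<phi>0 where "\<phi>0 \<in> borel_measurable borel" "\<And>t. 0 \<le> \<phi>0 t" "\<And>t. t \<notin> Ib b \<Longrightarrow> \<phi>0 t = 0"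
    "AE t in lborel. t \<in> Ib b \<longrightarrow> \<phi>0 t = \<phi> t"
proof -
  obtain g where g: "g \<in> borel_measurable lborel" "AE x in lborel. indicator (Ib b) x * \<phi> x = g x"
    using completion_ex_borel_measurable_real[OF weight_on_measurable[OF assms]] by blast
  have [measurable]: "g \<in> borel_measurable borel" using g(1) by simp
  show thesis
  proof (rule that[of "\<lambda>t. max 0 (g t) * indicator (Ib b) t"])
    show "AE t in lborel. t \<in> Ib b \<longrightarrow> max 0 (g t) * indicator (Ib b) t = \<phi> t"
      using g(2)
    proof eventually_elim
      case (elim t)
      show ?case
      proof
        assume t: "t \<in> Ib b"
        then have "0 < \<phi> t" using assms(2) by (auto simp: weight_on_def)
        then show "max 0 (g t) * indicator (Ib b) t = \<phi> t" using elim t by simp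
      qed
    qed
  qed auto
qed

lemma nn_integral_Ib_cong:
  assumes ae: "AE t in lborel. t \<in> Ib b \<longrightarrow> \<phi>0 t = \<phi> t" and z: "\<And>t. t \<notin> Ib b \<Longrightarrow> \<phi>0 t = (0::real)"
    and eq: "\<And>t. t \<in> Ib b \<Longrightarrow> F t * ennreal (\<phi> t) = G t * ennreal (\<phi> t)"
  shows "(\<integral>\<^sup>+t. F t * ennreal (\<phi> t) * indicator (Ib b) t \<partial>lebesgue) = (\<integral>\<^sup>+t. G t * ennreal (\<phi>0 t) \<partial>lborel)"
  unfolding nn_integral_completion
proof (rule nn_integral_cong_AE, use ae in eventually_elim)
  fix t assume "t \<in> Ib b \<longrightarrow> \<phi>0 t = \<phi> t"
  then show "F t * ennreal (\<phi> t) * indicator (Ib b) t = G t * ennreal (\<phi>0 t)"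
    using z[of t] eq[of t] by (cases "t \<in> Ib b") auto
qed

text \<open>For finite \<open>b\<close> integrability up to \<open>b\<close> controls everything to
  the left, and the tail beyond \<open>b\<close> is 0. For infinite \<open>b\<close> the tail from 1
  on is the first half of non-triviality.\<close>

lemma rearr_weight_of_weight_on:
  assumes b: "0 < b" and p: "1 < p" and w: "weight_on b \<phi>" and nt: "nontrivial_weight b p \<phi>"
    and m[measurable]: "\<phi>0 \<in> borel_measurable borel" and nn: "\<And>t. 0 \<le> \<phi>0 t" and z: "\<And>t. t \<notin> Ib b \<Longrightarrow> \<phi>0 t = 0"
    and ae: "AE t in lborel. t \<in> Ib b \<longrightarrow> \<phi>0 t = \<phi> t"
  shows "rearr_weight \<phi>0 p"
proof -
  have z0: "\<phi>0 t = 0" if "t \<le> 0" for t using z[of t] that by (auto simp: Ib_def)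
  have fin: "(\<integral>\<^sup>+s\<in>{0<..<t}. ennreal (\<phi>0 s) \<partial>lborel) < \<infinity>" if t: "0 < t" "ennreal t \<le> b" for t
  proof -
    have "set_integrable lebesgue {0<..<t} \<phi>" using w t by (auto simp: weight_on_def)
    then have "(\<integral>\<^sup>+x. ennreal (norm (indicator {0<..<t} x *\<^sub>R \<phi> x)) \<partial>lebesgue) < \<infinity>"
      by (simp add: set_integrable_def integrable_iff_bounded)
    also have "(\<integral>\<^sup>+x. ennreal (norm (indicator {0<..<t} x *\<^sub>R \<phi> x)) \<partial>lebesgue) = (\<integral>\<^sup>+s\<in>{0<..<t}. ennreal (\<phi>0 s) \<partial>lborel)"
      unfolding nn_integral_completion
    proof (rule nn_integral_cong_AE, use ae in eventually_elim)
      fix x assume "x \<in> Ib b \<longrightarrow> \<phi>0 x = \<phi> x"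
      moreover have "x \<in> Ib b" if "x \<in> {0<..<t}" using that t by (auto simp: Ib_def intro: less_le_trans[of _ "ennreal t"] simp: ennreal_less_iff)
      ultimately show "ennreal (norm (indicator {0<..<t} x *\<^sub>R \<phi> x)) = ennreal (\<phi>0 x) * indicator {0<..<t} x"
        using nn[of x] by (cases "x \<in> {0<..<t}") auto
    qed
    finally show ?thesis .
  qed
  have finL: "(\<integral>\<^sup>+s\<in>{..t}. ennreal (\<phi>0 s) \<partial>lborel) < \<infinity>" for t
  proof -
    obtain t' where t': "0 < t'" "ennreal t' \<le> b" "\<And>s. \<phi>0 s * indicator {..t} s \<le> \<phi>0 s * indicator {0<..<t'} s"
    proof (cases rule: Ib_cases[OF b])
      case 1
      show ?thesis by (rule that[of "max t 0 + 1"]) (use 1 z0 nn in \<open>auto simp: indicator_def not_less\<close>)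
    next
      case (2 \<beta>)
      show ?thesis by (rule that[of \<beta>]) (use 2 z nn in \<open>auto simp: indicator_def\<close>)
    qed
    have "(\<integral>\<^sup>+s\<in>{..t}. ennreal (\<phi>0 s) \<partial>lborel) \<le> (\<integral>\<^sup>+s\<in>{0<..<t'}. ennreal (\<phi>0 s) \<partial>lborel)"
    proof (rule nn_integral_mono)
      fix s
      show "ennreal (\<phi>0 s) * indicator {..t} s \<le> ennreal (\<phi>0 s) * indicator {0<..<t'} s"
        using t'(3)[of s] nn[of s] by (auto simp: indicator_def split: if_splits intro: ennreal_leI)
    qed
    also have "\<dots> < \<infinity>" by (intro fin t')
    finally show ?thesis .
  qed
  show ?thesis
  proof
    show "\<phi>0 \<in> borel_measurable borel" "1 < p" by fact+
    show "0 \<le> \<phi>0 t" for t by (rule nn)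
    show "\<phi>0 t = 0" if "t \<le> 0" for t using z0 that .
    show "(\<integral>\<^sup>+s\<in>{..t}. ennreal (\<phi>0 s) \<partial>lborel) < \<infinity>" for t by (rule finL)
  next
    fix t :: real assume t: "0 < t"
    have pw: "s powr (-p) \<le> t powr (-p)" if "t < s" for s using that t p by (intro powr_mono2') auto
    let ?I = "\<lambda>t. \<integral>\<^sup>+s. ennreal (\<phi>0 s * s powr (-p)) * indicator {t<..} s \<partial>lborel"
    obtain c where c: "?I c < \<infinity>"
    proof (cases rule: Ib_cases[OF b])
      case 1
      have "AE s in lborel. s \<in> {1<..} \<longrightarrow> \<phi>0 s = \<phi> s" using ae by eventually_elim (simp add: 1(2))
      then have "?I 1 = (\<integral>\<^sup>+s\<in>{1<..}. ennreal (\<phi> s * s powr (-p)) \<partial>lebesgue)"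
        unfolding nn_integral_completion by (intro nn_integral_cong_AE) (auto simp: indicator_def elim!: eventually_mono)
      then show ?thesis using nt 1(1) by (intro that[of 1]) (simp add: nontrivial_weight_def)
    next
      case (2 \<beta>)
      then have "?I \<beta> = (\<integral>\<^sup>+(s::real). 0 \<partial>lborel)" using z by (intro nn_integral_cong) (auto simp: indicator_def)
      then show ?thesis by (intro that[of \<beta>]) simp
    qed
    \<comment> \<open>Between \<open>t\<close> and \<open>c\<close> the factor
      \<open>s powr (-p)\<close> is at most \<open>t powr (-p)\<close>, so only the integral of the
      weight itself enters there.\<close>
    have "?I t \<le> (\<integral>\<^sup>+s. ennreal (t powr (-p)) * (ennreal (\<phi>0 s) * indicator {..c} s) + ennreal (\<phi>0 s * s powr (-p)) * indicator {c<..} s \<partial>lborel)"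
      using pw nn by (intro nn_integral_mono)
        (auto simp: indicator_def mult.commute mult_left_mono intro!: ennreal_leI simp flip: ennreal_mult)
    also have "\<dots> = ennreal (t powr (-p)) * (\<integral>\<^sup>+s\<in>{..c}. ennreal (\<phi>0 s) \<partial>lborel) + ?I c"
      by (subst nn_integral_add) (auto simp: nn_integral_cmult)
    also have "\<dots> < \<infinity>" using c finL[of c] by (simp add: ennreal_mult_less_top)
    finally show "?I t < \<infinity>" .
    obtain c where c: "0 < c" "ennreal c \<le> b" "c \<le> t"
      using t by (cases rule: Ib_cases[OF b]) (force, metis ennreal_leI min.cobounded1 min.cobounded2 min_less_iff_conj)
    have "\<infinity> = (\<integral>\<^sup>+s\<in>{0<..<c}. ennreal (\<phi> s * s powr (-p)) \<partial>lebesgue)"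
      using nt c by (simp add: nontrivial_weight_def)
    also have "\<dots> \<le> (\<integral>\<^sup>+s\<in>{..t}. ennreal (\<phi>0 s * s powr (-p)) \<partial>lborel)"
      unfolding nn_integral_completion
    proof (rule nn_integral_mono_AE, use ae in eventually_elim)
      fix x assume "x \<in> Ib b \<longrightarrow> \<phi>0 x = \<phi> x"
      moreover have "x \<in> Ib b" if "x \<in> {0<..<c}" using that c by (auto simp: Ib_def intro: less_le_trans[of _ "ennreal c"] simp: ennreal_less_iff)
      ultimately show "ennreal (\<phi> x * x powr (-p)) * indicator {0<..<c} x \<le> ennreal (\<phi>0 x * x powr (-p)) * indicator {..t} x"
        using c(3) by (cases "x \<in> {0<..<c}") auto
    qed
    finally show "(\<integral>\<^sup>+s\<in>{..t}. ennreal (\<phi>0 s * s powr (-p)) \<partial>lborel) = \<infinity>" by (simp add: top_unique)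
  qed
qed

text \<open>The exponents split as \<open>t^(p+p'-1) = t^(p-1) t^p'\<close> and
  \<open>\<omega>^(p'+1) = \<omega> \<omega>^p'\<close>. The second factors turn \<open>g**\<close>
  into \<open>K(g,t) / \<omega>\<close>.\<close>

lemma dual_weight_eq:
  assumes rw: "rearr_weight \<phi>0 p" and w: "weight_on b \<phi>" and b: "0 < b" and z: "\<And>t. t \<notin> Ib b \<Longrightarrow> \<phi>0 t = 0"
    and ae: "AE t in lborel. t \<in> Ib b \<longrightarrow> \<phi>0 t = \<phi> t" and t: "t \<in> Ib b"
  shows "dual_weight b p \<phi> t = rearr_weight.\<phi>' \<phi>0 p t * (t / rearr_weight.\<omega> \<phi>0 p t) powr (p / (p - 1))"
proof -
  interpret rearr_weight \<phi>0 p by fact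
  have t0: "0 < t" using t by (simp add: Ib_def)
  have LINT_eq: "(LINT s:A|lebesgue. \<phi> s * v s) = enn2real (\<integral>\<^sup>+s\<in>A. ennreal (\<phi>0 s * v s) \<partial>lborel)"
    if [measurable]: "A \<in> sets borel" "v \<in> borel_measurable borel" and A: "A \<subseteq> Ib b" and v: "\<And>s. 0 \<le> v s" for A and v :: "real \<Rightarrow> real"
  proof -
    have aeA: "AE s in lborel. indicator A s *\<^sub>R (\<phi> s * v s) = indicator A s * (\<phi>0 s * v s)"
      using ae by eventually_elim (use A in \<open>auto simp: indicator_def\<close>)
    have "(LINT s:A|lebesgue. \<phi> s * v s) = (LINT s|lebesgue. indicator A s * (\<phi>0 s * v s))"
      unfolding set_lebesgue_integral_def
    proof (rule integral_cong_AE)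
      show "AE s in lebesgue. indicator A s *\<^sub>R (\<phi> s * v s) = indicator A s * (\<phi>0 s * v s)"
        using aeA by (rule AE_completion)
      show 2: "(\<lambda>s. indicator A s * (\<phi>0 s * v s)) \<in> borel_measurable lebesgue" by (rule measurable_completion) measurable
      show "(\<lambda>s. indicator A s *\<^sub>R (\<phi> s * v s)) \<in> borel_measurable lebesgue"
      proof -
        \<comment> \<open>Outside \<open>Ib b\<close> nothing is known about the weight, not even
          measurability; as \<open>A\<close> lies in \<open>Ib b\<close>, the indicator of
          \<open>Ib b\<close> can be inserted.\<close>
        have "(\<lambda>s. indicator A s *\<^sub>R (\<phi> s * v s)) = (\<lambda>s. (indicator A s * v s) * (indicator (Ib b) s * \<phi> s))"
          using A by (auto simp: indicator_def fun_eq_iff)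
        moreover have "(\<lambda>s. indicator A s * v s) \<in> borel_measurable lebesgue" by (rule measurable_completion) measurable
        ultimately show ?thesis using weight_on_measurable[OF b w] by simp
      qed
    qed
    also have "\<dots> = (LINT s|lborel. indicator A s * (\<phi>0 s * v s))" by (rule integral_completion) measurable
    also have "\<dots> = enn2real (\<integral>\<^sup>+s. ennreal (indicator A s * (\<phi>0 s * v s)) \<partial>lborel)"
      by (rule integral_eq_nn_integral) (auto simp: phi_nonneg v)
    also have "(\<integral>\<^sup>+s. ennreal (indicator A s * (\<phi>0 s * v s)) \<partial>lborel) = (\<integral>\<^sup>+s\<in>A. ennreal (\<phi>0 s * v s) \<partial>lborel)"
      by (intro nn_integral_cong) (auto simp: indicator_def)
    finally show ?thesis .
  qed
  have V: "(LINT s:{0<..<t}|lebesgue. \<phi> s) = V t"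
  proof -
    have "{0<..<t} \<subseteq> Ib b" using t by (auto simp: Ib_def intro: less_trans[of _ "ennreal t"] simp: ennreal_less_iff)
    then have "(LINT s:{0<..<t}|lebesgue. \<phi> s) = enn2real (\<integral>\<^sup>+s\<in>{0<..<t}. ennreal (\<phi>0 s) \<partial>lborel)"
      using LINT_eq[of "{0<..<t}" "\<lambda>_. 1"] by simp
    also have "(\<integral>\<^sup>+s\<in>{0<..<t}. ennreal (\<phi>0 s) \<partial>lborel) = (\<integral>\<^sup>+s\<in>{..t}. ennreal (\<phi>0 s) \<partial>lborel)"
      by (rule nn_integral_cong_AE, use AE_lborel_singleton[of t] in eventually_elim) (auto simp: indicator_def phi_zero)
    also have "\<dots> = ennreal (V t)" by (simp add: emeasure_N[symmetric] emeasure_N_atMost)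
    finally show ?thesis by (simp add: V_nonneg)
  qed
  have W: "(LINT s:{s. t < s \<and> ennreal s < b}|lebesgue. \<phi> s * s powr (-p)) = W t"
  proof -
    have "(LINT s:{s. t < s \<and> ennreal s < b}|lebesgue. \<phi> s * s powr (-p)) = enn2real (\<integral>\<^sup>+s. ennreal (\<phi>0 s * s powr (-p)) * indicator {s. t < s \<and> ennreal s < b} s \<partial>lborel)"
      using t0 by (intro LINT_eq) (auto simp: Ib_def)
    also have "(\<integral>\<^sup>+s. ennreal (\<phi>0 s * s powr (-p)) * indicator {s. t < s \<and> ennreal s < b} s \<partial>lborel) = (\<integral>\<^sup>+s\<in>{t<..}. ennreal (\<phi>0 s * s powr (-p)) \<partial>lborel)"
      using z t0 by (intro nn_integral_cong) (auto simp: indicator_def Ib_def)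
    also have "\<dots> = ennreal (W t)" using t0 by (simp add: emeasure_N'[symmetric] emeasure_N'_greater)
    finally show ?thesis by (simp add: W_nonneg)
  qed
  define r where "r = p / (p - 1)"
  have o: "0 < \<omega> t" by (rule omega_pos[OF t0])
  have "dual_weight b p \<phi> t = t powr (p + r - 1) * V t * W t / \<omega> t powr (r + 1)"
    unfolding dual_weight_def Let_def V W r_def by (simp add: \<omega>_def)
  also have "t powr (p + r - 1) = t powr (p - 1) * t powr r" by (simp add: algebra_simps flip: powr_add)
  also have "\<omega> t powr (r + 1) = \<omega> t powr r * \<omega> t" using o by (simp add: powr_add)
  finally show ?thesis unfolding r_def[symmetric] \<phi>'_def using t0 o by (simp add: powr_divide mult_ac)
qed

subsection \<open>The duality theorem\<close>

context rearr_weight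
begin

text \<open>The function \<open>\<psi>\<close> of the theorem, extended by 0 beyond
  \<open>b\<close>, where \<open>W\<close> vanishes.\<close>

definition dual_density :: "real \<Rightarrow> real" where
  "dual_density t = \<phi>' t * (t / \<omega> t) powr p'"

definition dual :: "'a measure \<Rightarrow> ('a \<Rightarrow> real) \<Rightarrow> ennreal" where
  "dual M g = (\<integral>\<^sup>+t. ennpowr (kfun M g (ennreal t) / ennreal t) p' * ennreal (dual_density t) \<partial>lborel)"

lemma dual_density_meas[measurable]: "dual_density \<in> borel_measurable borel"
  unfolding dual_density_def[abs_def] by measurable

lemma dual_integrand_truncated:
  assumes "truncated_fun M g B"
  shows "ennpowr (kfun M g (ennreal t) / ennreal t) p' * ennreal (dual_density t)
    = ennreal ((truncated_fun.k M g t / \<omega> t) powr p' * \<phi>' t)"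
proof -
  interpret g: truncated_fun M g B by fact
  show ?thesis
  proof (cases "0 < t")
    case True
    have "(g.k t / t) powr p' * (t / \<omega> t) powr p' = (g.k t / t * (t / \<omega> t)) powr p'"
      using True omega_pos[OF True] by (subst powr_mult) (auto simp: g.k_nonneg)
    then have "(g.k t / t) powr p' * dual_density t = (g.k t / \<omega> t) powr p' * \<phi>' t"
      using True by (simp add: dual_density_def)
    then show ?thesis
      using True by (simp add: g.kfun_eq divide_ennreal g.k_nonneg ennpowr_ennreal flip: ennreal_mult')
  qed (simp add: dual_density_def phi'_nonpos)
qed

text \<open>Both functions are truncated at the same stage. The right-hand side increases with
  \<open>g\<close>, so the bound is uniform in the stage and survives monotone convergence.\<close>

lemma pairing_le:
  assumes sf: "sigma_finite_measure M" and [measurable]: "f \<in> borel_measurable M" "g \<in> borel_measurable M"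
    and norm: "primal M f \<le> 1"
  shows "(\<integral>\<^sup>+x. ennreal \<bar>f x * g x\<bar> \<partial>M) \<le> ennreal (16 * p * p') * ennpowr (dual M g) (1 / p') + ennreal (2 * e) * (\<integral>\<^sup>+x. ennreal \<bar>g x\<bar> \<partial>M)"
proof -
  interpret sigma_finite_measure M by fact
  have "(\<integral>\<^sup>+x. ennreal \<bar>f x * g x\<bar> \<partial>M) \<le> (\<integral>\<^sup>+x. (SUP n. ennreal \<bar>trunc n f x * trunc n g x\<bar>) \<partial>M)"
  proof (rule nn_integral_mono)
    fix x assume "x \<in> space M"
    then obtain m k where mk: "\<forall>i\<ge>m. trunc i f x = \<bar>f x\<bar>" "\<forall>i\<ge>k. trunc i g x = \<bar>g x\<bar>" using trunc_eventually by meson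
    let ?n = "max m k"
    have "trunc ?n f x = \<bar>f x\<bar>" "trunc ?n g x = \<bar>g x\<bar>" using mk by auto
    then have "ennreal \<bar>f x * g x\<bar> = ennreal \<bar>trunc ?n f x * trunc ?n g x\<bar>" by (simp add: abs_mult)
    also have "\<dots> \<le> (SUP n. ennreal \<bar>trunc n f x * trunc n g x\<bar>)" by (rule SUP_upper) simp
    finally show "ennreal \<bar>f x * g x\<bar> \<le> (SUP n. ennreal \<bar>trunc n f x * trunc n g x\<bar>)" .
  qed
  also have "\<dots> = (SUP n. \<integral>\<^sup>+x. ennreal \<bar>trunc n f x * trunc n g x\<bar> \<partial>M)"
  proof (rule nn_integral_monotone_convergence_SUP)
    show "incseq (\<lambda>n x. ennreal \<bar>trunc n f x * trunc n g x\<bar>)"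
      using trunc_nonneg trunc_mono by (auto simp: incseq_def le_fun_def abs_mult intro!: ennreal_leI mult_mono)
  qed measurable
  also have "\<dots> \<le> ennreal (16 * p * p') * ennpowr (dual M g) (1 / p') + ennreal (2 * e) * (\<integral>\<^sup>+x. ennreal \<bar>g x\<bar> \<partial>M)"
  proof (rule SUP_least)
    fix n
    interpret F: truncated_fun M "trunc n f" "real n" by (rule truncated_trunc) measurable
    interpret G: truncated_fun M "trunc n g" "real n" by (rule truncated_trunc) measurable
    have "(\<integral>\<^sup>+s. ennreal ((F.k s / s) powr p) \<partial>N) \<le> primal M f"
      unfolding primal_def
    proof (rule nn_integral_N_mono)
      fix s :: real assume s: "0 < s"
      have "ennreal ((F.k s / s) powr p) = ennpowr (kfun M (trunc n f) (ennreal s) / ennreal s) p"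
        using s by (simp add: F.kfun_eq divide_ennreal F.k_nonneg ennpowr_ennreal)
      also have "\<dots> \<le> ennpowr (kfun M f (ennreal s) / ennreal s) p"
        using p_gt by (intro ennpowr_mono divide_right_mono_ennreal kfun_trunc_mono) auto
      finally show "ennreal ((F.k s / s) powr p) \<le> ennpowr (kfun M f (ennreal s) / ennreal s) p" .
    qed
    with norm have "(\<integral>\<^sup>+s. ennreal ((F.k s / s) powr p) \<partial>N) \<le> 1" by simp
    then have "(\<integral>\<^sup>+x. ennreal \<bar>trunc n f x * trunc n g x\<bar> \<partial>M) \<le>
      ennreal (16 * p * p') * ennpowr (\<integral>\<^sup>+t. ennreal ((G.k t / \<omega> t) powr p' * \<phi>' t) \<partial>lborel) (1 / p')
      + ennreal (2 * e) * (\<integral>\<^sup>+x. ennreal \<bar>trunc n g x\<bar> \<partial>M)"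
      by (rule upper_estimate[OF F.truncated_fun_axioms G.truncated_fun_axioms])
    also have "\<dots> \<le> ennreal (16 * p * p') * ennpowr (dual M g) (1 / p') + ennreal (2 * e) * (\<integral>\<^sup>+x. ennreal \<bar>g x\<bar> \<partial>M)"
    proof (intro add_mono mult_left_mono ennpowr_mono nn_integral_mono ennreal_leI)
      show "\<bar>trunc n g x\<bar> \<le> \<bar>g x\<bar>" for x using trunc_nonneg[of n g x] trunc_le[of n g x] by simp
      show "(\<integral>\<^sup>+t. ennreal ((G.k t / \<omega> t) powr p' * \<phi>' t) \<partial>lborel) \<le> dual M g"
        unfolding dual_def dual_integrand_truncated[OF G.truncated_fun_axioms, symmetric]
        using p'(1) by (intro nn_integral_mono mult_right_mono ennpowr_mono divide_right_mono_ennreal kfun_trunc_mono) auto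
    qed (use p' in auto)
    finally show "(\<integral>\<^sup>+x. ennreal \<bar>trunc n f x * trunc n g x\<bar> \<partial>M) \<le> \<dots>" .
  qed
  finally show ?thesis .
qed

text \<open>\<open>lower_estimate\<close> is applied to \<open>trunc n g\<close> on the interval
  \<open>A n\<close>; its constant does not depend on \<open>n\<close>, so truncation and interval
  are removed together by monotone convergence.\<close>

lemma dual_le:
  assumes sf: "sigma_finite_measure M" and [measurable]: "g \<in> borel_measurable M"
    and R: "\<And>f. f \<in> borel_measurable M \<Longrightarrow> primal M f \<le> 1 \<Longrightarrow> (\<integral>\<^sup>+x. ennreal \<bar>f x * g x\<bar> \<partial>M) \<le> R"
  shows "ennpowr (dual M g) (1 / p') \<le> ennreal (8 * p) * R"
proof -
  interpret sigma_finite_measure M by fact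
  have p'0: "0 < p'" using p'(1) by simp
  \<comment> \<open>The shift by 2 makes the endpoint exceed 1 for every \<open>n\<close>, as
    \<open>lower_estimate\<close> requires.\<close>
  define A where "A n = {1 / real (n + 2)<..<real (n + 2)}" for n
  have [measurable]: "A n \<in> sets borel" for n by (simp add: A_def)
  define G where "G n t = ennpowr (kfun M (trunc n g) (ennreal t) / ennreal t) p' * ennreal (dual_density t) * indicator (A n) t" for n t
  have Amono: "A m \<subseteq> A n" if "m \<le> n" for m n
  proof -
    have "1 / real (n + 2) \<le> 1 / real (m + 2)" using that by (intro divide_left_mono) auto
    then show ?thesis using that by (auto simp: A_def)
  qed
  note kle = kfun_trunc_mono(1)[OF \<open>g \<in> borel_measurable M\<close>]
  have inc: "G m t \<le> G n t" if "m \<le> n" for m n t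
    unfolding G_def using Amono[OF that] p'0 kle[OF that]
    by (intro mult_mono ennpowr_mono divide_right_mono_ennreal) (auto simp: indicator_def)
  have "dual M g \<le> (\<integral>\<^sup>+t. (SUP n. G n t) \<partial>lborel)"
    unfolding dual_def
  proof (rule nn_integral_mono)
    fix t :: real
    show "ennpowr (kfun M g (ennreal t) / ennreal t) p' * ennreal (dual_density t) \<le> (SUP n. G n t)"
    proof (cases "0 < t")
      case True
      obtain m where "max t (1 / t) < real m" using reals_Archimedean2 by blast
      then have m: "t \<in> A m" using True by (auto simp: A_def field_simps add_strict_increasing)
      have "kfun M g (ennreal t) / ennreal t = (SUP n. kfun M (trunc n g) (ennreal t)) / ennreal t"
        by (subst kfun_SUP_trunc) auto
      also have "\<dots> = (SUP n. kfun M (trunc n g) (ennreal t) / ennreal t)" by (rule SUP_divide_ennreal)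
      finally have "ennpowr (kfun M g (ennreal t) / ennreal t) p' * ennreal (dual_density t)
        \<le> (SUP n. ennpowr (kfun M (trunc n g) (ennreal t) / ennreal t) p') * ennreal (dual_density t)"
        using ennpowr_SUP_le[OF p'0, of "\<lambda>n. kfun M (trunc n g) (ennreal t) / ennreal t"] by (simp add: mult_right_mono)
      also have "\<dots> = (SUP n. ennpowr (kfun M (trunc n g) (ennreal t) / ennreal t) p' * ennreal (dual_density t))"
        by (rule SUP_mult_right_ennreal)
      also have "\<dots> \<le> (SUP n. G n t)"
      proof (rule SUP_mono)
        fix n
        \<comment> \<open>A later stage is used so that \<open>t\<close> already belongs to the
          interval; the truncation only grows.\<close>
        have "t \<in> A (max m n)" using m Amono[of m "max m n"] by auto
        then have "ennpowr (kfun M (trunc n g) (ennreal t) / ennreal t) p' * ennreal (dual_density t) \<le> G (max m n) t"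
          unfolding G_def using p'0 kle[of n "max m n"]
          by (auto intro!: mult_right_mono ennpowr_mono divide_right_mono_ennreal)
        then show "\<exists>k\<in>UNIV. ennpowr (kfun M (trunc n g) (ennreal t) / ennreal t) p' * ennreal (dual_density t) \<le> G k t" by blast
      qed
      finally show ?thesis .
    qed (simp add: dual_density_def phi'_nonpos)
  qed
  also have "\<dots> = (SUP n. \<integral>\<^sup>+t. G n t \<partial>lborel)"
    by (rule nn_integral_monotone_convergence_SUP)
      (auto simp: incseq_def le_fun_def inc, simp add: G_def[abs_def])
  also have "\<dots> \<le> ennpowr (ennreal (8 * p) * R) p'"
  proof (rule SUP_least)
    fix n
    have tr: "truncated_fun M (trunc n g) (real n)" by (rule truncated_trunc) measurable
    have n1: "1 < real (n + 2)" by simp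
    have "(\<integral>\<^sup>+t. G n t \<partial>lborel) = (\<integral>\<^sup>+t\<in>{1/real (n+2)<..<real (n+2)}. ennreal ((truncated_fun.k M (trunc n g) t / \<omega> t) powr p' * \<phi>' t) \<partial>lborel)"
      unfolding G_def dual_integrand_truncated[OF tr] A_def ..
    then obtain f where f: "f \<in> borel_measurable M" "primal M f \<le> 1"
      and "ennpowr (\<integral>\<^sup>+t. G n t \<partial>lborel) (1 / p') \<le> ennreal (8 * p) * (\<integral>\<^sup>+x. ennreal \<bar>f x * trunc n g x\<bar> \<partial>M)"
      using lower_estimate[OF tr n1] by auto
    note this(3)
    also have "(\<integral>\<^sup>+x. ennreal \<bar>f x * trunc n g x\<bar> \<partial>M) \<le> (\<integral>\<^sup>+x. ennreal \<bar>f x * g x\<bar> \<partial>M)"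
      using trunc_nonneg[of n g] trunc_le[of n g] by (intro nn_integral_mono ennreal_leI) (auto simp: abs_mult intro!: mult_left_mono)
    also have "\<dots> \<le> R" by (rule R[OF f])
    finally have "ennpowr (ennpowr (\<integral>\<^sup>+t. G n t \<partial>lborel) (1 / p')) p' \<le> ennpowr (ennreal (8 * p) * R) p'"
      using p'0 by (intro ennpowr_mono) (auto simp: mult_left_mono)
    then show "(\<integral>\<^sup>+t. G n t \<partial>lborel) \<le> ennpowr (ennreal (8 * p) * R) p'" using p'0 by (simp add: ennpowr_inverse)
  qed
  finally have "ennpowr (dual M g) (1 / p') \<le> ennpowr (ennpowr (ennreal (8 * p) * R) p') (1 / p')"
    using p'0 by (intro ennpowr_mono) auto
  then show ?thesis using p'0 by (simp add: ennpowr_inverse)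
qed

text \<open>The constant function \<open>e\<close> is admissible: its \<open>f**\<close> is at most
  \<open>e\<close>, and \<open>e powr p\<close> times the total mass of \<open>N\<close> is at most
  1.\<close>

lemma mean_le:
  assumes sf: "sigma_finite_measure M" and [measurable]: "g \<in> borel_measurable M"
    and R: "\<And>f. f \<in> borel_measurable M \<Longrightarrow> primal M f \<le> 1 \<Longrightarrow> (\<integral>\<^sup>+x. ennreal \<bar>f x * g x\<bar> \<partial>M) \<le> R"
  shows "ennreal e * (\<integral>\<^sup>+x. ennreal \<bar>g x\<bar> \<partial>M) \<le> R"
proof -
  interpret sigma_finite_measure M by fact
  have "primal M (\<lambda>_. e) \<le> (\<integral>\<^sup>+s. ennreal (e powr p) \<partial>N)"
    unfolding primal_def
  proof (rule nn_integral_N_mono)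
    fix s :: real assume s: "0 < s"
    have "kfun M (\<lambda>_. e) (ennreal s) \<le> ennreal e * ennreal s"
      using kfun_le_add[of "\<lambda>_. e" e "ennreal s"] e_nonneg by simp
    then have "ennpowr (kfun M (\<lambda>_. e) (ennreal s) / ennreal s) p \<le> ennpowr (ennreal (e * s) / ennreal s) p"
      using p_gt s e_nonneg by (intro ennpowr_mono divide_right_mono_ennreal) (auto simp: ennreal_mult)
    then show "ennpowr (kfun M (\<lambda>_. e) (ennreal s) / ennreal s) p \<le> ennreal (e powr p)"
      using s e_nonneg by (simp add: divide_ennreal ennpowr_ennreal)
  qed
  also have "\<dots> = ennreal (e powr p) * emeasure N UNIV" by simp
  also have "\<dots> \<le> 1"
  proof (cases "emeasure N UNIV = \<infinity>")
    case True then show ?thesis by (simp add: e_def)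
  next
    case False
    then have eq: "emeasure N UNIV = ennreal (measure N UNIV)" by (simp add: emeasure_eq_ennreal_measure)
    have "e powr p = measure N UNIV powr (-1)" using False p_gt by (simp add: e_def powr_powr)
    then have "e powr p * measure N UNIV \<le> 1" by (cases "measure N UNIV = 0") (auto simp: powr_minus)
    then show ?thesis by (simp add: eq flip: ennreal_mult)
  qed
  finally have "(\<integral>\<^sup>+x. ennreal \<bar>e * g x\<bar> \<partial>M) \<le> R" by (intro R) auto
  then show ?thesis using e_nonneg by (simp add: abs_mult ennreal_mult nn_integral_cmult)
qed

end

theorem theoremA:
  fixes M :: "'a measure" and b :: ennreal and p p' :: real
    and \<phi> \<psi> :: "real \<Rightarrow> real" and avg_term :: "('a \<Rightarrow> real) \<Rightarrow> ennreal"
  assumes "sigma_finite_measure M"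
    and "emeasure M (space M) = b" and "0 < b"
    and "1 < p" and "p' = p / (p - 1)"
    and "weight_on b \<phi>" and "nontrivial_weight b p \<phi>"
  defines "\<psi> \<equiv> dual_weight b p \<phi>"
    and "avg_term \<equiv> (\<lambda>g. if (\<integral>\<^sup>+ t\<in>Ib b. ennreal (\<phi> t) \<partial>lebesgue) = \<infinity> then 0
           else (\<integral>\<^sup>+ x. ennreal \<bar>g x\<bar> \<partial>M)
                / ennpowr (\<integral>\<^sup>+ t\<in>Ib b. ennreal (\<phi> t) \<partial>lebesgue) (1 / p))"
  shows "\<exists>C::real. 1 \<le> C \<and>
    (\<forall>g \<in> borel_measurable M.
       rho_assoc M p \<phi> g \<le> ennreal C * (rho M p' \<psi> g + avg_term g) \<and>
       rho M p' \<psi> g + avg_term g \<le> ennreal C * rho_assoc M p \<phi> g)"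
proof -
  interpret M: sigma_finite_measure M by fact
  obtain \<phi>0 where \<phi>0: "\<phi>0 \<in> borel_measurable borel" "\<And>t. 0 \<le> \<phi>0 t" "\<And>t. t \<notin> Ib b \<Longrightarrow> \<phi>0 t = 0"
    "AE t in lborel. t \<in> Ib b \<longrightarrow> \<phi>0 t = \<phi> t"
    using weight_on_borel[OF assms(3,6)] by metis
  interpret w: rearr_weight \<phi>0 p by (rule rearr_weight_of_weight_on[OF assms(3,4,6,7) \<phi>0])
  have p': "p' = w.p'" by (simp add: w.p'_def assms(5))
  have rho_p: "rho M p \<phi> f = ennpowr (w.primal M f) (1 / p)" if [measurable]: "f \<in> borel_measurable M" for f
  proof -
    have "(\<integral>\<^sup>+ t\<in>Ib b. ennpowr (max_rearr M f t) p * ennreal (\<phi> t) \<partial>lebesgue)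
        = (\<integral>\<^sup>+ t. ennpowr (kfun M f (ennreal t) / ennreal t) p * ennreal (\<phi>0 t) \<partial>lborel)"
      by (rule nn_integral_Ib_cong[OF \<phi>0(4,3)]) (simp_all add: M.max_rearr_eq)
    then show ?thesis unfolding rho_def w.primal_def assms(2) by (simp add: w.nn_integral_N mult.commute)
  qed
  have rho_p': "rho M p' \<psi> g = ennpowr (w.dual M g) (1 / w.p')" if [measurable]: "g \<in> borel_measurable M" for g
  proof -
    \<comment> \<open>Beyond \<open>b\<close> the extended weight is 0, hence so are
      \<open>W\<close> and the density; the integral over the line thus reduces to one over
      \<open>Ib b\<close>.\<close>
    have "w.dual_density t = 0" if "t \<notin> Ib b" for t
    proof (cases "0 < t")
      case True
      then have bt: "b \<le> ennreal t" using that by (auto simp: Ib_def not_less)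
      have "\<phi>0 x = 0" if "t < x" for x
        using order_trans[OF bt ennreal_leI[of t x]] that by (intro \<phi>0(3)) (auto simp: Ib_def not_less)
      then have "(\<integral>\<^sup>+x. ennreal (\<phi>0 x * x powr (-p)) * indicator {t<..} x \<partial>lborel) = (\<integral>\<^sup>+(x::real). 0 \<partial>lborel)"
        by (intro nn_integral_cong) (auto simp: indicator_def)
      then have "emeasure w.N' {t<..} = 0" by (simp add: w.emeasure_N')
      then have "w.W t = 0" by (simp add: w.W_def measure_def)
      then show ?thesis by (simp add: w.dual_density_def w.\<phi>'_def)
    qed (simp add: w.dual_density_def w.phi'_nonpos)
    moreover have "w.dual_density t = \<psi> t" if "t \<in> Ib b" for t
      unfolding \<psi>_def w.dual_density_def w.p'_def
      using dual_weight_eq[OF w.rearr_weight_axioms assms(6,3) \<phi>0(3,4) that] by simp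
    ultimately have "(\<integral>\<^sup>+ t\<in>Ib b. ennpowr (max_rearr M g t) p' * ennreal (\<psi> t) \<partial>lebesgue)
        = (\<integral>\<^sup>+ t. ennpowr (kfun M g (ennreal t) / ennreal t) p' * ennreal (w.dual_density t) \<partial>lborel)"
      by (intro nn_integral_Ib_cong) (simp_all add: M.max_rearr_eq)
    then show ?thesis unfolding rho_def w.dual_def assms(2) p' by simp
  qed
  have total: "(\<integral>\<^sup>+ t\<in>Ib b. ennreal (\<phi> t) \<partial>lebesgue) = emeasure w.N UNIV"
    using nn_integral_Ib_cong[OF \<phi>0(4,3), of "\<lambda>_. 1" "\<lambda>_. 1"] by (simp add: w.emeasure_N)
  have avg: "avg_term g = ennreal w.e * (\<integral>\<^sup>+ x. ennreal \<bar>g x\<bar> \<partial>M)" for g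
  proof (cases "emeasure w.N UNIV = \<infinity>")
    case False
    define m where "m = measure w.N UNIV"
    have eq: "emeasure w.N UNIV = ennreal m" using False by (simp add: m_def emeasure_eq_ennreal_measure)
    have "ennreal (w.V 1) \<le> ennreal m" unfolding w.emeasure_N_atMost[symmetric] eq[symmetric] by (intro emeasure_mono) auto
    then have m: "0 < m" using w.V_pos[of 1] by (auto simp: ennreal_le_iff2)
    have "ennreal w.e = inverse (ennreal (m powr (1 / p)))"
      using False m by (simp add: w.e_def m_def[symmetric] inverse_ennreal powr_minus)
    then show ?thesis using False m
      by (simp add: avg_term_def total eq ennpowr_ennreal divide_ennreal_def mult.commute)
  qed (simp add: avg_term_def total w.e_def)
  have sup: "(\<integral>\<^sup>+x. ennreal \<bar>f x * g x\<bar> \<partial>M) \<le> rho_assoc M p \<phi> g" if "f \<in> borel_measurable M" "w.primal M f \<le> 1" for f g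
    unfolding rho_assoc_def using that assms(4) by (intro SUP_upper) (simp add: rho_p ennpowr_le_1_iff)
  \<comment> \<open>\<open>16 * p * p'\<close> and 2 are the coefficients in
    \<open>pairing_le\<close>; \<open>8 * p + 1\<close> is the sum of the constants of
    \<open>dual_le\<close> and \<open>mean_le\<close>.\<close>
  define C where "C = 16 * p * w.p' + 2 + 8 * p"
  have C: "1 \<le> C" "16 * p * w.p' \<le> C" "2 \<le> C" "8 * p + 1 \<le> C"
    using assms(4) w.p'(1) by (auto simp: C_def)
  show ?thesis
  proof (intro exI[of _ C] conjI ballI C)
    fix g :: "'a \<Rightarrow> real" assume [measurable]: "g \<in> borel_measurable M"
    show "rho_assoc M p \<phi> g \<le> ennreal C * (rho M p' \<psi> g + avg_term g)"
      unfolding rho_assoc_def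
    proof (rule SUP_least)
      fix f assume "f \<in> {f \<in> borel_measurable M. rho M p \<phi> f \<le> 1}"
      then have f: "f \<in> borel_measurable M" "w.primal M f \<le> 1" using assms(4) by (auto simp: rho_p ennpowr_le_1_iff)
      have "(\<integral>\<^sup>+x. ennreal \<bar>f x * g x\<bar> \<partial>M) \<le> ennreal (16 * p * w.p') * ennpowr (w.dual M g) (1 / w.p') + ennreal (2 * w.e) * (\<integral>\<^sup>+x. ennreal \<bar>g x\<bar> \<partial>M)"
        using f by (intro w.pairing_le assms(1)) auto
      also have "\<dots> = ennreal (16 * p * w.p') * rho M p' \<psi> g + ennreal 2 * avg_term g"
        using w.e_nonneg by (simp add: rho_p' avg ennreal_mult mult.assoc)
      also have "\<dots> \<le> ennreal C * rho M p' \<psi> g + ennreal C * avg_term g"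
        using C by (intro add_mono mult_right_mono ennreal_leI) auto
      finally show "(\<integral>\<^sup>+x. ennreal \<bar>f x * g x\<bar> \<partial>M) \<le> ennreal C * (rho M p' \<psi> g + avg_term g)" by (simp add: distrib_left)
    qed
    have "rho M p' \<psi> g + avg_term g \<le> ennreal (8 * p) * rho_assoc M p \<phi> g + rho_assoc M p \<phi> g"
      unfolding rho_p'[OF \<open>g \<in> borel_measurable M\<close>] avg
      by (intro add_mono w.dual_le w.mean_le assms(1) sup) auto
    also have "\<dots> = ennreal (8 * p + 1) * rho_assoc M p \<phi> g"
      using assms(4) by (simp add: distrib_right)
    also have "\<dots> \<le> ennreal C * rho_assoc M p \<phi> g" using C by (intro mult_right_mono ennreal_leI) auto
    finally show "rho M p' \<psi> g + avg_term g \<le> ennreal C * rho_assoc M p \<phi> g" .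
  qed
qed

end
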